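(* Let $X_1,X_2,\ldots$ be i.i.d. copies of an absolutely continuous real-valued random variable $X$ with distribution function $F$. Assume that (A1) $X$ possesses a finite mean $\mu$ and variance $\sigma^2$, and (A2) the probability density function of $X$ is continuous in a neighbourhood of $\mu$. Then, under the null hypothesis $H_0$ that $F$ is symmetric, $-2\log\mathcal{R}^{ad}$ converges in distribution to $\chi^2_1$ (the chi-square distribution with one degree of freedom) as $n\to\infty$, where $\mathcal{R}^{ad}$ is the adjusted jackknife empirical likelihood ratio defined in the context.
   Context: $F$ is called symmetric if there is a point $m\in\mathbb{R}$ such that $F(m+x)=1-F(m-x)$ for all $x\in\mathbb{R}$. Define the $U$-statistic $$\widehat{\Delta}_n=\binom{n}{3}^{-1}\sum_{1\le k<j<i\le n}h(X_i,X_j,X_k),$$ with symmetric kernel $$h(x_1,x_2,x_3)=\frac13\left(\frac{3\max(x_1,x_2,x_3)+3\min(x_1,x_2,x_3)}{2}-(x_1+x_2+x_3)\right).$$ The jackknife pseudo-values are $$\widehat{\mathcal{V}}_i=n\widehat{\Delta}_n-(n-1)\widehat{\Delta}^{(-i)}_{n-1},\qquad i=1,\ldots,n,$$ where $\widehat{\Delta}^{(-i)}_{n-1}$ is the same $U$-statistic computed from the sample $X_1,\ldots,X_n$ with the $i$-th observation excluded. The adjusted pseudo-values are $$\widehat{\mathcal{W}}_i=\widehat{\mathcal{V}}_i\ \ (i=1,\ldots,n),\qquad \widehat{\mathcal{W}}_{n+1}=-\max\Big(1,\frac{\log n}{2}\Big)\frac1n\sum_{i=1}^n\widehat{\mathcal{V}}_i.$$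 The adjusted jackknife empirical likelihood ratio is $$\mathcal{R}^{ad}=\max\left\{\prod_{i=1}^{n+1}(n+1)p_i:\ \sum_{i=1}^{n+1}p_i=1,\ p_i\ge0,\ \sum_{i=1}^{n+1}p_i\widehat{\mathcal{W}}_i=0\right\}.$$ *)

theory Defs
  imports "HOL-Probability.Probability"
begin

definition symmetric_cdf :: "(real \<Rightarrow> real) \<Rightarrow> bool" where
  "symmetric_cdf F \<longleftrightarrow> (\<exists>m. \<forall>x. F (m + x) = 1 - F (m - x))"

(* The chi-square distribution with d degrees of freedom: the law of the sum of the
   squares of d independent standard normal variables. *)
definition chi_square_measure :: "nat \<Rightarrow> real measure" where
  "chi_square_measure d =
     distr (\<Pi>\<^sub>M i\<in>{..<d}. density lborel std_normal_density) borel (\<lambda>z. \<Sum>i<d. (z i)\<^sup>2)"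

definition sym_kernel :: "real \<Rightarrow> real \<Rightarrow> real \<Rightarrow> real" where
  "sym_kernel x1 x2 x3 =
     1 / 3 * ((3 * max x1 (max x2 x3) + 3 * min x1 (min x2 x3)) / 2 - (x1 + x2 + x3))"

(* The U-statistic of the sub-sample of x indexed by I: I = {1..n} is the full sample,
   I = {1..n} - {i} the sample without its i-th observation. *)
definition U_stat :: "nat set \<Rightarrow> (nat \<Rightarrow> real) \<Rightarrow> real" where
  "U_stat I x =
     inverse (real (card I choose 3)) *
     (\<Sum>(k, j, i) \<in> {(k, j, i). k \<in> I \<and> j \<in> I \<and> i \<in> I \<and> k < j \<and> j < i}.
        sym_kernel (x i) (x j) (x k))"

definition pseudo_value :: "nat \<Rightarrow> (nat \<Rightarrow> real) \<Rightarrow> nat \<Rightarrow> real" where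
  "pseudo_value n x i = real n * U_stat {1..n} x - (real n - 1) * U_stat ({1..n} - {i}) x"

definition adj_pseudo_value :: "nat \<Rightarrow> (nat \<Rightarrow> real) \<Rightarrow> nat \<Rightarrow> real" where
  "adj_pseudo_value n x i =
     (if i = n + 1
      then - max 1 (ln (real n) / 2) * (1 / real n) * (\<Sum>l = 1..n. pseudo_value n x l)
      else pseudo_value n x i)"

definition adj_jel_ratio :: "nat \<Rightarrow> (nat \<Rightarrow> real) \<Rightarrow> real" where
  "adj_jel_ratio n x =
     (GREATEST r. \<exists>p :: nat \<Rightarrow> real.
        r = (\<Prod>i = 1..n + 1. real (n + 1) * p i) \<and>
        (\<Sum>i = 1..n + 1. p i) = 1 \<and>
        (\<forall>i \<in> {1..n + 1}. 0 \<le> p i) \<and>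
        (\<Sum>i = 1..n + 1. p i * adj_pseudo_value n x i) = 0)"

end

theory Submission
  imports Defs
begin

text \<open>
  By Lagrangian duality \<open>-2 log R\<close> is twice the maximum over \<open>l\<close> of the concave function
  \<open>\<Sum> ln (1 + l W\<^sub>i)\<close>. The added pseudo-value has the opposite sign of the mean of the others, so
  the maximum is always attained in the interior. If \<open>max \<bar>W\<^sub>i\<bar>\<close> is of smaller order than \<open>sqrt n\<close>, the
  maximum is asymptotically \<open>(\<Sum> W\<^sub>i)\<^sup>2 / \<Sum> W\<^sub>i\<^sup>2\<close>.

  The kernel is half the difference of mean and median of three points, so under symmetry it is
  centred. With \<open>h\<^sub>1\<close> its projection onto one variable, Hoeffding's decomposition gives
  \<open>V\<^sub>i = 3 h\<^sub>1(X\<^sub>i) + r\<^sub>i\<close> with \<open>E r\<^sub>i\<^sup>2 = O(1/n)\<close>, because remainders of triples that share at most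
  one index are orthogonal. The central limit theorem for \<open>\<Sum> 3 h\<^sub>1(X\<^sub>i)\<close> and the law of large
  numbers for its squares then give the chi-square limit. The limit variance is positive since
  \<open>h\<^sub>1\<close> is strictly increasing in the lower tail of an atomless distribution.
\<close>

subsection \<open>Duality for the empirical likelihood\<close>

text \<open>The statistic is a \<open>GREATEST\<close> over weight vectors, evaluated at dependent
  pseudo-values, so the proof keeps analysis and probability apart. The quadratic expansion concerns
  real numbers along an arbitrary filter; the probabilistic part only shows that a few averages are
  close to their limits off a small event. \<open>jel_stat_eq_square_on_good_event\<close> joins the
  two by contradiction. Measurability of the maximum comes from rational multipliers. The remainders
  r_i have to be estimated twice. The bound O(1/n) for each of them controls the sum of squares, but
  through Cauchy-Schwarz it bounds the second moment of their sum only by O(n), which is too weak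
  after division by sqrt n. The sum is therefore computed exactly: the contributions of the triples
  cancel down to a single sum with one small factor. Only second moments of h_1(X_i) are at hand.
  Hence the law of large numbers for the squares goes through truncation, and the bound on the
  largest term through the tail of the second moment.\<close>

definition loglik :: "'i set \<Rightarrow> ('i \<Rightarrow> real) \<Rightarrow> real \<Rightarrow> real" where
  "loglik I w l = (\<Sum>k\<in>I. ln (1 + l * w k))"

text \<open>The first-order condition for \<open>loglik\<close> on the open region where all
  logarithms have positive arguments. The objective is concave there, so a stationary point is
  already a global maximum.\<close>

definition multiplier :: "'i set \<Rightarrow> ('i \<Rightarrow> real) \<Rightarrow> real \<Rightarrow> bool" where
  "multiplier I w l \<longleftrightarrow> (\<forall>k\<in>I. 0 < 1 + l * w k) \<and> (\<Sum>k\<in>I. w k / (1 + l * w k)) = 0"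

text \<open>The product of the factors replaces the sum of logarithms: it is continuous up to the
  boundary of the admissible region, where some factor vanishes and the logarithm would diverge. A
  maximizer of the product on the compact region is interior, and there the logarithmic derivative
  is zero.\<close>

lemma multiplier_exists_signs:
  fixes w :: "'i \<Rightarrow> real"
  assumes fin: "finite I" and neg: "i \<in> I" "w i < 0" and pos: "j \<in> I" "w j > 0"
  obtains l where "multiplier I w l"
proof -
  define P where "P l = (\<Prod>k\<in>I. 1 + l * w k)" for l
  define K where "K = (\<Inter>k\<in>I. {l. 0 \<le> 1 + l * w k})"
  have "closed K"
    unfolding K_def by (intro closed_INT ballI closed_Collect_le continuous_intros)
  \<comment> \<open>A negative entry bounds the multiplier from above and a positive one from below;
    this is where both signs are used.\<close>
  moreover have "K \<subseteq> {- 1 / w j .. - 1 / w i}"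
  proof
    fix x assume "x \<in> K"
    then have "0 \<le> 1 + x * w i" "0 \<le> 1 + x * w j" using neg pos by (auto simp: K_def)
    then show "x \<in> {- 1 / w j .. - 1 / w i}" using neg pos by (auto simp: field_simps)
  qed
  ultimately have "compact K"
    using bounded_subset[OF bounded_closed_interval] compact_eq_bounded_closed by blast
  moreover have "0 \<in> K" by (simp add: K_def)
  moreover have "continuous_on K P" unfolding P_def by (intro continuous_intros)
  ultimately obtain l where l: "l \<in> K" "\<And>y. y \<in> K \<Longrightarrow> P y \<le> P l"
    using continuous_attains_sup[of K P] by blast
  \<comment> \<open>The product is 1 at 0, so its maximum cannot lie where a factor
    vanishes.\<close>
  have "1 \<le> P l" using l(2)[OF \<open>0 \<in> K\<close>] by (simp add: P_def)
  then have "P l \<noteq> 0" by simp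
  then have lpos: "0 < 1 + l * w k" if "k \<in> I" for k
    using l(1) that fin by (auto simp: K_def P_def order_less_le)
  have "\<forall>\<^sub>F y in nhds l. \<forall>k\<in>I. 0 < 1 + y * w k"
  proof (intro eventually_ball_finite[OF fin] ballI)
    fix k assume "k \<in> I"
    show "\<forall>\<^sub>F y in nhds l. 0 < 1 + y * w k"
      by (rule order_tendstoD(1)[OF _ lpos[OF \<open>k \<in> I\<close>]]) (intro tendsto_intros filterlim_ident)
  qed
  then obtain d where d: "d > 0" "\<And>y. dist y l < d \<Longrightarrow> \<forall>k\<in>I. 0 < 1 + y * w k"
    unfolding eventually_nhds_metric by blast
  define G where "G y = (\<Sum>k\<in>I. ln (1 + y * w k))" for y
  have G: "G y = ln (P y)" if "\<forall>k\<in>I. 0 < 1 + y * w k" for y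
    unfolding G_def P_def by (rule ln_prod[symmetric]) (use that fin in auto)
  have "\<forall>y. \<bar>l - y\<bar> < d \<longrightarrow> G y \<le> G l"
  proof (intro allI impI)
    fix y assume "\<bar>l - y\<bar> < d"
    then have y: "\<forall>k\<in>I. 0 < 1 + y * w k" using d(2)[of y] by (simp add: dist_real_def abs_minus_commute)
    then have "y \<in> K" by (auto simp: K_def order_less_imp_le)
    moreover have "0 < P y" using y by (auto simp: P_def intro!: prod_pos)
    ultimately show "G y \<le> G l" using G[OF y] G[of l] lpos l(2)[of y] by simp
  qed
  moreover have "(G has_field_derivative (\<Sum>k\<in>I. w k / (1 + l * w k))) (at l)"
    unfolding G_def using lpos
    by (auto intro!: derivative_eq_intros sum.cong)
  ultimately have "(\<Sum>k\<in>I. w k / (1 + l * w k)) = 0"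
    using DERIV_local_max d(1) by blast
  with lpos show thesis by (intro that[of l]) (simp add: multiplier_def)
qed

text \<open>A vanishing combination with positive coefficients leaves two possibilities: all entries
  are zero, or both signs occur.\<close>

lemma multiplier_exists:
  fixes w :: "'i \<Rightarrow> real"
  assumes fin: "finite I" and b: "\<And>k. k \<in> I \<Longrightarrow> 0 < b k" "(\<Sum>k\<in>I. b k * w k) = 0"
  obtains l where "multiplier I w l"
proof (cases "\<forall>k\<in>I. w k = 0")
  case True
  then have "multiplier I w 0" by (simp add: multiplier_def)
  then show thesis by (rule that)
next
  case False
  have "\<exists>i\<in>I. w i < 0"
  proof (rule ccontr)
    assume "\<not> ?thesis"
    then have "\<forall>k\<in>I. 0 \<le> b k * w k" using b(1) by (auto simp: not_less less_imp_le)
    then have "\<forall>k\<in>I. b k * w k = 0" using b(2) fin by (simp add: sum_nonneg_eq_0_iff)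
    with False b(1) show False by force
  qed
  moreover have "\<exists>i\<in>I. 0 < w i"
  proof (rule ccontr)
    assume "\<not> ?thesis"
    then have "\<forall>k\<in>I. 0 \<le> - (b k * w k)"
      using b(1) by (auto simp: not_less less_imp_le mult_nonneg_nonpos)
    then have "\<forall>k\<in>I. - (b k * w k) = 0" using b(2) fin
      by (subst sum_nonneg_eq_0_iff[symmetric]) (auto simp: sum_negf)
    with False b(1) show False by force
  qed
  ultimately show thesis using multiplier_exists_signs[OF fin] that by metis
qed

text \<open>Each logarithm lies below its tangent at \<open>1 + l * w k\<close>. The tangent terms
  sum to a multiple of the stationarity equation and disappear.\<close>

lemma loglik_le_multiplier:
  assumes "multiplier I w l" and l': "\<And>k. k \<in> I \<Longrightarrow> 0 < 1 + l' * w k"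
  shows "loglik I w l' \<le> loglik I w l"
proof -
  have l: "\<And>k. k \<in> I \<Longrightarrow> 0 < 1 + l * w k" and z: "(\<Sum>k\<in>I. w k / (1 + l * w k)) = 0"
    using assms(1) by (auto simp: multiplier_def)
  have "ln (1 + l' * w k) - ln (1 + l * w k) \<le> (l' - l) * (w k / (1 + l * w k))" if "k \<in> I" for k
  proof -
    have "ln (1 + l' * w k) - ln (1 + l * w k) \<le> ((1 + l' * w k) - (1 + l * w k)) / (1 + l * w k)"
      by (rule ln_diff_le) (use l l' that in auto)
    then show ?thesis by (simp add: field_simps)
  qed
  then have "(\<Sum>k\<in>I. ln (1 + l' * w k) - ln (1 + l * w k)) \<le> (\<Sum>k\<in>I. (l' - l) * (w k / (1 + l * w k)))"
    by (rule sum_mono)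
  also have "\<dots> = 0" using z by (simp only: sum_distrib_left[symmetric])
  finally show ?thesis by (simp add: loglik_def sum_subtractf)
qed

text \<open>The Lagrange conditions suggest the weights \<open>1 / (N * (1 + l * w k))\<close> with
  \<open>N = card I\<close>; they are feasible and attain the value. The converse bound uses only
  \<open>x <= exp (x - 1)\<close>, applied to the ratio of an arbitrary feasible weight to the
  optimal one.\<close>

lemma greatest_likelihood_ratio:
  fixes w :: "'i \<Rightarrow> real"
  assumes fin: "finite I" and ne: "I \<noteq> {}" and l: "multiplier I w l"
  shows "(GREATEST r. \<exists>p. r = (\<Prod>k\<in>I. real (card I) * p k) \<and> (\<Sum>k\<in>I. p k) = 1 \<and>
            (\<forall>k\<in>I. 0 \<le> p k) \<and> (\<Sum>k\<in>I. p k * w k) = 0) = exp (- loglik I w l)"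
proof (rule Greatest_equality)
  have lpos: "\<And>k. k \<in> I \<Longrightarrow> 0 < 1 + l * w k" and z: "(\<Sum>k\<in>I. w k / (1 + l * w k)) = 0"
    using l by (auto simp: multiplier_def)
  have E: "exp (- loglik I w l) = (\<Prod>k\<in>I. 1 / (1 + l * w k))"
    unfolding loglik_def sum_negf[symmetric] exp_sum[OF fin]
    using lpos by (intro prod.cong) (auto simp: exp_minus field_simps)
  let ?N = "real (card I)"
  have N: "?N > 0" using fin ne by (simp add: card_gt_0_iff)
  let ?p = "\<lambda>k. 1 / (?N * (1 + l * w k))"
  \<comment> \<open>Summed over \<open>I\<close>, this identity and stationarity make the candidate
    weights add up to 1.\<close>
  have "1 / (1 + l * w k) = 1 - l * (w k / (1 + l * w k))" if "k \<in> I" for k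
    using lpos[OF that] by (simp add: field_simps)
  then have "(\<Sum>k\<in>I. 1 / (1 + l * w k)) = ?N - l * (\<Sum>k\<in>I. w k / (1 + l * w k))"
    by (simp add: sum_subtractf sum_distrib_left)
  then have P1: "(\<Sum>k\<in>I. 1 / (1 + l * w k)) = ?N" using z by simp
  have "(\<Sum>k\<in>I. ?p k) = 1"
  proof -
    have "(\<Sum>k\<in>I. ?p k) = (\<Sum>k\<in>I. 1 / (1 + l * w k)) / ?N"
      unfolding sum_divide_distrib by (simp add: mult.commute)
    then show ?thesis using N P1 by simp
  qed
  moreover have "(\<Sum>k\<in>I. ?p k * w k) = 0"
  proof -
    have "(\<Sum>k\<in>I. ?p k * w k) = (\<Sum>k\<in>I. w k / (1 + l * w k)) / ?N"
      by (simp add: sum_divide_distrib mult.commute)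
    then show ?thesis using z by simp
  qed
  moreover have "(\<Prod>k\<in>I. ?N * ?p k) = exp (- loglik I w l)"
    unfolding E using N by (intro prod.cong) auto
  moreover have "\<forall>k\<in>I. 0 \<le> ?p k" using lpos N by (auto simp: less_imp_le)
  ultimately show "\<exists>p. exp (- loglik I w l) = (\<Prod>k\<in>I. ?N * p k) \<and> (\<Sum>k\<in>I. p k) = 1 \<and>
            (\<forall>k\<in>I. 0 \<le> p k) \<and> (\<Sum>k\<in>I. p k * w k) = 0"
    by (intro exI[of _ ?p]) auto
  fix r assume "\<exists>p. r = (\<Prod>k\<in>I. ?N * p k) \<and> (\<Sum>k\<in>I. p k) = 1 \<and>
            (\<forall>k\<in>I. 0 \<le> p k) \<and> (\<Sum>k\<in>I. p k * w k) = 0"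
  then obtain p where r: "r = (\<Prod>k\<in>I. ?N * p k)" and p: "(\<Sum>k\<in>I. p k) = 1"
     "\<forall>k\<in>I. 0 \<le> p k" "(\<Sum>k\<in>I. p k * w k) = 0" by blast
  \<comment> \<open>The two constraints on \<open>p\<close> give these ratios the average 1, so the
    exponents \<open>?x k - 1\<close> sum to 0.\<close>
  let ?x = "\<lambda>k. ?N * p k * (1 + l * w k)"
  have "(\<Prod>k\<in>I. ?x k) \<le> (\<Prod>k\<in>I. exp (?x k - 1))"
  proof (rule prod_mono, intro conjI)
    fix k assume k: "k \<in> I"
    show "0 \<le> ?x k" using p(2) lpos[OF k] k by simp
    show "?x k \<le> exp (?x k - 1)" using exp_ge_add_one_self[of "?x k - 1"] by simp
  qed
  also have "\<dots> = exp (\<Sum>k\<in>I. ?x k - 1)" by (simp add: exp_sum fin)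
  also have "(\<Sum>k\<in>I. ?x k - 1) = ?N * ((\<Sum>k\<in>I. p k) + l * (\<Sum>k\<in>I. p k * w k)) - ?N"
    by (simp add: sum_subtractf sum_distrib_left sum_distrib_right sum.distrib algebra_simps)
  also have "\<dots> = 0" using p by simp
  finally have "(\<Prod>k\<in>I. ?N * p k) * (\<Prod>k\<in>I. 1 + l * w k) \<le> 1"
    by (simp add: prod.distrib mult.assoc)
  moreover have "0 < (\<Prod>k\<in>I. 1 + l * w k)" using lpos by (intro prod_pos) auto
  ultimately show "r \<le> exp (- loglik I w l)"
    unfolding E r by (simp add: prod_dividef field_simps)
qed

section \<open>Second-order expansion of the dual objective and of its maximum\<close>

lemma ln_add_one_quadratic_bound:
  fixes y :: real
  assumes "\<bar>y\<bar> \<le> d" "d \<le> 1 / 2"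
  shows "\<bar>ln (1 + y) - (y - y\<^sup>2 / 2)\<bar> \<le> 2 * d * y\<^sup>2"
proof -
  define r where "r t = ln (1 + t) - (t - t\<^sup>2 / 2)" for t :: real
  \<comment> \<open>The remainder has derivative t^2 / (1 + t), and \<open>1 + t\<close> is at least
    1/2 on the interval.\<close>
  have "norm (r y - r 0) \<le> 2 * y\<^sup>2 * norm (y - 0)"
  proof (rule field_differentiable_bound[where S = "cball 0 \<bar>y\<bar>" and f' = "\<lambda>t. t\<^sup>2 / (1 + t)"])
    fix t :: real assume "t \<in> cball 0 \<bar>y\<bar>"
    then have t: "\<bar>t\<bar> \<le> \<bar>y\<bar>" "\<bar>t\<bar> \<le> 1 / 2" using assms by (auto simp: dist_real_def)
    show "(r has_field_derivative t\<^sup>2 / (1 + t)) (at t within cball 0 \<bar>y\<bar>)"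
      unfolding r_def using t
      by (auto intro!: derivative_eq_intros simp: field_simps power2_eq_square)
    have "t\<^sup>2 / (1 + t) \<le> y\<^sup>2 / (1 / 2)"
      using t by (intro frac_le) (auto simp: abs_le_square_iff)
    then show "norm (t\<^sup>2 / (1 + t)) \<le> 2 * y\<^sup>2" using t by simp
  qed auto
  also have "\<dots> \<le> 2 * y\<^sup>2 * d" using assms by (intro mult_left_mono) auto
  finally show ?thesis by (simp add: r_def mult_ac)
qed

lemma loglik_quadratic_bound:
  assumes fin: "finite I" and m: "\<And>k. k \<in> I \<Longrightarrow> \<bar>w k\<bar> \<le> m" and d: "\<bar>l\<bar> * m \<le> d" "d \<le> 1 / 2"
  shows "\<bar>loglik I w l - (l * (\<Sum>k\<in>I. w k) - l\<^sup>2 * (\<Sum>k\<in>I. (w k)\<^sup>2) / 2)\<bar>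
           \<le> 2 * d * l\<^sup>2 * (\<Sum>k\<in>I. (w k)\<^sup>2)"
proof -
  have "\<bar>ln (1 + l * w k) - (l * w k - (l * w k)\<^sup>2 / 2)\<bar> \<le> 2 * d * (l * w k)\<^sup>2" if "k \<in> I" for k
  proof (rule ln_add_one_quadratic_bound[OF _ d(2)])
    have "\<bar>l * w k\<bar> \<le> \<bar>l\<bar> * m" using m[OF that] by (simp add: abs_mult mult_left_mono)
    with d(1) show "\<bar>l * w k\<bar> \<le> d" by simp
  qed
  then have "\<bar>\<Sum>k\<in>I. ln (1 + l * w k) - (l * w k - (l * w k)\<^sup>2 / 2)\<bar> \<le> (\<Sum>k\<in>I. 2 * d * (l * w k)\<^sup>2)"
    by (intro order_trans[OF sum_abs] sum_mono)
  then show ?thesis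
    by (simp add: loglik_def sum_subtractf sum_distrib_left[symmetric] sum_divide_distrib[symmetric]
        power_mult_distrib mult.assoc)
qed

text \<open>Concavity on the segment from 0 to \<open>l\<close>, where the value at 0 is 0.\<close>

lemma loglik_scale:
  assumes l: "\<And>k. k \<in> I \<Longrightarrow> 0 < 1 + l * w k" and t: "0 \<le> t" "t \<le> 1"
  shows "t * loglik I w l \<le> loglik I w (t * l)"
  unfolding loglik_def sum_distrib_left
proof (rule sum_mono)
  fix k assume "k \<in> I"
  have "(1 - t) * ln 1 + t * ln (1 + l * w k) \<le> ln ((1 - t) *\<^sub>R 1 + t *\<^sub>R (1 + l * w k))"
    using concave_onD[OF ln_concave t, of 1 "1 + l * w k"] l[OF \<open>k \<in> I\<close>] by simp
  then show "t * ln (1 + l * w k) \<le> ln (1 + t * l * w k)" by (simp add: algebra_simps)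
qed

text \<open>The lower bound evaluates the objective at \<open>S / Q\<close>, the maximizer of its
  quadratic part. For the upper bound the expansion applies directly when \<open>l\<close> is small.
  A large \<open>l\<close> is pulled back along the ray to the edge of the region where the
  expansion holds; there the quadratic term dominates, so by concavity the value at \<open>l\<close>
  is not positive either.\<close>

lemma max_loglik_bounds:
  assumes fin: "finite I" and mult: "multiplier I w l"
    and S: "S = (\<Sum>k\<in>I. w k)" and Q: "Q = (\<Sum>k\<in>I. (w k)\<^sup>2)" "0 < Q"
    and m: "\<And>k. k \<in> I \<Longrightarrow> \<bar>w k\<bar> \<le> m" "0 < m"
    and d: "0 < d" "d \<le> 1 / 8" and small: "m * \<bar>S\<bar> / Q \<le> d / 4"
  shows "(1 - 4 * d) * (S\<^sup>2 / Q) \<le> 2 * loglik I w l" "2 * loglik I w l \<le> S\<^sup>2 / Q / (1 - 4 * d)"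
proof -
  have lpos: "\<And>k. k \<in> I \<Longrightarrow> 0 < 1 + l * w k" using mult by (simp add: multiplier_def)
  have B: "\<bar>loglik I w a - (a * S - a\<^sup>2 * Q / 2)\<bar> \<le> 2 * d * a\<^sup>2 * Q" if "\<bar>a\<bar> * m \<le> d" for a
    unfolding S Q(1) by (rule loglik_quadratic_bound[OF fin m(1) that]) (use d in auto)
  have small': "\<bar>S / Q\<bar> * m \<le> d"
  proof -
    have "m * \<bar>S\<bar> / Q \<le> d" using small d by linarith
    then show ?thesis using Q(2) by (simp add: abs_divide mult.commute)
  qed
  have "0 < 1 + S / Q * w k" if "k \<in> I" for k
  proof -
    have "\<bar>S / Q * w k\<bar> \<le> \<bar>S / Q\<bar> * m"
      unfolding abs_mult using m(1)[OF that] by (rule mult_left_mono) simp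
    then have "\<bar>S / Q * w k\<bar> < 1" using small' d by linarith
    then show ?thesis by linarith
  qed
  then have "loglik I w (S / Q) \<le> loglik I w l" by (rule loglik_le_multiplier[OF mult])
  then have "S / Q * S - (S / Q)\<^sup>2 * Q / 2 - 2 * d * (S / Q)\<^sup>2 * Q \<le> loglik I w l"
    using B[OF small'] by linarith
  moreover have "S / Q * S - (S / Q)\<^sup>2 * Q / 2 - 2 * d * (S / Q)\<^sup>2 * Q = (1 - 4 * d) * (S\<^sup>2 / Q) / 2"
    using Q(2) by (simp add: power2_eq_square field_simps)
  ultimately have "(1 - 4 * d) * (S\<^sup>2 / Q) / 2 \<le> loglik I w l" by (simp only:)
  moreover have "a \<le> 2 * b" if "a / 2 \<le> b" for a b :: real using that by simp
  ultimately show "(1 - 4 * d) * (S\<^sup>2 / Q) \<le> 2 * loglik I w l" by blast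
  show "2 * loglik I w l \<le> S\<^sup>2 / Q / (1 - 4 * d)"
  proof (cases "\<bar>l\<bar> * m \<le> d")
    case True
    define c where "c = 1 - 4 * d"
    have c: "c > 0" using d by (simp add: c_def)
    have "2 * loglik I w l \<le> 2 * l * S - c * l\<^sup>2 * Q"
      using B[OF True] unfolding c_def by (simp add: algebra_simps abs_le_iff)
    also have "\<dots> \<le> S\<^sup>2 / Q / c"
    proof -
      \<comment> \<open>Completing the square in \<open>l\<close>.\<close>
      have "0 \<le> (S - c * l * Q)\<^sup>2" by simp
      then have "(2 * l * S - c * l\<^sup>2 * Q) * (Q * c) \<le> S\<^sup>2"
        by (simp add: power2_eq_square algebra_simps)
      then show ?thesis using Q(2) c by (simp add: pos_le_divide_eq)
    qed
    finally show ?thesis by (simp add: c_def)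
  next
    case False
    \<comment> \<open>The scaling that makes the modulus of \<open>a\<close> times \<open>m\<close>
      equal to \<open>d\<close>, the limit of the quadratic expansion.\<close>
    define t where "t = d / (\<bar>l\<bar> * m)"
    define a where "a = t * l"
    have lm: "0 < \<bar>l\<bar> * m" using False d by linarith
    then have t: "0 < t" "t \<le> 1" using False d by (auto simp: t_def)
    have am: "\<bar>a\<bar> * m = d" using lm m(2) d(1) by (auto simp: a_def t_def abs_mult)
    then have am': "\<bar>a\<bar> = d / m" using m(2) by (simp add: field_simps)
    have "t * loglik I w l \<le> loglik I w a"
      unfolding a_def by (rule loglik_scale) (use lpos t in auto)
    also have "\<dots> \<le> a * S - (1 / 2 - 2 * d) * a\<^sup>2 * Q"
      using B[of a] am by (simp add: algebra_simps abs_le_iff)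
    also have "\<dots> \<le> \<bar>a\<bar> * \<bar>S\<bar> - 1 / 4 * a\<^sup>2 * Q"
    proof -
      \<comment> \<open>From \<open>d <= 1 / 8\<close> the coefficient is at least 1/4, which is
        what the \<open>d / 4\<close> in the assumption \<open>small\<close> is matched to.\<close>
      have "1 / 4 * (a\<^sup>2 * Q) \<le> (1 / 2 - 2 * d) * (a\<^sup>2 * Q)"
        using d Q(2) by (intro mult_right_mono) auto
      moreover have "a * S \<le> \<bar>a\<bar> * \<bar>S\<bar>" by (metis abs_ge_self abs_mult)
      ultimately show ?thesis by (simp add: mult.assoc)
    qed
    also have "\<dots> = \<bar>a\<bar> * (\<bar>S\<bar> - 1 / 4 * (d / m) * Q)"
    proof -
      have "a\<^sup>2 = \<bar>a\<bar> * \<bar>a\<bar>" by (simp add: power2_eq_square)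
      then show ?thesis unfolding am'[symmetric]
        by (simp only:) (simp add: right_diff_distrib mult_ac del: abs_mult_self_eq)
    qed
    also have "\<dots> \<le> 0"
    proof -
      have "\<bar>S\<bar> \<le> 1 / 4 * (d / m) * Q" using small m(2) Q(2) by (simp add: field_simps)
      then show ?thesis by (simp add: mult_nonneg_nonpos)
    qed
    finally have "loglik I w l \<le> 0" using t(1) by (simp add: mult_le_0_iff)
    moreover have "0 \<le> S\<^sup>2 / Q / (1 - 4 * d)" using Q(2) d by simp
    ultimately show ?thesis by linarith
  qed
qed

section \<open>Duality and measurability for the adjusted pseudo-values\<close>

lemma adj_jel_ratio_multiplier:
  assumes n: "n \<ge> 1"
  obtains l where "multiplier {1..n + 1} (adj_pseudo_value n x) l"
    "- 2 * ln (adj_jel_ratio n x) = 2 * loglik {1..n + 1} (adj_pseudo_value n x) l"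
proof -
  define c where "c = max 1 (ln (real n) / 2) * (1 / real n)"
  have c: "c > 0" using n by (simp add: c_def less_max_iff_disj)
  \<comment> \<open>The added value is \<open>- c\<close> times the sum of the others, so
    coefficient 1 on it and \<open>c\<close> on the others give zero. Positivity of \<open>c\<close>
    holds whatever the sample.\<close>
  let ?b = "\<lambda>k. if k = n + 1 then 1 else c"
  have "(\<Sum>k\<in>{1..n + 1}. ?b k * adj_pseudo_value n x k)
      = (\<Sum>k\<in>{1..n}. c * pseudo_value n x k) + adj_pseudo_value n x (n + 1)"
    by (simp add: adj_pseudo_value_def)
  also have "\<dots> = 0"
    by (simp add: adj_pseudo_value_def c_def sum_distrib_left sum_negf)
  finally have "(\<Sum>k\<in>{1..n + 1}. ?b k * adj_pseudo_value n x k) = 0" .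
  then obtain l where l: "multiplier {1..n + 1} (adj_pseudo_value n x) l"
    using c by (elim multiplier_exists[rotated 2]) (auto split: if_splits)
  have "adj_jel_ratio n x = exp (- loglik {1..n + 1} (adj_pseudo_value n x) l)"
    using greatest_likelihood_ratio[OF _ _ l] unfolding adj_jel_ratio_def by simp
  with l show thesis by (intro that) auto
qed

text \<open>For measurability: the maximizing multiplier depends on the sample in an uncontrolled
  way. Admissibility and exceeding \<open>a\<close> are open conditions in the multiplier, however,
  so a rational one near the maximizer also satisfies them, and a countable union suffices.\<close>

lemma jel_statistic_greater_iff:
  assumes n: "n \<ge> 1"
  shows "a < - 2 * ln (adj_jel_ratio n x) \<longleftrightarrow>
    (\<exists>q\<in>\<rat>. (\<forall>k\<in>{1..n + 1}. 0 < 1 + q * adj_pseudo_value n x k) \<and>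
       a < 2 * loglik {1..n + 1} (adj_pseudo_value n x) q)"
proof -
  let ?I = "{1..n + 1}" and ?w = "adj_pseudo_value n x"
  obtain l where l: "multiplier ?I ?w l" "- 2 * ln (adj_jel_ratio n x) = 2 * loglik ?I ?w l"
    using adj_jel_ratio_multiplier[OF n] by blast
  have lpos: "\<And>k. k \<in> ?I \<Longrightarrow> 0 < 1 + l * ?w k" using l(1) unfolding multiplier_def by blast
  show ?thesis unfolding l(2)
  proof
    assume a: "a < 2 * loglik ?I ?w l"
    have "\<forall>\<^sub>F y in nhds l. \<forall>k\<in>?I. 0 < 1 + y * ?w k"
    proof (intro eventually_ball_finite ballI)
      fix k assume "k \<in> ?I"
      show "\<forall>\<^sub>F y in nhds l. 0 < 1 + y * ?w k"
        by (rule order_tendstoD(1)[OF _ lpos[OF \<open>k \<in> ?I\<close>]]) (intro tendsto_intros filterlim_ident)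
    qed simp
    moreover have "((\<lambda>y. 2 * loglik ?I ?w y) \<longlongrightarrow> 2 * loglik ?I ?w l) (nhds l)"
      unfolding loglik_def using lpos by (intro tendsto_intros filterlim_ident) force
    then have "\<forall>\<^sub>F y in nhds l. a < 2 * loglik ?I ?w y"
      using a by (rule order_tendstoD)
    ultimately have "\<forall>\<^sub>F y in nhds l. (\<forall>k\<in>?I. 0 < 1 + y * ?w k) \<and> a < 2 * loglik ?I ?w y"
      by (rule eventually_conj)
    then obtain d where d: "d > 0" "\<And>y. dist y l < d \<Longrightarrow> (\<forall>k\<in>?I. 0 < 1 + y * ?w k) \<and> a < 2 * loglik ?I ?w y"
      unfolding eventually_nhds_metric by blast
    obtain q where "q \<in> \<rat>" "l < q" "q < l + d" using Rats_dense_in_real[of l "l + d"] d(1) by auto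
    then show "\<exists>q\<in>\<rat>. (\<forall>k\<in>?I. 0 < 1 + q * ?w k) \<and> a < 2 * loglik ?I ?w q"
      using d(2)[of q] by (auto simp: dist_real_def)
  next
    assume "\<exists>q\<in>\<rat>. (\<forall>k\<in>?I. 0 < 1 + q * ?w k) \<and> a < 2 * loglik ?I ?w q"
    then obtain q where "\<forall>k\<in>?I. 0 < 1 + q * ?w k" and a: "a < 2 * loglik ?I ?w q" by blast
    then have "loglik ?I ?w q \<le> loglik ?I ?w l" using loglik_le_multiplier[OF l(1)] by blast
    with a show "a < 2 * loglik ?I ?w l" by linarith
  qed
qed

lemma jel_statistic_measurable:
  assumes n: "n \<ge> 1"
    and [measurable]: "\<And>k. (\<lambda>\<omega>. adj_pseudo_value n (x \<omega>) k) \<in> borel_measurable M"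
  shows "(\<lambda>\<omega>. - 2 * ln (adj_jel_ratio n (x \<omega>))) \<in> borel_measurable M"
proof (rule borel_measurableI_greater)
  fix a
  have "{\<omega> \<in> space M. a < - 2 * ln (adj_jel_ratio n (x \<omega>))} =
     (\<Union>q\<in>\<rat>. {\<omega> \<in> space M. (\<forall>k\<in>{1..n + 1}. 0 < 1 + q * adj_pseudo_value n (x \<omega>) k) \<and>
       a < 2 * loglik {1..n + 1} (adj_pseudo_value n (x \<omega>)) q})"
    unfolding jel_statistic_greater_iff[OF n] by blast
  also have "\<dots> \<in> sets M"
    unfolding loglik_def by (intro sets.countable_UN'' countable_rat) measurable
  finally show "{\<omega> \<in> space M. a < - 2 * ln (adj_jel_ratio n (x \<omega>))} \<in> sets M" .
qed

subsection \<open>Pseudo-values and the linear part of the kernel\<close>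

text \<open>Maximum plus minimum is the sum minus the median. In this form the dependence on one
  argument is easy to follow: the median is that argument clipped between the other two.\<close>

lemma sym_kernel_eq_mean_median:
  "sym_kernel x y z = ((x + y + z) / 3 - max (min x y) (min (max x y) z)) / 2"
  unfolding sym_kernel_def by (simp add: max_def min_def field_simps)

lemma sym_kernel_commute:
  "sym_kernel y x z = sym_kernel x y z" "sym_kernel x z y = sym_kernel x y z"
  unfolding sym_kernel_def by (simp_all add: max_def min_def field_simps)

text \<open>Reflection exchanges maximum and minimum. Symmetry of the distribution enters the proof
  through this oddness.\<close>

lemma sym_kernel_reflect: "sym_kernel (c - x) (c - y) (c - z) = - sym_kernel x y z"
  unfolding sym_kernel_def by (simp add: max_def min_def field_simps)

lemma sym_kernel_bound: "\<bar>sym_kernel x y z\<bar> \<le> \<bar>x\<bar> + \<bar>y\<bar> + \<bar>z\<bar>"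
proof -
  have "\<bar>max (min x y) (min (max x y) z)\<bar> \<le> \<bar>x\<bar> + \<bar>y\<bar> + \<bar>z\<bar>"
    unfolding max_def min_def by auto
  moreover have "\<bar>(x + y + z) / 3\<bar> \<le> \<bar>x\<bar> + \<bar>y\<bar> + \<bar>z\<bar>"
    by (auto simp: abs_if field_simps)
  moreover have "\<bar>(p - q) / 2\<bar> \<le> b" if "\<bar>q\<bar> \<le> b" "\<bar>p\<bar> \<le> b" for p q b :: real
    using that by (auto simp: abs_le_iff field_simps)
  ultimately show ?thesis unfolding sym_kernel_eq_mean_median by blast
qed

lemma sym_kernel_measurable [measurable (raw)]:
  assumes [measurable]: "f \<in> borel_measurable M" "g \<in> borel_measurable M" "h \<in> borel_measurable M"
  shows "(\<lambda>x. sym_kernel (f x) (g x) (h x)) \<in> borel_measurable M"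
  unfolding sym_kernel_def by measurable

section \<open>Counting increasing index triples\<close>

definition triples :: "nat set \<Rightarrow> (nat \<times> nat \<times> nat) set" where
  "triples I = {(k, j, i). k \<in> I \<and> j \<in> I \<and> i \<in> I \<and> k < j \<and> j < i}"

text \<open>Forgets the order, so that overlaps of triples become intersections of sets.\<close>

definition elems :: "nat \<times> nat \<times> nat \<Rightarrow> nat set" where
  "elems = (\<lambda>(k, j, i). {k, j, i})"

lemma triples_subset: "triples I \<subseteq> I \<times> I \<times> I"
  by (auto simp: triples_def)

lemma finite_triples [simp]: "finite I \<Longrightarrow> finite (triples I)"
  by (rule finite_subset[OF triples_subset]) simp

text \<open>Sorting the set recovers the increasing triple.\<close>

lemma inj_on_elems: "inj_on elems (triples I)"
proof (rule inj_onI)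
  fix s t assume "s \<in> triples I" "t \<in> triples I" and eq: "elems s = elems t"
  then obtain a b c a' b' c' where st: "s = (a, b, c)" "t = (a', b', c')"
    and ord: "a < b" "b < c" "a' < b'" "b' < c'" by (auto simp: triples_def)
  have "{a, b, c} = {a', b', c'}" using eq by (simp add: st elems_def)
  then have "sorted_list_of_set {a, b, c} = sorted_list_of_set {a', b', c'}" by simp
  then show "s = t" using ord by (simp add: st insort_insert_triv)
qed

lemma card_elems: "t \<in> triples I \<Longrightarrow> card (elems t) = 3"
  by (auto simp: triples_def elems_def)

lemma elems_image: "elems ` triples I = {A. A \<subseteq> I \<and> card A = 3}"
proof (intro equalityI subsetI)
  fix A assume "A \<in> {A. A \<subseteq> I \<and> card A = 3}"
  then obtain x y z where A: "A = {x, y, z}" "x \<noteq> y" "y \<noteq> z" "x \<noteq> z" "A \<subseteq> I"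
    by (auto simp: card_3_iff)
  have "\<exists>a b c. {x, y, z} = {a, b, c} \<and> a < b \<and> b < c"
    using A(2-4) by (metis insert_commute nat_neq_iff)
  then obtain a b c where "A = elems (a, b, c)" "a < b" "b < c" using A(1) by (auto simp: elems_def)
  with A(5) show "A \<in> elems ` triples I" by (auto simp: triples_def elems_def)
qed (auto simp: triples_def elems_def)

lemma card_triples: "finite I \<Longrightarrow> card (triples I) = card I choose 3"
  using card_image[OF inj_on_elems, of I] by (simp add: elems_image n_subsets)

lemma triples_remove: "triples (I - {l}) = {t \<in> triples I. l \<notin> elems t}"
  by (auto simp: triples_def elems_def)

text \<open>Pascal's rule: the triples avoiding \<open>l\<close> are those of
  \<open>I - {l}\<close>.\<close>

lemma card_triples_containing:
  assumes "finite I" "l \<in> I"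
  shows "card {t \<in> triples I. l \<in> elems t} = (card I - 1) choose 2"
proof -
  have "card (triples I) = card {t \<in> triples I. l \<in> elems t} + card {t \<in> triples I. l \<notin> elems t}"
    using assms by (subst card_Un_disjoint[symmetric]) (auto intro: arg_cong[where f = card])
  then have "card I choose 3 = card {t \<in> triples I. l \<in> elems t} + (card I - 1 choose 3)"
    using assms by (simp add: triples_remove[symmetric] card_triples)
  moreover obtain k where "card I = Suc k" using assms by (metis card_Suc_Diff1)
  ultimately show ?thesis by (simp add: numeral_3_eq_3 numeral_2_eq_2)
qed

text \<open>Such an \<open>s\<close> consists of a two-element subset of \<open>t\<close>, for which
  there are 3 choices, and one further index from \<open>I\<close>.\<close>

lemma card_triples_overlapping:
  assumes "finite I" "t \<in> triples I"
  shows "card {s \<in> triples I. 2 \<le> card (elems t \<inter> elems s)} \<le> 3 * card I"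
proof -
  have fin: "finite (elems t)" by (simp add: elems_def split: prod.split)
  let ?B = "{B. B \<subseteq> elems t \<and> card B = 2}"
  let ?S = "{s \<in> triples I. 2 \<le> card (elems t \<inter> elems s)}"
  have "elems ` ?S \<subseteq> (\<lambda>(B, c). insert c B) ` (?B \<times> I)"
  proof
    fix A assume "A \<in> elems ` ?S"
    then obtain s where s: "A = elems s" "s \<in> triples I" "2 \<le> card (elems t \<inter> elems s)" by auto
    then obtain B where B: "B \<subseteq> elems t \<inter> elems s" "card B = 2"
      using obtain_subset_with_card_n by metis
    have A: "card A = 3" "A \<subseteq> I" using s elems_image by (auto simp: card_elems)
    have "finite A" using A(1) by (simp add: card_ge_0_finite)
    then have "card (A - B) = 1" using B s(1) A(1) by (subst card_Diff_subset) (auto intro: finite_subset)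
    then obtain c where "A - B = {c}" by (auto simp: card_1_singleton_iff)
    then have "A = insert c B" "c \<in> I" using B s(1) A(2) by auto
    then show "A \<in> (\<lambda>(B, c). insert c B) ` (?B \<times> I)" using B by auto
  qed
  then have "card (elems ` ?S) \<le> card ((\<lambda>(B, c). insert c B) ` (?B \<times> I))"
    using assms(1) fin by (intro card_mono) auto
  also have "\<dots> \<le> card (?B \<times> I)" using assms(1) fin by (intro card_image_le) auto
  also have "\<dots> = 3 * card I"
    using fin card_elems[OF assms(2)] by (simp add: card_cartesian_product n_subsets numeral_3_eq_3 numeral_2_eq_2)
  also have "card (elems ` ?S) = card ?S"
    by (rule card_image) (rule inj_on_subset[OF inj_on_elems], auto)
  finally show ?thesis .
qed

text \<open>Double counting: exchange the sums and count the triples through a fixed index.\<close>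

lemma sum_triples_linear:
  fixes f :: "nat \<Rightarrow> real"
  assumes "finite I"
  shows "(\<Sum>t\<in>triples I. \<Sum>l\<in>elems t. f l) = real ((card I - 1) choose 2) * (\<Sum>l\<in>I. f l)"
proof -
  have "(\<Sum>t\<in>triples I. \<Sum>l\<in>elems t. f l) = (\<Sum>t\<in>triples I. \<Sum>l\<in>{l\<in>I. l \<in> elems t}. f l)"
    by (intro sum.cong) (auto simp: triples_def elems_def)
  also have "\<dots> = (\<Sum>l\<in>I. \<Sum>t\<in>{t\<in>triples I. l \<in> elems t}. f l)"
    using assms by (intro sum.swap_restrict) auto
  also have "\<dots> = (\<Sum>l\<in>I. real ((card I - 1) choose 2) * f l)"
    using assms by (intro sum.cong) (simp_all add: card_triples_containing)
  finally show ?thesis by (simp add: sum_distrib_left)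
qed

lemma real_choose_2: "real (n choose 2) = real n * (real n - 1) / 2"
proof (induction n)
  case (Suc n)
  have "Suc n choose 2 = (n choose 2) + n" by (simp add: numeral_2_eq_2)
  then show ?case using Suc by (simp add: field_simps)
qed simp

lemma real_choose_3: "real (n choose 3) = real n * (real n - 1) * (real n - 2) / 6"
proof (induction n)
  case (Suc n)
  have "Suc n choose 3 = (n choose 3) + (n choose 2)" by (simp add: numeral_3_eq_3 numeral_2_eq_2)
  then show ?case using Suc by (simp add: real_choose_2 field_simps)
qed simp

text \<open>\<open>G\<close> is the remainder of the kernel after removal of its linear part \<open>f\<close>: the linear part
  contributes exactly \<open>3 f l\<close> to the pseudo-value, and the triples avoiding \<open>l\<close> enter with
  the difference of the two normalizing factors, which is one order smaller than either.\<close>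

lemma pseudo_value_decomposition:
  fixes G :: "nat \<times> nat \<times> nat \<Rightarrow> real"
  assumes n: "4 \<le> n" and l: "l \<in> {1..n}"
    and G: "\<And>k j i. (k, j, i) \<in> triples {1..n} \<Longrightarrow>
      sym_kernel (x i) (x j) (x k) = G (k, j, i) + (f i + f j + f k)"
  defines "T \<equiv> triples {1..n}"
  defines "c \<equiv> 6 / ((real n - 1) * (real n - 2))" and "c' \<equiv> 6 / ((real n - 2) * (real n - 3))"
  shows "pseudo_value n x l - 3 * f l
    = c * (\<Sum>t\<in>{t\<in>T. l \<in> elems t}. G t) + (c - c') * (\<Sum>t\<in>{t\<in>T. l \<notin> elems t}. G t)"
proof -
  define H where "H = (\<lambda>(k, j, i). sym_kernel (x i) (x j) (x k))"
  have U: "U_stat I x = inverse (real (card I choose 3)) * (\<Sum>t\<in>triples I. H t)" for I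
    by (simp add: U_stat_def triples_def H_def)
  have H: "H t = G t + (\<Sum>l\<in>elems t. f l)" if "t \<in> T" for t
    using that G by (auto simp: T_def H_def triples_def elems_def add_ac)
  have HS: "(\<Sum>t\<in>triples I. H t) = (\<Sum>t\<in>triples I. G t) + real ((card I - 1) choose 2) * (\<Sum>l\<in>I. f l)"
    if "I \<subseteq> {1..n}" for I
  proof -
    have "triples I \<subseteq> T" using that by (auto simp: triples_def T_def)
    then have "(\<Sum>t\<in>triples I. H t) = (\<Sum>t\<in>triples I. G t + (\<Sum>l\<in>elems t. f l))"
      by (intro sum.cong refl H) auto
    then show ?thesis using finite_subset[OF that] by (simp add: sum.distrib sum_triples_linear)
  qed
  have c: "real n * inverse (real (n choose 3)) = c" "(real n - 1) * inverse (real ((n - 1) choose 3)) = c'"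
    using n by (auto simp: real_choose_3 c_def c'_def of_nat_diff divide_simps)
  \<comment> \<open>In the full and in the reduced sample every index receives the same total weight
    3. In the difference all linear terms but that of \<open>l\<close> cancel.\<close>
  have c2: "c * real ((n - 1) choose 2) = 3" "c' * real ((n - 1 - 1) choose 2) = 3"
    using n by (simp_all add: real_choose_2 c_def c'_def of_nat_diff)
  have "pseudo_value n x l = c * (\<Sum>t\<in>T. H t) - c' * (\<Sum>t\<in>triples ({1..n} - {l}). H t)"
    using l by (simp add: pseudo_value_def U c[symmetric] T_def mult.assoc)
  also have "\<dots> = c * (\<Sum>t\<in>T. G t) - c' * (\<Sum>t\<in>triples ({1..n} - {l}). G t)
      + (c * real ((n - 1) choose 2)) * (\<Sum>l\<in>{1..n}. f l)
      - (c' * real ((n - 1 - 1) choose 2)) * (\<Sum>l\<in>{1..n} - {l}. f l)"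
    using HS[of "{1..n}"] HS[of "{1..n} - {l}"] l by (simp add: T_def algebra_simps)
  also have "\<dots> = c * (\<Sum>t\<in>T. G t) - c' * (\<Sum>t\<in>triples ({1..n} - {l}). G t) + 3 * f l"
    unfolding c2 using l by (simp add: sum_diff1 algebra_simps)
  also have "triples ({1..n} - {l}) = {t\<in>T. l \<notin> elems t}" by (simp add: triples_remove T_def)
  also have "(\<Sum>t\<in>T. G t) = (\<Sum>t\<in>{t\<in>T. l \<in> elems t}. G t) + (\<Sum>t\<in>{t\<in>T. l \<notin> elems t}. G t)"
    by (subst sum.union_disjoint[symmetric]) (auto simp: T_def intro!: sum.cong)
  finally show ?thesis by (simp add: algebra_simps)
qed

text \<open>A triple contains 3 of the indices and misses the other \<open>n - 3\<close>, so its
  total coefficient is \<open>3 * c + (n - 3) * (c - c')\<close>, which collapses to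
  \<open>c\<close>. This cancellation gives the sum of the remainders a bounded second
  moment.\<close>

lemma sum_pseudo_value_decomposition:
  fixes G :: "nat \<times> nat \<times> nat \<Rightarrow> real"
  assumes n: "4 \<le> n"
    and G: "\<And>k j i. (k, j, i) \<in> triples {1..n} \<Longrightarrow>
      sym_kernel (x i) (x j) (x k) = G (k, j, i) + (f i + f j + f k)"
  defines "T \<equiv> triples {1..n}"
  defines "c \<equiv> 6 / ((real n - 1) * (real n - 2))"
  shows "(\<Sum>l=1..n. pseudo_value n x l - 3 * f l) = c * (\<Sum>t\<in>T. G t)"
proof -
  define c' where "c' = 6 / ((real n - 2) * (real n - 3))"
  have "(\<Sum>l\<in>{1..n}. \<Sum>t\<in>{t\<in>T. l \<in> elems t}. G t) = (\<Sum>t\<in>T. \<Sum>l\<in>{l\<in>{1..n}. l \<in> elems t}. G t)"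
    by (intro sum.swap_restrict) (auto simp: T_def)
  also have "\<dots> = (\<Sum>t\<in>T. 3 * G t)"
  proof (intro sum.cong refl)
    fix t assume t: "t \<in> T"
    then have "{l\<in>{1..n}. l \<in> elems t} = elems t" by (auto simp: T_def triples_def elems_def)
    then show "(\<Sum>l\<in>{l\<in>{1..n}. l \<in> elems t}. G t) = 3 * G t" using card_elems t by (simp add: T_def)
  qed
  finally have in3: "(\<Sum>l\<in>{1..n}. \<Sum>t\<in>{t\<in>T. l \<in> elems t}. G t) = 3 * (\<Sum>t\<in>T. G t)"
    by (simp add: sum_distrib_left)
  have "(\<Sum>t\<in>{t\<in>T. l \<notin> elems t}. G t) = (\<Sum>t\<in>T. G t) - (\<Sum>t\<in>{t\<in>T. l \<in> elems t}. G t)" for l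
  proof -
    have "(\<Sum>t\<in>T. G t) = (\<Sum>t\<in>{t\<in>T. l \<in> elems t}. G t) + (\<Sum>t\<in>{t\<in>T. l \<notin> elems t}. G t)"
      by (subst sum.union_disjoint[symmetric]) (auto simp: T_def intro!: sum.cong)
    then show ?thesis by simp
  qed
  then have out3: "(\<Sum>l\<in>{1..n}. \<Sum>t\<in>{t\<in>T. l \<notin> elems t}. G t) = (real n - 3) * (\<Sum>t\<in>T. G t)"
    using in3 by (simp only: sum_subtractf) (simp add: algebra_simps)
  have "(\<Sum>l=1..n. pseudo_value n x l - 3 * f l) = (\<Sum>l\<in>{1..n}. c * (\<Sum>t\<in>{t\<in>T. l \<in> elems t}. G t)
      + (c - c') * (\<Sum>t\<in>{t\<in>T. l \<notin> elems t}. G t))"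
    unfolding T_def c_def c'_def
    by (intro sum.cong refl pseudo_value_decomposition n G) auto
  also have "\<dots> = c * (3 * (\<Sum>t\<in>T. G t)) + (c - c') * ((real n - 3) * (\<Sum>t\<in>T. G t))"
    unfolding sum.distrib sum_distrib_left[symmetric] in3 out3 ..
  also have "\<dots> = (real n * c - (real n - 3) * c') * (\<Sum>t\<in>T. G t)" by (simp add: algebra_simps)
  also have "real n * c - (real n - 3) * c' = c"
    using n by (simp add: c_def c'_def divide_simps) (simp add: algebra_simps)
  finally show ?thesis .
qed

subsection \<open>The projection of the kernel and its degenerate remainder\<close>

lemma integrable_abs_bound:
  fixes f b :: "'a \<Rightarrow> real"
  assumes "integrable N b" "f \<in> borel_measurable N" "\<And>x. \<bar>f x\<bar> \<le> b x"
  shows "integrable N f"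
  using assms(1,2)
proof (rule Bochner_Integration.integrable_bound)
  show "AE x in N. norm (f x) \<le> norm (b x)"
    using order_trans[OF assms(3) abs_ge_self] by simp
qed

text \<open>Indices begin at 1, as in \<open>U_stat\<close>. With the common law \<open>D\<close> as
  a parameter, projections and tail bounds become integrals over the real line.\<close>

locale iid_sample = prob_space M for M :: "'a measure" +
  fixes X :: "nat \<Rightarrow> 'a \<Rightarrow> real" and D :: "real measure"
  assumes indep: "indep_vars (\<lambda>_. borel) X {1..}"
    and distr_X: "\<And>i. i \<ge> 1 \<Longrightarrow> distr M borel (X i) = D"
    and square: "integrable D (\<lambda>x. x\<^sup>2)"
begin

lemma X_measurable: "i \<ge> 1 \<Longrightarrow> X i \<in> borel_measurable M"
  using indep by (simp add: indep_vars_def2)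

sublocale D: real_distribution D
proof -
  have "real_distribution (distr M borel (X 1))"
    by (rule real_distribution_distr) (simp add: X_measurable)
  then show "real_distribution D" by (simp add: distr_X)
qed

lemma sets_D [measurable_cong]: "sets D = sets borel"
  by simp

sublocale DD: pair_prob_space D D ..

lemma integrable_X_iff:
  fixes f :: "real \<Rightarrow> real"
  assumes "i \<ge> 1" and [measurable]: "f \<in> borel_measurable borel"
  shows "integrable M (\<lambda>\<omega>. f (X i \<omega>)) \<longleftrightarrow> integrable D f"
  unfolding distr_X[OF assms(1), symmetric] using X_measurable[OF assms(1)]
  by (subst integrable_distr_eq) auto

lemma expectation_X:
  fixes f :: "real \<Rightarrow> real"
  assumes "i \<ge> 1" and [measurable]: "f \<in> borel_measurable borel"
  shows "expectation (\<lambda>\<omega>. f (X i \<omega>)) = (\<integral>x. f x \<partial>D)"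
  unfolding distr_X[OF assms(1), symmetric] using X_measurable[OF assms(1)]
  by (subst integral_distr) auto

lemma integrable_id: "integrable D (\<lambda>x. x)"
  by (rule D.square_integrable_imp_integrable[OF _ square]) simp

lemma integrable_abs: "integrable D (\<lambda>x. \<bar>x\<bar>)"
  using integrable_id by simp

definition abs_mean :: real where
  "abs_mean = (\<integral>x. \<bar>x\<bar> \<partial>D)"

lemma abs_mean_nonneg: "0 \<le> abs_mean"
  unfolding abs_mean_def by simp

text \<open>The function h_1 of the overview: the conditional mean of the kernel given one of its
  arguments.\<close>

definition proj :: "real \<Rightarrow> real" where
  "proj x = (\<integral>y. \<integral>z. sym_kernel x y z \<partial>D \<partial>D)"

text \<open>Contains no constant term, so it is Hoeffding's remainder once \<open>proj\<close> has
  mean zero. It still includes the second-order part: averaging over two arguments will annihilate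
  it, averaging over one in general not.\<close>

definition resid :: "real \<Rightarrow> real \<Rightarrow> real \<Rightarrow> real" where
  "resid x y z = sym_kernel x y z - proj x - proj y - proj z"

lemma integrable_sym_kernel: "integrable D (\<lambda>z. sym_kernel x y z)"
proof (rule integrable_abs_bound)
  show "integrable D (\<lambda>z. \<bar>x\<bar> + \<bar>y\<bar> + \<bar>z\<bar>)" using integrable_abs by simp
qed (use sym_kernel_bound in auto)

lemma inner_measurable: "(\<lambda>(x, y). \<integral>z. sym_kernel x y z \<partial>D) \<in> borel_measurable (borel \<Otimes>\<^sub>M borel)"
  unfolding split_beta' by (intro D.borel_measurable_lebesgue_integral) measurable

lemma inner_measurable' [measurable]: "(\<lambda>y. \<integral>z. sym_kernel x y z \<partial>D) \<in> borel_measurable D"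
  by (intro D.borel_measurable_lebesgue_integral) measurable

lemma inner_bound: "\<bar>\<integral>z. sym_kernel x y z \<partial>D\<bar> \<le> \<bar>x\<bar> + \<bar>y\<bar> + abs_mean"
proof -
  have "\<bar>\<integral>z. sym_kernel x y z \<partial>D\<bar> \<le> (\<integral>z. \<bar>sym_kernel x y z\<bar> \<partial>D)" by simp
  also have "\<dots> \<le> (\<integral>z. \<bar>x\<bar> + \<bar>y\<bar> + \<bar>z\<bar> \<partial>D)"
    by (intro integral_mono) (use integrable_sym_kernel integrable_abs sym_kernel_bound in auto)
  also have "\<dots> = \<bar>x\<bar> + \<bar>y\<bar> + abs_mean"
    using integrable_abs D.prob_space by (simp add: abs_mean_def)
  finally show ?thesis .
qed

lemma integrable_inner: "integrable D (\<lambda>y. \<integral>z. sym_kernel x y z \<partial>D)"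
proof (rule integrable_abs_bound)
  show "integrable D (\<lambda>y. \<bar>x\<bar> + \<bar>y\<bar> + abs_mean)" using integrable_abs by simp
qed (use inner_bound in auto)

lemma proj_measurable [measurable]: "proj \<in> borel_measurable borel"
  unfolding proj_def
  by (intro D.borel_measurable_lebesgue_integral)
     (use inner_measurable in \<open>simp add: split_beta' cong: measurable_cong_sets\<close>)

lemma proj_bound: "\<bar>proj x\<bar> \<le> \<bar>x\<bar> + 2 * abs_mean"
proof -
  have "\<bar>proj x\<bar> \<le> (\<integral>y. \<bar>\<integral>z. sym_kernel x y z \<partial>D\<bar> \<partial>D)" unfolding proj_def by simp
  also have "\<dots> \<le> (\<integral>y. \<bar>x\<bar> + \<bar>y\<bar> + abs_mean \<partial>D)"
    by (intro integral_mono) (use integrable_inner integrable_abs inner_bound in auto)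
  also have "\<dots> = \<bar>x\<bar> + 2 * abs_mean"
    using integrable_abs D.prob_space by (simp add: abs_mean_def)
  finally show ?thesis .
qed

lemma integrable_proj_square: "integrable D (\<lambda>x. (proj x)\<^sup>2)"
proof (rule integrable_abs_bound)
  show "integrable D (\<lambda>x. 2 * x\<^sup>2 + 8 * abs_mean\<^sup>2)" using square by simp
  have "(proj x)\<^sup>2 \<le> 2 * x\<^sup>2 + 8 * abs_mean\<^sup>2" for x
  proof -
    have "(proj x)\<^sup>2 \<le> (\<bar>x\<bar> + 2 * abs_mean)\<^sup>2"
      using proj_bound[of x] abs_mean_nonneg by (simp add: abs_le_square_iff[symmetric])
    also have "\<dots> \<le> 2 * x\<^sup>2 + 8 * abs_mean\<^sup>2"
      using zero_le_power2[of "\<bar>x\<bar> - 2 * abs_mean"] by (simp add: power2_eq_square algebra_simps)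
    finally show ?thesis .
  qed
  then show "\<bar>(proj x)\<^sup>2\<bar> \<le> 2 * x\<^sup>2 + 8 * abs_mean\<^sup>2" for x by simp
qed measurable

lemma integrable_proj: "integrable D proj"
  by (rule D.square_integrable_imp_integrable[OF _ integrable_proj_square]) measurable

lemma resid_measurable [measurable (raw)]:
  assumes [measurable]: "f \<in> borel_measurable N" "g \<in> borel_measurable N" "h \<in> borel_measurable N"
  shows "(\<lambda>x. resid (f x) (g x) (h x)) \<in> borel_measurable N"
  unfolding resid_def by measurable

lemma resid_commute: "resid y x z = resid x y z" "resid x z y = resid x y z"
  unfolding resid_def by (simp_all add: sym_kernel_commute)

text \<open>The kernel and the three projections together are at most twice the sum of the moduli
  and \<open>3 * abs_mean\<close>. The factor 16 is 2^2 times the 4 from squaring a sum of four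
  terms.\<close>

lemma resid_square_bound: "(resid x y z)\<^sup>2 \<le> 16 * (x\<^sup>2 + y\<^sup>2 + z\<^sup>2 + 9 * abs_mean\<^sup>2)"
proof -
  let ?a = "\<bar>x\<bar>" and ?b = "\<bar>y\<bar>" and ?c = "\<bar>z\<bar>" and ?m = "3 * abs_mean"
  have "\<bar>resid x y z\<bar> \<le> 2 * (?a + ?b + ?c + ?m)"
  proof -
    have "\<bar>p - q - r - s\<bar> \<le> b + b1 + b2 + b3"
      if "\<bar>p\<bar> \<le> b" "\<bar>q\<bar> \<le> b1" "\<bar>r\<bar> \<le> b2" "\<bar>s\<bar> \<le> b3" for p q r s b b1 b2 b3 :: real
      using that by linarith
    from this[OF sym_kernel_bound proj_bound proj_bound proj_bound, of x y z x y z]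
    show ?thesis unfolding resid_def by (simp add: algebra_simps)
  qed
  then have "(resid x y z)\<^sup>2 \<le> (2 * (?a + ?b + ?c + ?m))\<^sup>2"
    using abs_mean_nonneg by (simp add: abs_le_square_iff[symmetric])
  also have "\<dots> \<le> 16 * (?a\<^sup>2 + ?b\<^sup>2 + ?c\<^sup>2 + ?m\<^sup>2)"
  proof -
    have *: "(p + q + r + s)\<^sup>2 \<le> 4 * (p\<^sup>2 + q\<^sup>2 + r\<^sup>2 + s\<^sup>2)" for p q r s :: real
    proof -
      have "0 \<le> (p - q)\<^sup>2 + (p - r)\<^sup>2 + (p - s)\<^sup>2 + (q - r)\<^sup>2 + (q - s)\<^sup>2 + (r - s)\<^sup>2"
        by (intro add_nonneg_nonneg zero_le_power2)
      then show ?thesis by (simp add: power2_eq_square algebra_simps)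
    qed
    have "(2 * s)\<^sup>2 \<le> 16 * t" if "s\<^sup>2 \<le> 4 * t" for s t :: real
      using that by (simp add: power_mult_distrib)
    from this[OF *] show ?thesis .
  qed
  finally show ?thesis by (simp add: power_mult_distrib)
qed

text \<open>Not the variance but an upper bound for the second moment, valid for any three sample
  indices, equal or distinct.\<close>

definition resid_var :: real where
  "resid_var = 16 * (3 * (\<integral>x. x\<^sup>2 \<partial>D) + 9 * abs_mean\<^sup>2)"

lemma
  assumes "i \<ge> 1" "j \<ge> 1" "k \<ge> 1"
  shows resid_square_integrable: "integrable M (\<lambda>\<omega>. (resid (X i \<omega>) (X j \<omega>) (X k \<omega>))\<^sup>2)"
    and resid_square_expectation: "expectation (\<lambda>\<omega>. (resid (X i \<omega>) (X j \<omega>) (X k \<omega>))\<^sup>2) \<le> resid_var"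
proof -
  note [measurable] = X_measurable[OF assms(1)] X_measurable[OF assms(2)] X_measurable[OF assms(3)]
  let ?b = "\<lambda>\<omega>. 16 * ((X i \<omega>)\<^sup>2 + (X j \<omega>)\<^sup>2 + (X k \<omega>)\<^sup>2 + 9 * abs_mean\<^sup>2)"
  have sq: "integrable M (\<lambda>\<omega>. (X l \<omega>)\<^sup>2)" "expectation (\<lambda>\<omega>. (X l \<omega>)\<^sup>2) = (\<integral>x. x\<^sup>2 \<partial>D)" if "l \<ge> 1" for l
    using integrable_X_iff[OF that, of "\<lambda>x. x\<^sup>2"] expectation_X[OF that, of "\<lambda>x. x\<^sup>2"] square by simp_all
  have b: "integrable M ?b" using sq assms by simp
  show int: "integrable M (\<lambda>\<omega>. (resid (X i \<omega>) (X j \<omega>) (X k \<omega>))\<^sup>2)"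
  proof (rule integrable_abs_bound[OF b])
    show "\<bar>(resid (X i \<omega>) (X j \<omega>) (X k \<omega>))\<^sup>2\<bar> \<le> ?b \<omega>" for \<omega>
      using resid_square_bound by simp
  qed measurable
  have "expectation (\<lambda>\<omega>. (resid (X i \<omega>) (X j \<omega>) (X k \<omega>))\<^sup>2) \<le> expectation ?b"
    using int b resid_square_bound by (intro integral_mono) auto
  also have "\<dots> = resid_var" using sq assms prob_space by (simp add: resid_var_def)
  finally show "expectation (\<lambda>\<omega>. (resid (X i \<omega>) (X j \<omega>) (X k \<omega>))\<^sup>2) \<le> resid_var" .
qed

lemma resid_var_nonneg: "0 \<le> resid_var"
  by (simp add: resid_var_def)

lemma resid_integrable:
  assumes "i \<ge> 1" "j \<ge> 1"
  shows "integrable M (\<lambda>\<omega>. resid (X i \<omega>) (X j \<omega>) c)"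
proof -
  note [measurable] = X_measurable[OF assms(1)] X_measurable[OF assms(2)]
  let ?b = "\<lambda>\<omega>. 16 * ((X i \<omega>)\<^sup>2 + (X j \<omega>)\<^sup>2 + c\<^sup>2 + 9 * abs_mean\<^sup>2)"
  have sq: "integrable M (\<lambda>\<omega>. (X l \<omega>)\<^sup>2)" if "l \<ge> 1" for l
    using integrable_X_iff[OF that, of "\<lambda>x. x\<^sup>2"] square by simp
  have b: "integrable M ?b" using sq assms by simp
  have "integrable M (\<lambda>\<omega>. (resid (X i \<omega>) (X j \<omega>) c)\<^sup>2)"
  proof (rule integrable_abs_bound[OF b])
    show "\<bar>(resid (X i \<omega>) (X j \<omega>) c)\<^sup>2\<bar> \<le> ?b \<omega>" for \<omega>
      using resid_square_bound by simp
  qed measurable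
  then show ?thesis by (rule square_integrable_imp_integrable[rotated]) measurable
qed

lemma indep_pair:
  assumes "i \<ge> 1" "j \<ge> 1" "i \<noteq> j"
  shows "distr M (borel \<Otimes>\<^sub>M borel) (\<lambda>\<omega>. (X i \<omega>, X j \<omega>)) = D \<Otimes>\<^sub>M D"
proof -
  have "indep_var (PiM {i} (\<lambda>_. borel)) (\<lambda>\<omega>. restrict (\<lambda>i. X i \<omega>) {i})
      (PiM {j} (\<lambda>_. borel)) (\<lambda>\<omega>. restrict (\<lambda>i. X i \<omega>) {j})"
    using assms by (intro indep_var_restrict[OF indep]) auto
  then have "indep_var borel ((\<lambda>z. z i) \<circ> (\<lambda>\<omega>. restrict (\<lambda>i. X i \<omega>) {i}))
       borel ((\<lambda>z. z j) \<circ> (\<lambda>\<omega>. restrict (\<lambda>i. X i \<omega>) {j}))"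
    by (rule indep_var_compose) measurable
  then have "indep_var borel (X i) borel (X j)" by (simp add: comp_def)
  then show ?thesis using distr_X assms by (simp add: indep_var_distribution_eq)
qed

text \<open>Fubini for the joint law of two independent blocks, integrating over the
  \<open>A\<close> block first. Blocks are used because products of remainders may share variables;
  the shared ones go into \<open>B\<close> and are frozen.\<close>

lemma expectation_indep_blocks:
  fixes F :: "_ \<Rightarrow> real"
  assumes A: "A \<subseteq> {1..}" and B: "B \<subseteq> {1..}" and AB: "A \<inter> B = {}"
    and F: "F \<in> borel_measurable (PiM A (\<lambda>_. borel) \<Otimes>\<^sub>M PiM B (\<lambda>_. borel))"
    and int: "integrable M (\<lambda>\<omega>. F (restrict (\<lambda>i. X i \<omega>) A, restrict (\<lambda>i. X i \<omega>) B))"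
    and zero: "\<And>z. z \<in> space (PiM B (\<lambda>_. borel)) \<Longrightarrow> expectation (\<lambda>\<omega>. F (restrict (\<lambda>i. X i \<omega>) A, z)) = 0"
  shows "expectation (\<lambda>\<omega>. F (restrict (\<lambda>i. X i \<omega>) A, restrict (\<lambda>i. X i \<omega>) B)) = 0"
proof -
  let ?A = "PiM A (\<lambda>_. borel :: real measure)" and ?B = "PiM B (\<lambda>_. borel :: real measure)"
  let ?XA = "\<lambda>\<omega>. restrict (\<lambda>i. X i \<omega>) A" and ?XB = "\<lambda>\<omega>. restrict (\<lambda>i. X i \<omega>) B"
  have ind: "indep_var ?A ?XA ?B ?XB" using A B AB by (intro indep_var_restrict[OF indep])
  then have XA [measurable]: "?XA \<in> measurable M ?A" and XB [measurable]: "?XB \<in> measurable M ?B"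
    by (auto simp: indep_var_distribution_eq)
  have eq: "distr M (?A \<Otimes>\<^sub>M ?B) (\<lambda>\<omega>. (?XA \<omega>, ?XB \<omega>)) = distr M ?A ?XA \<Otimes>\<^sub>M distr M ?B ?XB"
    using ind by (simp add: indep_var_distribution_eq)
  interpret P: prob_space "distr M ?A ?XA" by (rule prob_space_distr) measurable
  interpret Q: prob_space "distr M ?B ?XB" by (rule prob_space_distr) measurable
  interpret PQ: pair_prob_space "distr M ?A ?XA" "distr M ?B ?XB" ..
  have int': "integrable (distr M ?A ?XA \<Otimes>\<^sub>M distr M ?B ?XB) (\<lambda>(u, z). F (u, z))"
    unfolding eq[symmetric] using int F by (subst integrable_distr_eq) auto
  have "expectation (\<lambda>\<omega>. F (?XA \<omega>, ?XB \<omega>)) = integral\<^sup>L (distr M ?A ?XA \<Otimes>\<^sub>M distr M ?B ?XB) F"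
    unfolding eq[symmetric] using F by (subst integral_distr) auto
  also have "\<dots> = (\<integral>z. \<integral>u. F (u, z) \<partial>distr M ?A ?XA \<partial>distr M ?B ?XB)"
    using PQ.integral_snd[OF int'] by simp
  also have "\<dots> = (\<integral>z. 0 \<partial>distr M ?B ?XB)"
  proof (intro Bochner_Integration.integral_cong refl)
    fix z assume "z \<in> space (distr M ?B ?XB)"
    then have z: "z \<in> space ?B" by simp
    then have "(\<lambda>u. F (u, z)) \<in> borel_measurable ?A" using F by measurable
    then show "(\<integral>u. F (u, z) \<partial>distr M ?A ?XA) = 0"
      using zero[OF z] by (subst integral_distr) auto
  qed
  finally show ?thesis by simp
qed

end

section \<open>Degeneracy and orthogonality of the remainders\<close>

locale centred_iid_sample = iid_sample +
  assumes centred: "(\<integral>x. proj x \<partial>D) = 0"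
begin

text \<open>Averaging the kernel over two arguments gives \<open>proj c\<close>, which the
  subtracted \<open>proj c\<close> cancels; the other two projections have mean zero.\<close>

lemma expectation_resid_pair:
  assumes "i \<ge> 1" "j \<ge> 1" "i \<noteq> j"
  shows "expectation (\<lambda>\<omega>. resid (X i \<omega>) (X j \<omega>) c) = 0"
proof -
  note [measurable] = X_measurable[OF assms(1)] X_measurable[OF assms(2)]
  have "integrable (distr M (borel \<Otimes>\<^sub>M borel) (\<lambda>\<omega>. (X i \<omega>, X j \<omega>))) (\<lambda>p. resid (fst p) (snd p) c)"
    using resid_integrable[OF assms(1,2), of c] by (subst integrable_distr_eq) auto
  then have int: "integrable (D \<Otimes>\<^sub>M D) (\<lambda>p. resid (fst p) (snd p) c)"
    by (simp only: indep_pair[OF assms])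
  have "expectation (\<lambda>\<omega>. resid (X i \<omega>) (X j \<omega>) c)
     = integral\<^sup>L (distr M (borel \<Otimes>\<^sub>M borel) (\<lambda>\<omega>. (X i \<omega>, X j \<omega>))) (\<lambda>p. resid (fst p) (snd p) c)"
    by (subst integral_distr) auto
  also have "\<dots> = (\<integral>x. \<integral>y. resid x y c \<partial>D \<partial>D)"
    unfolding indep_pair[OF assms] using DD.integral_fst'[OF int] by simp
  also have "\<dots> = (\<integral>x. (\<integral>y. sym_kernel c x y \<partial>D) - proj x - proj c \<partial>D)"
  proof (intro Bochner_Integration.integral_cong refl)
    fix x
    have "resid x y c = sym_kernel c x y - proj x - proj y - proj c" for y
      unfolding resid_def by (simp add: sym_kernel_commute)
    then show "(\<integral>y. resid x y c \<partial>D) = (\<integral>y. sym_kernel c x y \<partial>D) - proj x - proj c"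
      using integrable_sym_kernel integrable_proj D.prob_space by (simp add: centred)
  qed
  also have "\<dots> = 0"
    using integrable_inner integrable_proj D.prob_space by (simp add: centred proj_def[symmetric])
  finally show ?thesis .
qed

lemma resid_prod_integrable:
  assumes "i \<ge> 1" "j \<ge> 1" "k \<ge> 1" "a \<ge> 1" "b \<ge> 1" "c \<ge> 1"
  shows "integrable M (\<lambda>\<omega>. resid (X i \<omega>) (X j \<omega>) (X k \<omega>) * resid (X a \<omega>) (X b \<omega>) (X c \<omega>))"
    and "expectation (\<lambda>\<omega>. resid (X i \<omega>) (X j \<omega>) (X k \<omega>) * resid (X a \<omega>) (X b \<omega>) (X c \<omega>)) \<le> resid_var"
proof -
  note [measurable] = assms[THEN X_measurable]
  let ?f = "\<lambda>\<omega>. resid (X i \<omega>) (X j \<omega>) (X k \<omega>)" and ?g = "\<lambda>\<omega>. resid (X a \<omega>) (X b \<omega>) (X c \<omega>)"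
  have b: "integrable M (\<lambda>\<omega>. ((?f \<omega>)\<^sup>2 + (?g \<omega>)\<^sup>2) / 2)"
    using resid_square_integrable assms by simp
  have AM: "\<bar>?f \<omega> * ?g \<omega>\<bar> \<le> ((?f \<omega>)\<^sup>2 + (?g \<omega>)\<^sup>2) / 2" for \<omega>
    using sum_squares_bound[of "\<bar>?f \<omega>\<bar>" "\<bar>?g \<omega>\<bar>"] by (simp add: abs_mult)
  show int: "integrable M (\<lambda>\<omega>. ?f \<omega> * ?g \<omega>)"
    by (rule integrable_abs_bound[OF b _ AM]) measurable
  have "expectation (\<lambda>\<omega>. ?f \<omega> * ?g \<omega>) \<le> expectation (\<lambda>\<omega>. ((?f \<omega>)\<^sup>2 + (?g \<omega>)\<^sup>2) / 2)"
    by (intro integral_mono int b order_trans[OF abs_ge_self AM])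
  also have "\<dots> \<le> resid_var"
    using resid_square_expectation[OF assms(1-3)] resid_square_expectation[OF assms(4-6)]
      resid_square_integrable assms by simp
  finally show "expectation (\<lambda>\<omega>. ?f \<omega> * ?g \<omega>) \<le> resid_var" .
qed

text \<open>With all variables but \<open>X p\<close> and \<open>X q\<close> frozen, the second
  factor is constant and the first averages to zero. The index \<open>r\<close> may occur in the
  second factor.\<close>

lemma resid_orthogonal_aux:
  assumes ge: "p \<ge> 1" "q \<ge> 1" "r \<ge> 1" "a \<ge> 1" "b \<ge> 1" "c \<ge> 1"
    and "p \<noteq> q" "{p, q} \<inter> {r, a, b, c} = {}"
  shows "expectation (\<lambda>\<omega>. resid (X p \<omega>) (X q \<omega>) (X r \<omega>) * resid (X a \<omega>) (X b \<omega>) (X c \<omega>)) = 0"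
proof -
  let ?A = "{p, q}" and ?B = "{r, a, b, c}"
  let ?F = "\<lambda>(u, z). resid (u p) (u q) (z r) * resid (z a) (z b) (z c) :: real"
  have "expectation (\<lambda>\<omega>. ?F (restrict (\<lambda>i. X i \<omega>) ?A, restrict (\<lambda>i. X i \<omega>) ?B)) = 0"
  proof (rule expectation_indep_blocks)
    show "?F \<in> borel_measurable (PiM ?A (\<lambda>_. borel) \<Otimes>\<^sub>M PiM ?B (\<lambda>_. borel))"
      unfolding split_beta' by measurable
    show "integrable M (\<lambda>\<omega>. ?F (restrict (\<lambda>i. X i \<omega>) ?A, restrict (\<lambda>i. X i \<omega>) ?B))"
      using resid_prod_integrable(1)[OF ge] by simp
    fix z
    show "expectation (\<lambda>\<omega>. ?F (restrict (\<lambda>i. X i \<omega>) ?A, z)) = 0"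
      using expectation_resid_pair[OF ge(1,2) \<open>p \<noteq> q\<close>] by simp
  qed (use assms in auto)
  then show ?thesis by simp
qed

definition triple_resid :: "nat \<times> nat \<times> nat \<Rightarrow> 'a \<Rightarrow> real" where
  "triple_resid = (\<lambda>(k, j, i) \<omega>. resid (X k \<omega>) (X j \<omega>) (X i \<omega>))"

text \<open>With at most one common index, two of the three indices of \<open>s\<close> are foreign
  to \<open>t\<close>. Symmetry of \<open>resid\<close> moves these two to the front.\<close>

lemma resid_orthogonal:
  assumes I: "I \<subseteq> {1..}" and s: "s \<in> triples I" and t: "t \<in> triples I"
    and le: "card (elems s \<inter> elems t) < 2"
  shows "expectation (\<lambda>\<omega>. triple_resid s \<omega> * triple_resid t \<omega>) = 0"
proof -
  obtain k j i where s': "s = (k, j, i)" and so: "k < j" "j < i" "k \<ge> 1" "j \<ge> 1" "i \<ge> 1"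
    using s I by (auto simp: triples_def)
  obtain c b a where t': "t = (c, b, a)" and to: "c < b" "b < a" "c \<ge> 1" "b \<ge> 1" "a \<ge> 1"
    using t I by (auto simp: triples_def)
  have fin: "finite (elems s \<inter> elems t)" by (simp add: s' elems_def)
  have sub: "x = y" if "x \<in> elems s \<inter> elems t" "y \<in> elems s \<inter> elems t" for x y
  proof (rule ccontr)
    assume "x \<noteq> y"
    then have "2 = card {x, y}" by simp
    also have "\<dots> \<le> card (elems s \<inter> elems t)" using that fin by (intro card_mono) auto
    finally show False using le by simp
  qed
  consider "k \<notin> elems t" "j \<notin> elems t" | "k \<notin> elems t" "i \<notin> elems t" | "j \<notin> elems t" "i \<notin> elems t"
    using sub[of k j] sub[of k i] sub[of j i] so by (auto simp: s' elems_def)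
  then show ?thesis
  proof cases
    case 1
    then show ?thesis using resid_orthogonal_aux[of k j i c b a] so to
      by (auto simp: triple_resid_def s' t' elems_def)
  next
    case 2
    have "resid (X k \<omega>) (X j \<omega>) (X i \<omega>) = resid (X k \<omega>) (X i \<omega>) (X j \<omega>)" for \<omega>
      by (simp add: resid_commute)
    then show ?thesis using 2 resid_orthogonal_aux[of k i j c b a] so to
      by (auto simp: triple_resid_def s' t' elems_def)
  next
    case 3
    have "resid (X k \<omega>) (X j \<omega>) (X i \<omega>) = resid (X j \<omega>) (X i \<omega>) (X k \<omega>)" for \<omega>
      by (metis resid_commute)
    then show ?thesis using 3 resid_orthogonal_aux[of j i k c b a] so to
      by (auto simp: triple_resid_def s' t' elems_def)
  qed
qed

text \<open>In the expanded square only pairs of triples with two common indices survive, at most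
  \<open>3 * n\<close> for each triple. This saves a factor of order n^2 against the trivial count
  when \<open>T\<close> is the set of all triples.\<close>

lemma
  assumes "T \<subseteq> triples {1..n}"
  shows sum_triple_resid_square_integrable: "integrable M (\<lambda>\<omega>. (\<Sum>t\<in>T. triple_resid t \<omega>)\<^sup>2)"
    and sum_triple_resid_square_expectation:
      "expectation (\<lambda>\<omega>. (\<Sum>t\<in>T. triple_resid t \<omega>)\<^sup>2) \<le> real (card T) * (3 * real n * resid_var)"
proof -
  have fin: "finite T" using finite_subset[OF assms] by simp
  have int_le: "integrable M (\<lambda>\<omega>. triple_resid s \<omega> * triple_resid t \<omega>)" "expectation (\<lambda>\<omega>. triple_resid s \<omega> * triple_resid t \<omega>) \<le> resid_var"
    if st: "s \<in> T" "t \<in> T" for s t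
  proof -
    obtain k j i c b a where "s = (k, j, i)" "t = (c, b, a)" by (metis prod_cases3)
    moreover have "s \<in> triples {1..n}" "t \<in> triples {1..n}" using st assms by auto
    ultimately show "integrable M (\<lambda>\<omega>. triple_resid s \<omega> * triple_resid t \<omega>)" "expectation (\<lambda>\<omega>. triple_resid s \<omega> * triple_resid t \<omega>) \<le> resid_var"
      using resid_prod_integrable[of k j i c b a] by (auto simp: triples_def triple_resid_def)
  qed
  have sq: "(\<Sum>t\<in>T. triple_resid t \<omega>)\<^sup>2 = (\<Sum>s\<in>T. \<Sum>t\<in>T. triple_resid s \<omega> * triple_resid t \<omega>)" for \<omega>
    by (simp add: power2_eq_square sum_product)
  show "integrable M (\<lambda>\<omega>. (\<Sum>t\<in>T. triple_resid t \<omega>)\<^sup>2)"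
    unfolding sq using int_le(1) by (intro Bochner_Integration.integrable_sum)
  have "expectation (\<lambda>\<omega>. (\<Sum>t\<in>T. triple_resid t \<omega>)\<^sup>2) = (\<Sum>s\<in>T. \<Sum>t\<in>T. expectation (\<lambda>\<omega>. triple_resid s \<omega> * triple_resid t \<omega>))"
    unfolding sq using int_le(1) by (simp add: Bochner_Integration.integral_sum Bochner_Integration.integrable_sum)
  also have "\<dots> \<le> (\<Sum>s\<in>T. 3 * real n * resid_var)"
  proof (rule sum_mono)
    fix s assume s: "s \<in> T"
    let ?N = "{t\<in>T. 2 \<le> card (elems s \<inter> elems t)}"
    have "(\<Sum>t\<in>T. expectation (\<lambda>\<omega>. triple_resid s \<omega> * triple_resid t \<omega>)) = (\<Sum>t\<in>?N. expectation (\<lambda>\<omega>. triple_resid s \<omega> * triple_resid t \<omega>))"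
      using fin s assms by (intro sum.mono_neutral_right ballI resid_orthogonal[of "{1..n}"]) auto
    also have "\<dots> \<le> (\<Sum>t\<in>?N. resid_var)" using s by (intro sum_mono int_le(2)) auto
    also have "\<dots> = real (card ?N) * resid_var" by simp
    also have "\<dots> \<le> (3 * real n) * resid_var"
    proof (rule mult_right_mono[OF _ resid_var_nonneg])
      have "card ?N \<le> card {t\<in>triples {1..n}. 2 \<le> card (elems s \<inter> elems t)}"
        using assms by (intro card_mono) auto
      also have "\<dots> \<le> 3 * card {1..n}" using s assms by (intro card_triples_overlapping) auto
      finally show "real (card ?N) \<le> 3 * real n" by simp
    qed
    finally show "(\<Sum>t\<in>T. expectation (\<lambda>\<omega>. triple_resid s \<omega> * triple_resid t \<omega>)) \<le> 3 * real n * resid_var" .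
  qed
  finally show "expectation (\<lambda>\<omega>. (\<Sum>t\<in>T. triple_resid t \<omega>)\<^sup>2) \<le> real (card T) * (3 * real n * resid_var)" by simp
qed

end

subsection \<open>Quadratic expansion of the likelihood ratio\<close>

lemma tendsto_zero_mult_bounded:
  fixes f g :: "'b \<Rightarrow> real"
  assumes "(f \<longlongrightarrow> 0) F" "\<forall>\<^sub>F x in F. \<bar>g x\<bar> \<le> K"
  shows "((\<lambda>x. f x * g x) \<longlongrightarrow> 0) F"
  using assms(1)
  by (rule tendsto_0_le[where K = K])
     (use assms(2) in \<open>auto elim!: eventually_mono simp: abs_mult mult_left_mono\<close>)

lemma sum_prod_sqrt_bound:
  fixes f g :: "'i \<Rightarrow> real"
  shows "\<bar>\<Sum>i\<in>A. f i * g i\<bar> \<le> sqrt ((\<Sum>i\<in>A. (f i)\<^sup>2) * (\<Sum>i\<in>A. (g i)\<^sup>2))"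
  using L2_set_mult_ineq[of f g A] sum_abs[of "\<lambda>i. f i * g i" A]
  by (simp add: L2_set_def real_sqrt_mult abs_mult)

text \<open>With \<open>S = \<Sum> W\<close>, \<open>Q = \<Sum> W\<^sup>2\<close> over the \<open>n + 1\<close> adjusted pseudo-values, the statistic is
  \<open>S\<^sup>2 / Q\<close> up to a factor close to \<open>1\<close>. The added pseudo-value has order \<open>ln n / sqrt n\<close>
  and influences neither \<open>S / sqrt n\<close> nor \<open>Q / n\<close> in the limit.\<close>

lemma jel_statistic_asymptotics:
  fixes N :: "'b \<Rightarrow> nat" and x v :: "'b \<Rightarrow> nat \<Rightarrow> real" and s :: real
  defines "R \<equiv> \<lambda>b i. pseudo_value (N b) (x b) i - v b i"
  defines "y \<equiv> \<lambda>b. (\<Sum>i=1..N b. v b i) / (s * sqrt (real (N b)))"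
  assumes N: "filterlim N at_top F" and s: "0 < s"
    and K: "\<And>b. \<bar>y b\<bar> \<le> K"
    and a: "((\<lambda>b. (\<Sum>i=1..N b. (v b i)\<^sup>2) / real (N b)) \<longlongrightarrow> s\<^sup>2) F"
    and rho: "((\<lambda>b. (\<Sum>i=1..N b. (R b i)\<^sup>2) / real (N b)) \<longlongrightarrow> 0) F"
    and r: "((\<lambda>b. (\<Sum>i=1..N b. R b i) / sqrt (real (N b))) \<longlongrightarrow> 0) F"
    and mu: "((\<lambda>b. m b / sqrt (real (N b))) \<longlongrightarrow> 0) F"
    and m: "\<And>b i. i \<in> {1..N b} \<Longrightarrow> \<bar>v b i\<bar> \<le> m b"
  shows "((\<lambda>b. - 2 * ln (adj_jel_ratio (N b) (x b)) - (y b)\<^sup>2) \<longlongrightarrow> 0) F"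
proof -
  have yK: "(y b)\<^sup>2 \<le> K\<^sup>2" for b
    using power_mono[OF K abs_ge_zero, of b 2] by simp
  define n where "n b = real (N b)" for b
  have nlim: "filterlim n at_top F"
    unfolding n_def by (rule filterlim_compose[OF filterlim_real_sequentially N])
  have N1: "\<forall>\<^sub>F b in F. 1 \<le> N b" using N by (auto simp: filterlim_at_top)
  define c where "c b = max 1 (ln (n b) / 2)" for b
  have cn: "((\<lambda>b. c b / sqrt (n b)) \<longlongrightarrow> 0) F" "((\<lambda>b. c b / n b) \<longlongrightarrow> 0) F"
  proof -
    have "((\<lambda>t::real. max 1 (ln t / 2) / sqrt t) \<longlongrightarrow> 0) at_top" by real_asymp
    from filterlim_compose[OF this nlim] show "((\<lambda>b. c b / sqrt (n b)) \<longlongrightarrow> 0) F" by (simp add: c_def)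
    have "((\<lambda>t::real. max 1 (ln t / 2) / t) \<longlongrightarrow> 0) at_top" by real_asymp
    from filterlim_compose[OF this nlim] show "((\<lambda>b. c b / n b) \<longlongrightarrow> 0) F" by (simp add: c_def)
  qed
  have sqrtn: "((\<lambda>b. 1 / sqrt (n b)) \<longlongrightarrow> 0) F"
  proof -
    have "((\<lambda>t::real. 1 / sqrt t) \<longlongrightarrow> 0) at_top" by real_asymp
    from filterlim_compose[OF this nlim] show ?thesis .
  qed
  define rr where "rr b = (\<Sum>i=1..N b. R b i) / sqrt (n b)" for b
  have rr: "(rr \<longlongrightarrow> 0) F" using r by (simp add: rr_def[abs_def] n_def)
  define aa where "aa b = (\<Sum>i=1..N b. (v b i)\<^sup>2) / n b" for b
  have aa: "(aa \<longlongrightarrow> s\<^sup>2) F" using a by (simp add: aa_def[abs_def] n_def)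
  define rh where "rh b = (\<Sum>i=1..N b. (R b i)\<^sup>2) / n b" for b
  have rh: "(rh \<longlongrightarrow> 0) F" using rho by (simp add: rh_def[abs_def] n_def)
  \<comment> \<open>The sum of the pseudo-values in units of sqrt n. It stays bounded because
    \<open>y\<close> does and \<open>rr\<close> tends to 0.\<close>
  define u where "u b = s * y b + rr b" for b
  have uV: "(\<Sum>i=1..N b. pseudo_value (N b) (x b) i) = sqrt (n b) * u b" if "1 \<le> N b" for b
    using that s by (simp add: u_def y_def rr_def R_def n_def sum_subtractf field_simps)
  have ub: "\<forall>\<^sub>F b in F. \<bar>u b\<bar> \<le> s * K + 1"
  proof -
    have "\<forall>\<^sub>F b in F. \<bar>rr b\<bar> < 1" using tendstoD[OF rr, of 1] by simp
    then show ?thesis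
    proof eventually_elim
      case (elim b)
      have "\<bar>s * y b\<bar> \<le> s * K" using K[of b] s by (simp add: abs_mult)
      with elim show ?case unfolding u_def by linarith
    qed
  qed
  define W where "W b = adj_pseudo_value (N b) (x b)" for b
  define S where "S b = (\<Sum>i\<in>{1..N b + 1}. W b i)" for b
  define Q where "Q b = (\<Sum>i\<in>{1..N b + 1}. (W b i)\<^sup>2)" for b
  have Wlast: "W b (N b + 1) = - (c b * u b / sqrt (n b))" if "1 \<le> N b" for b
  proof -
    have eq: "W b (N b + 1) = - c b * (1 / n b) * (sqrt (n b) * u b)"
      using uV[OF that] by (simp add: W_def adj_pseudo_value_def c_def n_def)
    have "- c b * (1 / (t * t)) * (t * u b) = - (c b * u b / t)" if "t > 0" for t
      using that by simp
    from this[of "sqrt (n b)"] show ?thesis unfolding eq using that by (simp add: n_def)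
  qed
  have Wi: "W b i = v b i + R b i" if "i \<in> {1..N b}" for b i
    using that by (simp add: W_def adj_pseudo_value_def R_def)
  define S' where "S' b = S b / sqrt (n b)" for b
  have S': "S' b = u b - u b * (c b / n b)" if "1 \<le> N b" for b
  proof -
    have "S b = (\<Sum>i\<in>{1..N b}. W b i) + W b (N b + 1)" by (simp add: S_def)
    also have "(\<Sum>i\<in>{1..N b}. W b i) = sqrt (n b) * u b"
      unfolding uV[OF that, symmetric] by (intro sum.cong) (auto simp: W_def adj_pseudo_value_def)
    finally have "S b = sqrt (n b) * u b - c b * u b / sqrt (n b)" by (simp only: Wlast[OF that])
    moreover have "(t * u b - c b * u b / t) / t = u b - u b * (c b / (t * t))" if "t > 0" for t
      using that by (simp add: field_simps)
    from this[of "sqrt (n b)"] have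
      "(sqrt (n b) * u b - c b * u b / sqrt (n b)) / sqrt (n b) = u b - u b * (c b / n b)"
      using that by (simp add: n_def)
    ultimately show ?thesis by (simp only: S'_def)
  qed
  define q where "q b = Q b / n b" for b
  have q: "q b = aa b + 2 * ((\<Sum>i=1..N b. v b i * R b i) / n b) + rh b + (c b / n b)\<^sup>2 * (u b)\<^sup>2"
    if "1 \<le> N b" for b
  proof -
    have "Q b = (\<Sum>i\<in>{1..N b}. (W b i)\<^sup>2) + (W b (N b + 1))\<^sup>2" by (simp add: Q_def)
    also have "(\<Sum>i\<in>{1..N b}. (W b i)\<^sup>2) = (\<Sum>i=1..N b. (v b i)\<^sup>2) + 2 * (\<Sum>i=1..N b. v b i * R b i)
        + (\<Sum>i=1..N b. (R b i)\<^sup>2)"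
      by (simp add: Wi power2_sum sum.distrib sum_distrib_left algebra_simps)
    also have "(W b (N b + 1))\<^sup>2 = (c b)\<^sup>2 * (u b)\<^sup>2 / n b"
      using Wlast[OF that] by (simp add: power_divide power_mult_distrib n_def)
    finally show ?thesis
      using that by (simp add: q_def aa_def rh_def n_def add_divide_distrib power_divide) (simp add: power2_eq_square)
  qed
  \<comment> \<open>Cauchy-Schwarz: the mixed term is at most the geometric mean of a convergent and
    a vanishing average.\<close>
  have "((\<lambda>b. (\<Sum>i=1..N b. v b i * R b i) / n b) \<longlongrightarrow> 0) F"
  proof (rule Lim_null_comparison)
    show "\<forall>\<^sub>F b in F. norm ((\<Sum>i=1..N b. v b i * R b i) / n b) \<le> sqrt (aa b * rh b)"
    proof (intro always_eventually allI)
      fix b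
      have "\<bar>(\<Sum>i=1..N b. v b i * R b i) / n b\<bar> = \<bar>\<Sum>i=1..N b. v b i * R b i\<bar> / n b"
        by (simp add: n_def abs_divide)
      also have "\<dots> \<le> sqrt ((\<Sum>i=1..N b. (v b i)\<^sup>2) * (\<Sum>i=1..N b. (R b i)\<^sup>2)) / n b"
        by (intro divide_right_mono sum_prod_sqrt_bound) (simp add: n_def)
      also have "\<dots> = sqrt (aa b * rh b)"
        by (simp add: aa_def rh_def n_def real_sqrt_divide real_sqrt_mult)
      finally show "norm ((\<Sum>i=1..N b. v b i * R b i) / n b) \<le> sqrt (aa b * rh b)" by simp
    qed
    show "((\<lambda>b. sqrt (aa b * rh b)) \<longlongrightarrow> 0) F"
      using tendsto_real_sqrt[OF tendsto_mult[OF aa rh]] by simp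
  qed
  moreover have "((\<lambda>b. (c b / n b)\<^sup>2 * (u b)\<^sup>2) \<longlongrightarrow> 0) F"
  proof -
    have "((\<lambda>b. (c b / n b * u b)\<^sup>2) \<longlongrightarrow> 0\<^sup>2) F"
      by (intro tendsto_power tendsto_zero_mult_bounded[OF cn(2) ub])
    then show ?thesis by (simp only: power_mult_distrib zero_power2)
  qed
  ultimately have "((\<lambda>b. aa b + 2 * ((\<Sum>i=1..N b. v b i * R b i) / n b) + rh b
      + (c b / n b)\<^sup>2 * (u b)\<^sup>2) \<longlongrightarrow> s\<^sup>2 + 2 * 0 + 0 + 0) F"
    by (intro tendsto_intros aa rh)
  then have "(q \<longlongrightarrow> s\<^sup>2 + 2 * 0 + 0 + 0) F"
    by (rule Lim_transform_eventually) (use N1 q in \<open>auto elim!: eventually_mono\<close>)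
  then have qlim: "(q \<longlongrightarrow> s\<^sup>2) F" by simp
  have S'lim: "((\<lambda>b. S' b - s * y b) \<longlongrightarrow> 0) F"
  proof -
    have "((\<lambda>b. rr b - c b / n b * u b) \<longlongrightarrow> 0 - 0) F"
      by (intro tendsto_diff rr tendsto_zero_mult_bounded[OF cn(2) ub])
    then have "((\<lambda>b. S' b - s * y b) \<longlongrightarrow> 0 - 0) F"
      by (rule Lim_transform_eventually) (use N1 S' in \<open>auto elim!: eventually_mono simp: u_def\<close>)
    then show ?thesis by simp
  qed
  have S'b: "\<forall>\<^sub>F b in F. \<bar>S' b\<bar> \<le> s * K + 1"
  proof -
    have "\<forall>\<^sub>F b in F. \<bar>S' b - s * y b\<bar> < 1" using tendstoD[OF S'lim, of 1] by simp
    then show ?thesis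
    proof eventually_elim
      case (elim b)
      have "\<bar>s * y b\<bar> \<le> s * K" using K[of b] s by (simp add: abs_mult)
      with elim show ?case by linarith
    qed
  qed
  define B where "B b = (S b)\<^sup>2 / Q b" for b
  have qpos: "\<forall>\<^sub>F b in F. s\<^sup>2 / 2 < q b"
    by (rule order_tendstoD(1)[OF qlim]) (use s in simp)
  have BS': "B b = (S' b)\<^sup>2 / q b" if "1 \<le> N b" for b
    using that by (simp add: B_def S'_def q_def power_divide n_def)
  have Blim: "((\<lambda>b. B b - (y b)\<^sup>2) \<longlongrightarrow> 0) F"
  proof -
    have 1: "((\<lambda>b. (S' b - s * y b) * (S' b + s * y b)) \<longlongrightarrow> 0) F"
    proof (rule tendsto_zero_mult_bounded[OF S'lim])
      show "\<forall>\<^sub>F b in F. \<bar>S' b + s * y b\<bar> \<le> s * K + 1 + s * K"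
        using S'b
      proof eventually_elim
        case (elim b)
        have "\<bar>s * y b\<bar> \<le> s * K" using K[of b] s by (simp add: abs_mult)
        with elim show ?case by linarith
      qed
    qed
    have "((\<lambda>b. s\<^sup>2 - q b) \<longlongrightarrow> s\<^sup>2 - s\<^sup>2) F" by (intro tendsto_intros qlim)
    then have 2: "((\<lambda>b. (s\<^sup>2 - q b) * (y b)\<^sup>2) \<longlongrightarrow> 0) F"
      by (intro tendsto_zero_mult_bounded[where K = "K\<^sup>2"])
         (simp_all add: yK)
    \<comment> \<open>The numerator is \<open>S'^2 - q * y^2\<close>, with \<open>s^2 * y^2\<close>
      subtracted and added so that each part has a factor tending to 0.\<close>
    have "((\<lambda>b. ((S' b - s * y b) * (S' b + s * y b) + (s\<^sup>2 - q b) * (y b)\<^sup>2) / q b) \<longlongrightarrow> (0 + 0) / s\<^sup>2) F"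
      using s by (intro tendsto_intros 1 2 qlim) auto
    then have "((\<lambda>b. ((S' b - s * y b) * (S' b + s * y b) + (s\<^sup>2 - q b) * (y b)\<^sup>2) / q b) \<longlongrightarrow> 0) F" by simp
    then show ?thesis
    proof (rule Lim_transform_eventually)
      show "\<forall>\<^sub>F b in F. ((S' b - s * y b) * (S' b + s * y b) + (s\<^sup>2 - q b) * (y b)\<^sup>2) / q b = B b - (y b)\<^sup>2"
        using N1 qpos
      proof eventually_elim
        case (elim b)
        then have "q b > 0" using s by (smt (verit) zero_le_power2 divide_nonneg_nonneg)
        then show ?case using BS'[OF elim(1)] by (simp add: field_simps power2_eq_square)
      qed
    qed
  qed
  have Bb: "\<forall>\<^sub>F b in F. \<bar>B b\<bar> \<le> K\<^sup>2 + 1"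
  proof -
    have "\<forall>\<^sub>F b in F. \<bar>B b - (y b)\<^sup>2\<bar> < 1" using tendstoD[OF Blim, of 1] by simp
    then show ?thesis
    proof eventually_elim
      case (elim b)
      have "0 \<le> (y b)\<^sup>2" by simp
      then show ?case using elim yK[of b] by linarith
    qed
  qed
  \<comment> \<open>One bound for all entries: the linear part, the largest remainder (at most the
    root of the sum of squares) and the added value. The final 1 keeps it positive.\<close>
  define mm where "mm b = \<bar>m b\<bar> + sqrt (n b * rh b) + \<bar>c b * u b / sqrt (n b)\<bar> + 1" for b
  have mmpos: "0 < mm b" for b
    unfolding mm_def by (simp add: rh_def n_def add_nonneg_pos sum_nonneg)
  have Wm: "\<bar>W b i\<bar> \<le> mm b" if b: "1 \<le> N b" and i: "i \<in> {1..N b + 1}" for b i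
  proof (cases "i = N b + 1")
    case True
    then have "\<bar>W b i\<bar> = \<bar>c b * u b / sqrt (n b)\<bar>" using Wlast[OF b] by simp
    moreover have "0 \<le> sqrt (n b * rh b)" by (simp add: rh_def n_def sum_nonneg)
    ultimately show ?thesis unfolding mm_def by linarith
  next
    case False
    then have i': "i \<in> {1..N b}" using i by auto
    have "(R b i)\<^sup>2 \<le> (\<Sum>i=1..N b. (R b i)\<^sup>2)" using i' by (intro member_le_sum) auto
    also have "\<dots> = n b * rh b" using b by (simp add: rh_def n_def)
    finally have "\<bar>R b i\<bar> \<le> sqrt (n b * rh b)" by (metis real_sqrt_abs real_sqrt_le_iff)
    moreover have "0 \<le> \<bar>c b * u b / sqrt (n b)\<bar>" by simp
    ultimately show ?thesis using m[OF i'] Wi[OF i'] unfolding mm_def by linarith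
  qed
  have mmlim: "((\<lambda>b. mm b / sqrt (n b)) \<longlongrightarrow> 0) F"
  proof -
    have 1: "((\<lambda>b. \<bar>m b / sqrt (n b)\<bar>) \<longlongrightarrow> 0) F"
      using tendsto_rabs[OF mu] by (simp add: n_def)
    have 2: "((\<lambda>b. \<bar>c b / sqrt (n b) * u b\<bar> * (1 / sqrt (n b))) \<longlongrightarrow> 0) F"
      using tendsto_mult[OF tendsto_rabs[OF tendsto_zero_mult_bounded[OF cn(1) ub]] sqrtn] by simp
    have 3: "((\<lambda>b. sqrt (rh b)) \<longlongrightarrow> 0) F" using tendsto_real_sqrt[OF rh] by simp
    have "((\<lambda>b. \<bar>m b / sqrt (n b)\<bar> + sqrt (rh b) + \<bar>c b / sqrt (n b) * u b\<bar> * (1 / sqrt (n b)) + 1 / sqrt (n b))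
        \<longlongrightarrow> 0 + 0 + 0 + 0) F"
      by (intro tendsto_add 1 2 3 sqrtn)
    then have "((\<lambda>b. \<bar>m b / sqrt (n b)\<bar> + sqrt (rh b) + \<bar>c b / sqrt (n b) * u b\<bar> * (1 / sqrt (n b)) + 1 / sqrt (n b))
        \<longlongrightarrow> 0) F" by simp
    then show ?thesis
    proof (rule Lim_transform_eventually)
      show "\<forall>\<^sub>F b in F. \<bar>m b / sqrt (n b)\<bar> + sqrt (rh b) + \<bar>c b / sqrt (n b) * u b\<bar> * (1 / sqrt (n b)) + 1 / sqrt (n b)
          = mm b / sqrt (n b)"
        using N1
      proof eventually_elim
        case (elim b)
        then have "sqrt (n b) > 0" by (simp add: n_def)
        then show ?case
          by (simp add: mm_def add_divide_distrib abs_divide abs_mult real_sqrt_mult)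
      qed
    qed
  qed
  have small: "((\<lambda>b. mm b * \<bar>S b\<bar> / Q b) \<longlongrightarrow> 0) F"
  proof -
    have "((\<lambda>b. (mm b / sqrt (n b) * \<bar>S' b\<bar>) / q b) \<longlongrightarrow> 0 / s\<^sup>2) F"
      using s S'b by (intro tendsto_divide qlim tendsto_zero_mult_bounded[OF mmlim, where K = "s * K + 1"]) auto
    then have "((\<lambda>b. (mm b / sqrt (n b) * \<bar>S' b\<bar>) / q b) \<longlongrightarrow> 0) F" by simp
    then show ?thesis
    proof (rule Lim_transform_eventually)
      show "\<forall>\<^sub>F b in F. mm b / sqrt (n b) * \<bar>S' b\<bar> / q b = mm b * \<bar>S b\<bar> / Q b"
        using N1 by eventually_elim (simp add: S'_def q_def n_def abs_divide)
    qed
  qed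
  define T where "T b = - 2 * ln (adj_jel_ratio (N b) (x b))" for b
  have "((\<lambda>b. T b - B b) \<longlongrightarrow> 0) F"
  proof (rule tendstoI)
    fix e :: real assume e: "e > 0"
    \<comment> \<open>The 1/8 is the range of \<open>max_loglik_bounds\<close>. The other bound
      makes the final error \<open>8 * d * B\<close> at most e/2, as \<open>B\<close> is eventually
      at most \<open>K^2 + 1\<close>.\<close>
    define d where "d = min (1 / 8) (e / (16 * (K\<^sup>2 + 1)))"
    have K1: "K\<^sup>2 + 1 > 0" by (simp add: add_nonneg_pos)
    have d2: "d \<le> 1 / 8" "d \<le> e / (16 * (K\<^sup>2 + 1))"
      unfolding d_def by (rule min.cobounded1, rule min.cobounded2)
    have d: "0 < d" "d \<le> 1 / 8" "d \<le> e / (16 * (K\<^sup>2 + 1))"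
      by (use e K1 in \<open>simp add: d_def\<close>) (fact d2)+
    have "\<forall>\<^sub>F b in F. mm b * \<bar>S b\<bar> / Q b < d / 4"
      by (rule order_tendstoD(2)[OF small]) (use d in simp)
    then show "\<forall>\<^sub>F b in F. dist (T b - B b) 0 < e"
      using N1 qpos Bb
    proof eventually_elim
      case (elim b)
      have "0 < q b" using elim(3) s by (smt (verit) zero_le_power2 divide_nonneg_nonneg)
      then have Qpos: "0 < Q b" using elim(2) by (simp add: q_def n_def zero_less_divide_iff)
      obtain l where l: "multiplier {1..N b + 1} (W b) l" "T b = 2 * loglik {1..N b + 1} (W b) l"
        unfolding T_def W_def using adj_jel_ratio_multiplier[OF elim(2)] by blast
      note bounds = max_loglik_bounds[OF _ l(1) S_def[of b] Q_def[of b] Qpos Wm[OF elim(2)] mmpos d(1,2)]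
      have lo: "(1 - 4 * d) * B b \<le> T b" and up: "T b \<le> B b / (1 - 4 * d)"
        unfolding B_def l(2) using bounds elim(1) by auto
      have B0: "0 \<le> B b" using Qpos by (simp add: B_def)
      \<comment> \<open>For \<open>d <= 1 / 8\<close> the product (1 + 8d)(1 - 4d) = 1 + 4d(1 - 8d)
        is at least 1.\<close>
      have "B b / (1 - 4 * d) \<le> B b * (1 + 8 * d)"
      proof -
        have "0 \<le> d * (1 - 8 * d)" using d by simp
        then have "1 \<le> (1 + 8 * d) * (1 - 4 * d)" by (simp add: algebra_simps)
        then have "B b * 1 \<le> B b * ((1 + 8 * d) * (1 - 4 * d))" using B0 by (rule mult_left_mono)
        then show ?thesis using d by (simp add: pos_divide_le_eq mult.assoc)
      qed
      then have "T b - B b \<le> 8 * (d * B b)" using up by (simp add: algebra_simps)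
      moreover have "- (8 * (d * B b)) \<le> T b - B b"
      proof -
        have "0 \<le> d * B b" using B0 d by simp
        moreover have "B b - 4 * (d * B b) \<le> T b" using lo by (simp add: algebra_simps)
        ultimately show ?thesis by linarith
      qed
      ultimately have "\<bar>T b - B b\<bar> \<le> 8 * (d * B b)" by (simp add: abs_le_iff)
      moreover have "d * B b \<le> e / (16 * (K\<^sup>2 + 1)) * (K\<^sup>2 + 1)"
        using d(3) elim(4) B0 e K1 by (intro mult_mono) auto
      moreover have "e / (16 * (K\<^sup>2 + 1)) * (K\<^sup>2 + 1) = e / 16"
      proof -
        have "e / (16 * k) * k = e / 16" if "k > 0" for k using that by simp
        from this[OF K1] show ?thesis .
      qed
      ultimately have "\<bar>T b - B b\<bar> < e" using e by linarith
      then show ?case by (simp add: dist_real_def)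
    qed
  qed
  from tendsto_add[OF this Blim] show ?thesis by (simp add: T_def)
qed

subsection \<open>Convergence in outer probability\<close>

text \<open>Convergence to zero in outer probability, so that no measurability of the \<open>Y n\<close> is needed.\<close>

definition (in prob_space) vanishes :: "(nat \<Rightarrow> 'a \<Rightarrow> real) \<Rightarrow> bool" where
  "vanishes Y \<longleftrightarrow> (\<forall>e>0. \<forall>d>0. \<forall>\<^sub>F n in sequentially.
     \<exists>A\<in>events. prob A \<le> d \<and> (\<forall>\<omega>\<in>space M - A. \<bar>Y n \<omega>\<bar> < e))"

context prob_space
begin

lemma vanishesD:
  "vanishes Y \<Longrightarrow> e > 0 \<Longrightarrow> d > 0 \<Longrightarrow> \<forall>\<^sub>F n in sequentially.
     \<exists>A\<in>events. prob A \<le> d \<and> (\<forall>\<omega>\<in>space M - A. \<bar>Y n \<omega>\<bar> < e)"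
  by (auto simp: vanishes_def)

lemma vanishes_add:
  assumes "vanishes Y" "vanishes Z"
  shows "vanishes (\<lambda>n \<omega>. Y n \<omega> + Z n \<omega>)"
  unfolding vanishes_def
proof (intro allI impI)
  fix e d :: real assume "e > 0" "d > 0"
  then have "\<forall>\<^sub>F n in sequentially. \<exists>A\<in>events. prob A \<le> d / 2 \<and> (\<forall>\<omega>\<in>space M - A. \<bar>Y n \<omega>\<bar> < e / 2)"
    "\<forall>\<^sub>F n in sequentially. \<exists>A\<in>events. prob A \<le> d / 2 \<and> (\<forall>\<omega>\<in>space M - A. \<bar>Z n \<omega>\<bar> < e / 2)"
    using assms by (intro vanishesD; simp)+
  then show "\<forall>\<^sub>F n in sequentially. \<exists>A\<in>events. prob A \<le> d \<and> (\<forall>\<omega>\<in>space M - A. \<bar>Y n \<omega> + Z n \<omega>\<bar> < e)"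
  proof eventually_elim
    case (elim n)
    then obtain A B where AB: "A \<in> events" "B \<in> events" "prob A \<le> d / 2" "prob B \<le> d / 2"
      "\<And>\<omega>. \<omega> \<in> space M - A \<Longrightarrow> \<bar>Y n \<omega>\<bar> < e / 2" "\<And>\<omega>. \<omega> \<in> space M - B \<Longrightarrow> \<bar>Z n \<omega>\<bar> < e / 2" by blast
    have "prob (A \<union> B) \<le> d" using measure_Un_le[of A M B] AB(1-4) by simp
    moreover have "\<bar>Y n \<omega> + Z n \<omega>\<bar> < e" if "\<omega> \<in> space M - (A \<union> B)" for \<omega>
      using AB(5)[of \<omega>] AB(6)[of \<omega>] that by auto
    ultimately show ?case using AB(1,2) by (intro bexI[of _ "A \<union> B"]) auto
  qed
qed

lemma vanishes_abs: "vanishes Y \<Longrightarrow> vanishes (\<lambda>n \<omega>. \<bar>Y n \<omega>\<bar>)"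
  by (simp add: vanishes_def)

lemma vanishes_const:
  assumes "a \<longlonglongrightarrow> 0"
  shows "vanishes (\<lambda>n \<omega>. a n)"
  unfolding vanishes_def
proof (intro allI impI)
  fix e d :: real assume "e > 0" "d > 0"
  have "\<forall>\<^sub>F n in sequentially. \<bar>a n\<bar> < e" using tendstoD[OF assms \<open>e > 0\<close>] by simp
  then show "\<forall>\<^sub>F n in sequentially. \<exists>A\<in>events. prob A \<le> d \<and> (\<forall>\<omega>\<in>space M - A. \<bar>a n\<bar> < e)"
    by eventually_elim (use \<open>d > 0\<close> in \<open>auto intro!: bexI[of _ "{}"]\<close>)
qed

lemma vanishes_of_square:
  assumes "vanishes (\<lambda>n \<omega>. (Y n \<omega>)\<^sup>2)"
  shows "vanishes Y"
  unfolding vanishes_def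
proof (intro allI impI)
  fix e d :: real assume "e > 0" "d > 0"
  then have "\<forall>\<^sub>F n in sequentially. \<exists>A\<in>events. prob A \<le> d \<and> (\<forall>\<omega>\<in>space M - A. \<bar>(Y n \<omega>)\<^sup>2\<bar> < e\<^sup>2)"
    using vanishesD[OF assms] by simp
  then show "\<forall>\<^sub>F n in sequentially. \<exists>A\<in>events. prob A \<le> d \<and> (\<forall>\<omega>\<in>space M - A. \<bar>Y n \<omega>\<bar> < e)"
  proof (rule eventually_mono, elim bexE conjE)
    fix n A assume "A \<in> events" "prob A \<le> d" "\<forall>\<omega>\<in>space M - A. \<bar>(Y n \<omega>)\<^sup>2\<bar> < e\<^sup>2"
    then show "\<exists>A\<in>events. prob A \<le> d \<and> (\<forall>\<omega>\<in>space M - A. \<bar>Y n \<omega>\<bar> < e)"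
      using \<open>e > 0\<close> by (intro bexI[of _ A] conjI ballI power2_less_imp_less[of "\<bar>Y n _\<bar>" e]) auto
  qed
qed

lemma markov_bound:
  assumes "integrable M (\<lambda>\<omega>. \<bar>Z \<omega>\<bar>)" "Z \<in> borel_measurable M" "e > 0" "expectation (\<lambda>\<omega>. \<bar>Z \<omega>\<bar>) \<le> d * e"
  shows "\<exists>A\<in>events. prob A \<le> d \<and> (\<forall>\<omega>\<in>space M - A. \<bar>Z \<omega>\<bar> < e)"
proof -
  note [measurable] = assms(2)
  let ?A = "{\<omega> \<in> space M. e \<le> \<bar>Z \<omega>\<bar>}"
  have "prob ?A \<le> expectation (\<lambda>\<omega>. \<bar>Z \<omega>\<bar>) / e"
    using integral_Markov_inequality_measure[of M "\<lambda>\<omega>. \<bar>Z \<omega>\<bar>" "{}" e] assms by simp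
  also have "\<dots> \<le> d" using assms by (simp add: pos_divide_le_eq)
  finally show ?thesis by (intro bexI[of _ ?A]) auto
qed

lemma vanishes_L1:
  assumes meas: "\<forall>\<^sub>F n in sequentially. integrable M (Y n)"
    and le: "\<forall>\<^sub>F n in sequentially. expectation (\<lambda>\<omega>. \<bar>Y n \<omega>\<bar>) \<le> a n" and a: "a \<longlonglongrightarrow> 0"
  shows "vanishes Y"
  unfolding vanishes_def
proof (intro allI impI)
  fix e d :: real assume ed: "e > 0" "d > 0"
  have "\<forall>\<^sub>F n in sequentially. a n < d * e" by (rule order_tendstoD(2)[OF a]) (use ed in simp)
  then show "\<forall>\<^sub>F n in sequentially. \<exists>A\<in>events. prob A \<le> d \<and> (\<forall>\<omega>\<in>space M - A. \<bar>Y n \<omega>\<bar> < e)"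
    using meas le by eventually_elim (rule markov_bound, use ed in auto)
qed

text \<open>The frame of a truncation argument: \<open>Z\<close>, which may depend on the tolerance,
  comes from truncated variables, and Markov's inequality disposes of what was cut off.\<close>

lemma vanishes_approx:
  assumes "\<And>\<epsilon>. \<epsilon> > 0 \<Longrightarrow> \<exists>Z. vanishes Z \<and> (\<forall>\<^sub>F n in sequentially.
     integrable M (\<lambda>\<omega>. Y n \<omega> - Z n \<omega>) \<and> expectation (\<lambda>\<omega>. \<bar>Y n \<omega> - Z n \<omega>\<bar>) \<le> \<epsilon>)"
  shows "vanishes Y"
  unfolding vanishes_def
proof (intro allI impI)
  fix e d :: real assume ed: "e > 0" "d > 0"
  then have "d / 2 * (e / 2) > 0" by simp
  from assms[OF this] obtain Z where Z: "vanishes Z" and ap: "\<forall>\<^sub>F n in sequentially.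
     integrable M (\<lambda>\<omega>. Y n \<omega> - Z n \<omega>) \<and> expectation (\<lambda>\<omega>. \<bar>Y n \<omega> - Z n \<omega>\<bar>) \<le> d / 2 * (e / 2)" by blast
  from Z ed have "\<forall>\<^sub>F n in sequentially. \<exists>A\<in>events. prob A \<le> d / 2 \<and> (\<forall>\<omega>\<in>space M - A. \<bar>Z n \<omega>\<bar> < e / 2)"
    by (intro vanishesD) auto
  with ap show "\<forall>\<^sub>F n in sequentially. \<exists>A\<in>events. prob A \<le> d \<and> (\<forall>\<omega>\<in>space M - A. \<bar>Y n \<omega>\<bar> < e)"
  proof eventually_elim
    case (elim n)
    then obtain A where A: "A \<in> events" "prob A \<le> d / 2" "\<And>\<omega>. \<omega> \<in> space M - A \<Longrightarrow> \<bar>Z n \<omega>\<bar> < e / 2" by blast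
    obtain B where B: "B \<in> events" "prob B \<le> d / 2" "\<And>\<omega>. \<omega> \<in> space M - B \<Longrightarrow> \<bar>Y n \<omega> - Z n \<omega>\<bar> < e / 2"
      using markov_bound[of "\<lambda>\<omega>. Y n \<omega> - Z n \<omega>" "e / 2" "d / 2"] elim ed by auto
    have "prob (A \<union> B) \<le> d" using measure_Un_le[of A M B] A B by simp
    moreover have "\<bar>Y n \<omega>\<bar> < e" if "\<omega> \<in> space M - (A \<union> B)" for \<omega>
      using A(3)[of \<omega>] B(3)[of \<omega>] that abs_triangle_ineq[of "Y n \<omega> - Z n \<omega>" "Z n \<omega>"] by simp
    ultimately show ?case using A B by (intro bexI[of _ "A \<union> B"]) auto
  qed
qed

text \<open>A form of Slutsky's theorem: \<open>Y\<close> is tight by Chebyshev, and on the event where \<open>Y\<close> is bounded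
  the error \<open>T - Y\<^sup>2\<close> is controlled by the vanishing deviation \<open>Z\<close>.\<close>

lemma vanishes_slutsky:
  fixes Y Z T :: "nat \<Rightarrow> 'a \<Rightarrow> real" and C :: real
  assumes Z: "vanishes Z"
    and Y: "\<And>n. n \<ge> 1 \<Longrightarrow> Y n \<in> borel_measurable M" "\<And>n. n \<ge> 1 \<Longrightarrow> integrable M (\<lambda>\<omega>. (Y n \<omega>)\<^sup>2)"
      "\<And>n. n \<ge> 1 \<Longrightarrow> expectation (\<lambda>\<omega>. (Y n \<omega>)\<^sup>2) \<le> C"
    and T: "\<And>K e. e > 0 \<Longrightarrow> \<exists>d>0. \<forall>n\<ge>1. \<forall>\<omega>\<in>space M. \<bar>Z n \<omega>\<bar> < d \<longrightarrow> \<bar>Y n \<omega>\<bar> \<le> K \<longrightarrow> \<bar>T n \<omega>\<bar> < e"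
  shows "vanishes T"
  unfolding vanishes_def
proof (intro allI impI)
  fix e d :: real assume ed: "e > 0" "d > 0"
  \<comment> \<open>The level at which Chebyshev's inequality leaves probability at most d/2; adding
    1 keeps \<open>K\<close> positive.\<close>
  define K where "K = sqrt ((\<bar>C\<bar> + 1) / (d / 2))"
  have K: "K > 0" "C \<le> d / 2 * K\<^sup>2" using ed by (auto simp: K_def add_nonneg_pos)
  obtain b where b: "b > 0" "\<And>n \<omega>. n \<ge> 1 \<Longrightarrow> \<omega> \<in> space M \<Longrightarrow> \<bar>Z n \<omega>\<bar> < b \<Longrightarrow> \<bar>Y n \<omega>\<bar> \<le> K \<Longrightarrow> \<bar>T n \<omega>\<bar> < e"
    using T[OF ed(1), of K] by blast
  have "\<forall>\<^sub>F n in sequentially. \<exists>A\<in>events. prob A \<le> d / 2 \<and> (\<forall>\<omega>\<in>space M - A. \<bar>Z n \<omega>\<bar> < b)"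
    using b(1) ed by (intro vanishesD[OF Z]) auto
  then show "\<forall>\<^sub>F n in sequentially. \<exists>A\<in>events. prob A \<le> d \<and> (\<forall>\<omega>\<in>space M - A. \<bar>T n \<omega>\<bar> < e)"
    using eventually_ge_at_top[of 1]
  proof eventually_elim
    case (elim n)
    then obtain A where A: "A \<in> events" "prob A \<le> d / 2" "\<And>\<omega>. \<omega> \<in> space M - A \<Longrightarrow> \<bar>Z n \<omega>\<bar> < b" by blast
    have "expectation (\<lambda>\<omega>. (Y n \<omega>)\<^sup>2) \<le> d / 2 * K\<^sup>2" using Y(3)[OF elim(2)] K(2) by linarith
    then obtain B where B: "B \<in> events" "prob B \<le> d / 2" "\<And>\<omega>. \<omega> \<in> space M - B \<Longrightarrow> (Y n \<omega>)\<^sup>2 < K\<^sup>2"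
      using markov_bound[of "\<lambda>\<omega>. (Y n \<omega>)\<^sup>2" "K\<^sup>2" "d / 2"] Y(1,2)[OF elim(2)] K(1) by auto
    have "prob (A \<union> B) \<le> d" using measure_Un_le[of A M B] A B by simp
    moreover have "\<bar>T n \<omega>\<bar> < e" if "\<omega> \<in> space M - (A \<union> B)" for \<omega>
    proof (rule b(2)[OF elim(2)])
      have "(Y n \<omega>)\<^sup>2 < K\<^sup>2" using B(3) that by auto
      then show "\<bar>Y n \<omega>\<bar> \<le> K" using K(1) by (metis abs_le_square_iff abs_of_pos less_imp_le)
    qed (use A(3) that in auto)
    ultimately show ?case using A B by (intro bexI[of _ "A \<union> B"]) auto
  qed
qed

text \<open>Off a small event the two variables differ by less than \<open>h\<close>, which traps
  the probability for \<open>T n\<close> at \<open>a\<close> between those for the square at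
  \<open>a - h\<close> and \<open>a + h\<close>. The thirds of \<open>e\<close> pay for the limit,
  the exceptional event and the shift by \<open>h\<close>.\<close>

lemma cdf_square_limit:
  fixes m :: nat
  assumes Y: "\<And>n. Y n \<in> borel_measurable M"
    and T: "\<And>n. m \<le> n \<Longrightarrow> T n \<in> borel_measurable M"
    and diff: "vanishes (\<lambda>n \<omega>. T n \<omega> - (Y n \<omega>)\<^sup>2)"
    and conv: "\<And>a. (\<lambda>n. prob {\<omega> \<in> space M. (Y n \<omega>)\<^sup>2 \<le> a}) \<longlonglongrightarrow> H a"
    and cont: "isCont H a"
  shows "(\<lambda>n. prob {\<omega> \<in> space M. T n \<omega> \<le> a}) \<longlonglongrightarrow> H a"
proof (rule tendstoI)
  fix e :: real assume e: "e > 0"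
  then obtain b where b: "b > 0" "\<And>t. \<bar>t - a\<bar> < b \<Longrightarrow> \<bar>H t - H a\<bar> < e / 3"
    using cont[unfolded continuous_at_eps_delta] by (metis dist_real_def zero_less_divide_iff zero_less_numeral)
  define h where "h = b / 2"
  have h: "h > 0" "\<bar>H (a + h) - H a\<bar> < e / 3" "\<bar>H (a - h) - H a\<bar> < e / 3"
    using b(2)[of "a + h"] b(2)[of "a - h"] b(1) by (simp_all add: h_def)
  have 1: "\<forall>\<^sub>F n in sequentially. \<bar>prob {\<omega> \<in> space M. (Y n \<omega>)\<^sup>2 \<le> a + h} - H (a + h)\<bar> < e / 3"
    "\<forall>\<^sub>F n in sequentially. \<bar>prob {\<omega> \<in> space M. (Y n \<omega>)\<^sup>2 \<le> a - h} - H (a - h)\<bar> < e / 3"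
    using tendstoD[OF conv, of "e / 3"] e by (simp_all add: dist_real_def)
  have 2: "\<forall>\<^sub>F n in sequentially. \<exists>A\<in>events. prob A \<le> e / 3 \<and> (\<forall>\<omega>\<in>space M - A. \<bar>T n \<omega> - (Y n \<omega>)\<^sup>2\<bar> < h)"
    using h(1) e by (intro vanishesD[OF diff]) auto
  from 1 2 eventually_ge_at_top[of m]
  show "\<forall>\<^sub>F n in sequentially. dist (prob {\<omega> \<in> space M. T n \<omega> \<le> a}) (H a) < e"
  proof eventually_elim
    case (elim n)
    note [measurable] = Y[of n] T[OF elim(4)]
    obtain A where A: "A \<in> events" "prob A \<le> e / 3"
      "\<And>\<omega>. \<omega> \<in> space M - A \<Longrightarrow> \<bar>T n \<omega> - (Y n \<omega>)\<^sup>2\<bar> < h" using elim(3) by blast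
    note [measurable] = A(1)
    have "prob {\<omega> \<in> space M. T n \<omega> \<le> a} \<le> prob ({\<omega> \<in> space M. (Y n \<omega>)\<^sup>2 \<le> a + h} \<union> A)"
    proof (rule finite_measure_mono)
      show "{\<omega> \<in> space M. T n \<omega> \<le> a} \<subseteq> {\<omega> \<in> space M. (Y n \<omega>)\<^sup>2 \<le> a + h} \<union> A"
        using A(3) by (fastforce simp: abs_less_iff)
    qed measurable
    also have "\<dots> \<le> prob {\<omega> \<in> space M. (Y n \<omega>)\<^sup>2 \<le> a + h} + prob A"
      by (rule measure_Un_le) measurable
    finally have up: "prob {\<omega> \<in> space M. T n \<omega> \<le> a} \<le> prob {\<omega> \<in> space M. (Y n \<omega>)\<^sup>2 \<le> a + h} + prob A" .
    have "prob {\<omega> \<in> space M. (Y n \<omega>)\<^sup>2 \<le> a - h} \<le> prob ({\<omega> \<in> space M. T n \<omega> \<le> a} \<union> A)"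
    proof (rule finite_measure_mono)
      show "{\<omega> \<in> space M. (Y n \<omega>)\<^sup>2 \<le> a - h} \<subseteq> {\<omega> \<in> space M. T n \<omega> \<le> a} \<union> A"
        using A(3) by (fastforce simp: abs_less_iff)
    qed measurable
    also have "\<dots> \<le> prob {\<omega> \<in> space M. T n \<omega> \<le> a} + prob A"
      by (rule measure_Un_le) measurable
    finally have lo: "prob {\<omega> \<in> space M. (Y n \<omega>)\<^sup>2 \<le> a - h} \<le> prob {\<omega> \<in> space M. T n \<omega> \<le> a} + prob A" .
    show ?case unfolding dist_real_def abs_less_iff
      using up lo A(2) elim(1,2) h(2,3) unfolding abs_less_iff by linarith
  qed
qed

end

subsection \<open>Limit theorems for the projection\<close>

context iid_sample
begin

lemma iid_f_measurable:
  assumes "i \<ge> 1" and [measurable]: "f \<in> borel_measurable borel"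
  shows "(\<lambda>\<omega>. f (X i \<omega>) :: real) \<in> borel_measurable M"
  using X_measurable[OF assms(1)] by measurable

lemma
  fixes f :: "real \<Rightarrow> real"
  assumes f [measurable]: "f \<in> borel_measurable borel" and sq: "integrable D (\<lambda>x. (f x)\<^sup>2)"
    and zero: "(\<integral>x. f x \<partial>D) = 0"
  shows centred_sum_square_integrable: "integrable M (\<lambda>\<omega>. (\<Sum>i=1..n. f (X i \<omega>))\<^sup>2)"
    and centred_sum_square_expectation:
      "expectation (\<lambda>\<omega>. (\<Sum>i=1..n. f (X i \<omega>))\<^sup>2) = real n * (\<integral>x. (f x)\<^sup>2 \<partial>D)"
proof -
  have sqX: "integrable M (\<lambda>\<omega>. (f (X i \<omega>))\<^sup>2)" if "i \<ge> 1" for i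
    using integrable_X_iff[OF that, of "\<lambda>x. (f x)\<^sup>2"] sq by simp
  have int: "integrable M (\<lambda>\<omega>. f (X i \<omega>) * f (X j \<omega>))" if ij: "i \<ge> 1" "j \<ge> 1" for i j
  proof (rule integrable_abs_bound)
    show "integrable M (\<lambda>\<omega>. ((f (X i \<omega>))\<^sup>2 + (f (X j \<omega>))\<^sup>2) / 2)"
      using sqX ij by simp
    show "\<bar>f (X i \<omega>) * f (X j \<omega>)\<bar> \<le> ((f (X i \<omega>))\<^sup>2 + (f (X j \<omega>))\<^sup>2) / 2" for \<omega>
      using sum_squares_bound[of "\<bar>f (X i \<omega>)\<bar>" "\<bar>f (X j \<omega>)\<bar>"] by (simp add: abs_mult)
  qed (use ij in \<open>auto intro!: borel_measurable_times iid_f_measurable\<close>)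
  have prod: "expectation (\<lambda>\<omega>. f (X i \<omega>) * f (X j \<omega>)) = (if i = j then \<integral>x. (f x)\<^sup>2 \<partial>D else 0)"
    if ij: "i \<ge> 1" "j \<ge> 1" for i j
  proof (cases "i = j")
    case True
    then show ?thesis using expectation_X[OF ij(1), of "\<lambda>x. (f x)\<^sup>2"] by (simp add: power2_eq_square)
  next
    case False
    note [measurable] = X_measurable[OF ij(1)] X_measurable[OF ij(2)]
    have "integrable (distr M (borel \<Otimes>\<^sub>M borel) (\<lambda>\<omega>. (X i \<omega>, X j \<omega>))) (\<lambda>p. f (fst p) * f (snd p))"
      using int[OF ij] by (subst integrable_distr_eq) auto
    then have i2: "integrable (D \<Otimes>\<^sub>M D) (\<lambda>p. f (fst p) * f (snd p))"
      by (simp only: indep_pair[OF ij False])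
    have "expectation (\<lambda>\<omega>. f (X i \<omega>) * f (X j \<omega>))
       = integral\<^sup>L (distr M (borel \<Otimes>\<^sub>M borel) (\<lambda>\<omega>. (X i \<omega>, X j \<omega>))) (\<lambda>p. f (fst p) * f (snd p))"
      by (subst integral_distr) auto
    also have "\<dots> = (\<integral>x. \<integral>y. f x * f y \<partial>D \<partial>D)"
      unfolding indep_pair[OF ij False] using DD.integral_fst'[OF i2] by simp
    also have "\<dots> = 0" using zero by simp
    finally show ?thesis using False by simp
  qed
  have eq: "(\<Sum>i=1..n. f (X i \<omega>))\<^sup>2 = (\<Sum>i=1..n. \<Sum>j=1..n. f (X i \<omega>) * f (X j \<omega>))" for \<omega>
    by (simp add: power2_eq_square sum_product)
  show "integrable M (\<lambda>\<omega>. (\<Sum>i=1..n. f (X i \<omega>))\<^sup>2)"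
    unfolding eq by (intro Bochner_Integration.integrable_sum int) auto
  have "expectation (\<lambda>\<omega>. (\<Sum>i=1..n. f (X i \<omega>))\<^sup>2)
      = (\<Sum>i=1..n. \<Sum>j=1..n. expectation (\<lambda>\<omega>. f (X i \<omega>) * f (X j \<omega>)))"
    unfolding eq using int by (subst Bochner_Integration.integral_sum)
      (auto intro!: Bochner_Integration.integrable_sum sum.cong Bochner_Integration.integral_sum)
  also have "\<dots> = (\<Sum>i=1..n. \<Sum>j=1..n. if i = j then \<integral>x. (f x)\<^sup>2 \<partial>D else 0)"
    by (intro sum.cong refl prod) auto
  finally show "expectation (\<lambda>\<omega>. (\<Sum>i=1..n. f (X i \<omega>))\<^sup>2) = real n * (\<integral>x. (f x)\<^sup>2 \<partial>D)"
    by simp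
qed

text \<open>The intended \<open>f\<close> is a squared projection with only a first moment.
  Chebyshev is applied to the truncation \<open>min (f x) k\<close>, and the excess over
  \<open>k\<close> is small in mean.\<close>

lemma weak_law_of_large_numbers_nonneg:
  fixes f :: "real \<Rightarrow> real"
  assumes f [measurable]: "f \<in> borel_measurable borel" and nonneg: "\<And>x. 0 \<le> f x"
    and int: "integrable D f"
  shows "vanishes (\<lambda>n \<omega>. (\<Sum>i=1..n. f (X i \<omega>)) / real n - (\<integral>x. f x \<partial>D))"
proof (rule vanishes_approx)
  fix e :: real assume e: "e > 0"
  define g where "g k x = min (f x) (real k)" for k x
  have g [measurable]: "g k \<in> borel_measurable borel" for k unfolding g_def by measurable
  have gf: "0 \<le> g k x" "g k x \<le> f x" "g k x \<le> real k" for k x using nonneg by (auto simp: g_def)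
  have gi: "integrable D (g k)" for k
    by (rule integrable_abs_bound[OF int]) (use gf in auto)
  have "(\<lambda>k. \<integral>x. g k x \<partial>D) \<longlonglongrightarrow> (\<integral>x. f x \<partial>D)"
  proof (rule integral_dominated_convergence[where w = f])
    show "AE x in D. (\<lambda>k. g k x) \<longlonglongrightarrow> f x"
    proof (rule AE_I2)
      fix x
      obtain N where "f x \<le> real N" using real_arch_simple by blast
      then have "\<forall>\<^sub>F k in sequentially. g k x = f x"
        by (intro eventually_sequentiallyI[of N]) (auto simp: g_def)
      then show "(\<lambda>k. g k x) \<longlonglongrightarrow> f x" by (rule tendsto_eventually)
    qed
    show "AE x in D. norm (g k x) \<le> f x" for k using gf by simp
  qed (use int in auto)
  from tendstoD[OF this, of "e / 2"] e
  have "\<forall>\<^sub>F k in sequentially. \<bar>(\<integral>x. g k x \<partial>D) - (\<integral>x. f x \<partial>D)\<bar> < e / 2"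
    by (simp add: dist_real_def)
  \<comment> \<open>The excess has mean below e/2; it counts twice, once in the sample average and
    once in the expectation.\<close>
  then obtain k where k: "\<bar>(\<integral>x. g k x \<partial>D) - (\<integral>x. f x \<partial>D)\<bar> < e / 2"
    by (meson eventually_happens' sequentially_bot)
  define m where "m = (\<integral>x. g k x \<partial>D)"
  define h where "h x = g k x - m" for x
  have h [measurable]: "h \<in> borel_measurable borel" unfolding h_def by measurable
  have h0: "(\<integral>x. h x \<partial>D) = 0" using gi D.prob_space by (simp add: h_def m_def)
  have "integrable D (\<lambda>x. (g k x)\<^sup>2)"
    by (rule integrable_abs_bound[of D "\<lambda>x. (real k)\<^sup>2"]) (use gf in \<open>auto intro: power_mono\<close>)
  then have hsq: "integrable D (\<lambda>x. (h x)\<^sup>2)"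
    unfolding h_def power2_diff using gi by simp
  define Z where "Z n \<omega> = (\<Sum>i=1..n. h (X i \<omega>)) / real n" for n \<omega>
  have Z: "vanishes Z"
  proof (rule vanishes_of_square, rule vanishes_L1)
    have Z2: "(Z n \<omega>)\<^sup>2 = (\<Sum>i=1..n. h (X i \<omega>))\<^sup>2 / (real n)\<^sup>2" for n \<omega> by (simp add: Z_def power_divide)
    show "\<forall>\<^sub>F n in sequentially. integrable M (\<lambda>\<omega>. (Z n \<omega>)\<^sup>2)"
      unfolding Z2 using centred_sum_square_integrable[OF h hsq h0] by simp
    show "\<forall>\<^sub>F n in sequentially. expectation (\<lambda>\<omega>. \<bar>(Z n \<omega>)\<^sup>2\<bar>) \<le> (\<integral>x. (h x)\<^sup>2 \<partial>D) / real n"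
      using eventually_ge_at_top[of 1]
    proof eventually_elim
      case (elim n)
      have "expectation (\<lambda>\<omega>. \<bar>(Z n \<omega>)\<^sup>2\<bar>) = real n * (\<integral>x. (h x)\<^sup>2 \<partial>D) / (real n)\<^sup>2"
        unfolding Z2 using centred_sum_square_expectation[OF h hsq h0] by simp
      then show ?case by (simp add: power2_eq_square)
    qed
    show "(\<lambda>n. (\<integral>x. (h x)\<^sup>2 \<partial>D) / real n) \<longlonglongrightarrow> 0"
      by (rule lim_const_over_n)
  qed
  let ?Y = "\<lambda>n \<omega>. (\<Sum>i=1..n. f (X i \<omega>)) / real n - (\<integral>x. f x \<partial>D)"
  have "integrable M (\<lambda>\<omega>. ?Y n \<omega> - Z n \<omega>) \<and> expectation (\<lambda>\<omega>. \<bar>?Y n \<omega> - Z n \<omega>\<bar>) \<le> e" if n: "n \<ge> 1" for n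
  proof -
    let ?r = "\<lambda>x. f x - g k x"
    let ?t = "(\<integral>x. f x \<partial>D) - m"
    have t: "0 \<le> ?t" unfolding m_def using integral_mono[OF gi int] gf by simp
    have YZ: "?Y n \<omega> - Z n \<omega> = (\<Sum>i=1..n. ?r (X i \<omega>)) / real n - ?t" for \<omega>
      using n by (simp add: Z_def h_def sum_subtractf diff_divide_distrib)
    have ri: "integrable M (\<lambda>\<omega>. ?r (X i \<omega>))" "expectation (\<lambda>\<omega>. ?r (X i \<omega>)) = ?t" if "i \<ge> 1" for i
      using integrable_X_iff[OF that, of ?r] expectation_X[OF that, of ?r] int gi by (simp_all add: m_def)
    have si: "integrable M (\<lambda>\<omega>. (\<Sum>i=1..n. ?r (X i \<omega>)) / real n)"
      using ri(1) by (intro Bochner_Integration.integrable_divide Bochner_Integration.integrable_sum) auto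
    have i: "integrable M (\<lambda>\<omega>. ?Y n \<omega> - Z n \<omega>)" unfolding YZ using si by simp
    \<comment> \<open>The difference is an average of nonnegative terms minus its mean
      \<open>?t\<close>, so its modulus is at most their sum.\<close>
    have "expectation (\<lambda>\<omega>. \<bar>?Y n \<omega> - Z n \<omega>\<bar>) \<le> expectation (\<lambda>\<omega>. (\<Sum>i=1..n. ?r (X i \<omega>)) / real n + ?t)"
    proof (rule integral_mono)
      show "\<bar>?Y n \<omega> - Z n \<omega>\<bar> \<le> (\<Sum>i=1..n. ?r (X i \<omega>)) / real n + ?t" for \<omega>
      proof -
        have "0 \<le> (\<Sum>i=1..n. ?r (X i \<omega>)) / real n" using gf by (intro divide_nonneg_nonneg sum_nonneg) auto
        then show ?thesis unfolding YZ using t by (simp add: abs_if)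
      qed
    qed (use i si in auto)
    also have "\<dots> = (\<Sum>i=1..n. expectation (\<lambda>\<omega>. ?r (X i \<omega>))) / real n + ?t"
      using si ri(1) prob_space by (simp add: Bochner_Integration.integral_sum)
    also have "(\<Sum>i=1..n. expectation (\<lambda>\<omega>. ?r (X i \<omega>))) = (\<Sum>i=1..n. ?t)"
      by (intro sum.cong refl ri(2)) auto
    also have "(\<Sum>i=1..n. ?t) / real n + ?t = 2 * ?t" using n by simp
    also have "\<dots> \<le> e" using k unfolding m_def abs_less_iff by simp
    finally show ?thesis using i by simp
  qed
  then show "\<exists>Z. vanishes Z \<and> (\<forall>\<^sub>F n in sequentially.
     integrable M (\<lambda>\<omega>. ?Y n \<omega> - Z n \<omega>) \<and> expectation (\<lambda>\<omega>. \<bar>?Y n \<omega> - Z n \<omega>\<bar>) \<le> e)"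
    using Z by (intro exI[of _ Z] conjI eventually_sequentiallyI[of 1]) auto
qed

text \<open>A union bound over the sample. By Markov's inequality on the tail, n P(|f| >= e sqrt n)
  is at most e^-2 times the integral of f^2 over the set where f^2 >= e^2 n, and this tends to 0 by
  dominated convergence.\<close>

lemma max_negligible:
  fixes f :: "real \<Rightarrow> real"
  assumes f [measurable]: "f \<in> borel_measurable borel" and sq: "integrable D (\<lambda>x. (f x)\<^sup>2)"
  shows "vanishes (\<lambda>n \<omega>. Max ((\<lambda>i. \<bar>f (X i \<omega>)\<bar>) ` {1..n}) / sqrt (real n))"
  unfolding vanishes_def
proof (intro allI impI)
  fix e d :: real assume ed: "e > 0" "d > 0"
  let ?B = "\<lambda>n. {x. e\<^sup>2 * real n \<le> (f x)\<^sup>2}"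
  have "(\<lambda>n. \<integral>x. (f x)\<^sup>2 * indicator (?B n) x \<partial>D) \<longlonglongrightarrow> (\<integral>x. 0 \<partial>D)"
  proof (rule integral_dominated_convergence[where w = "\<lambda>x. (f x)\<^sup>2"])
    show "AE x in D. (\<lambda>n. (f x)\<^sup>2 * indicator (?B n) x) \<longlonglongrightarrow> 0"
    proof (rule AE_I2)
      fix x
      obtain N where N: "(f x)\<^sup>2 / e\<^sup>2 < real N" using reals_Archimedean2 by blast
      have "(f x)\<^sup>2 * indicator (?B n) x = 0" if "n \<ge> N" for n
      proof -
        have "(f x)\<^sup>2 / e\<^sup>2 < real n" using N that by simp
        then have "(f x)\<^sup>2 < e\<^sup>2 * real n" using ed by (simp add: field_simps)
        then show ?thesis by simp
      qed
      then show "(\<lambda>n. (f x)\<^sup>2 * indicator (?B n) x) \<longlonglongrightarrow> 0"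
        by (intro tendsto_eventually eventually_sequentiallyI[of N])
    qed
  qed (use sq in \<open>auto simp: indicator_def\<close>)
  then have lim: "(\<lambda>n. \<integral>x. (f x)\<^sup>2 * indicator (?B n) x \<partial>D) \<longlonglongrightarrow> 0" by simp
  have "\<forall>\<^sub>F n in sequentially. (\<integral>x. (f x)\<^sup>2 * indicator (?B n) x \<partial>D) < d * e\<^sup>2"
    by (rule order_tendstoD(2)[OF lim]) (use ed in simp)
  then show "\<forall>\<^sub>F n in sequentially. \<exists>A\<in>events. prob A \<le> d \<and>
     (\<forall>\<omega>\<in>space M - A. \<bar>Max ((\<lambda>i. \<bar>f (X i \<omega>)\<bar>) ` {1..n}) / sqrt (real n)\<bar> < e)"
    using eventually_ge_at_top[of 1]
  proof eventually_elim
    case (elim n)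
    let ?A = "\<lambda>i. {\<omega> \<in> space M. X i \<omega> \<in> ?B n}"
    have A: "?A i \<in> events" if "i \<ge> 1" for i
      using X_measurable[OF that] by measurable
    have int: "integrable D (\<lambda>x. (f x)\<^sup>2 * indicator (?B n) x)"
      by (rule integrable_abs_bound[OF sq]) (auto simp: indicator_def)
    have pA: "prob (?A i) = measure D (?B n)" if "i \<ge> 1" for i
    proof -
      have "measure D (?B n) = measure (distr M borel (X i)) (?B n)" by (simp only: distr_X[OF that])
      also have "\<dots> = prob (?A i)"
        using X_measurable[OF that] by (subst measure_distr) (auto intro!: arg_cong[where f = prob])
      finally show ?thesis ..
    qed
    have "e\<^sup>2 * real n * measure D (?B n) = (\<integral>x. e\<^sup>2 * real n * indicator (?B n) x \<partial>D)" by simp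
    also have "\<dots> \<le> (\<integral>x. (f x)\<^sup>2 * indicator (?B n) x \<partial>D)"
    proof (rule integral_mono[OF _ int])
      show "integrable D (\<lambda>x. e\<^sup>2 * real n * indicator (?B n) x)"
        by (intro integrable_mult_right integrable_real_indicator) (auto simp: D.emeasure_eq_measure)
    qed (auto simp: indicator_def)
    also have "\<dots> \<le> d * e\<^sup>2" using elim(1) by simp
    finally have "e\<^sup>2 * (real n * measure D (?B n)) \<le> e\<^sup>2 * d" by (simp add: mult_ac)
    then have nB: "real n * measure D (?B n) \<le> d" using ed by (simp add: mult_le_cancel_left)
    have "prob (\<Union>i\<in>{1..n}. ?A i) \<le> (\<Sum>i\<in>{1..n}. prob (?A i))"
      by (rule finite_measure_subadditive_finite) (use A in auto)
    also have "\<dots> = real n * measure D (?B n)" using pA by simp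
    finally have "prob (\<Union>i\<in>{1..n}. ?A i) \<le> d" using nB by simp
    moreover have "\<bar>Max ((\<lambda>i. \<bar>f (X i \<omega>)\<bar>) ` {1..n}) / sqrt (real n)\<bar> < e"
      if "\<omega> \<in> space M - (\<Union>i\<in>{1..n}. ?A i)" for \<omega>
    proof -
      have "\<bar>f (X i \<omega>)\<bar> < e * sqrt (real n)" if i: "i \<in> {1..n}" for i
      proof (rule power2_less_imp_less)
        have "(f (X i \<omega>))\<^sup>2 < e\<^sup>2 * real n" using \<open>\<omega> \<in> _\<close> i by force
        then show "\<bar>f (X i \<omega>)\<bar>\<^sup>2 < (e * sqrt (real n))\<^sup>2" by (simp add: power_mult_distrib)
      qed (use ed in simp)
      then have "Max ((\<lambda>i. \<bar>f (X i \<omega>)\<bar>) ` {1..n}) < e * sqrt (real n)"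
        using elim(2) by (subst Max_less_iff) auto
      moreover have "0 \<le> Max ((\<lambda>i. \<bar>f (X i \<omega>)\<bar>) ` {1..n})"
      proof -
        have "\<bar>f (X 1 \<omega>)\<bar> \<le> Max ((\<lambda>i. \<bar>f (X i \<omega>)\<bar>) ` {1..n})" using elim(2) by (intro Max_ge) auto
        then show ?thesis by linarith
      qed
      ultimately show ?thesis using elim(2) by (simp add: pos_divide_less_eq)
    qed
    moreover have "(\<Union>i\<in>{1..n}. ?A i) \<in> events" using A by (intro sets.finite_UN) auto
    ultimately show ?case by blast
  qed
qed

lemma clt_centred:
  fixes f :: "real \<Rightarrow> real"
  assumes f [measurable]: "f \<in> borel_measurable borel" and sq: "integrable D (\<lambda>x. (f x)\<^sup>2)"
    and zero: "(\<integral>x. f x \<partial>D) = 0" and s: "0 < s" "s\<^sup>2 = (\<integral>x. (f x)\<^sup>2 \<partial>D)"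
  shows "weak_conv_m (\<lambda>n. distr M borel (\<lambda>\<omega>. (\<Sum>i=1..n. f (X i \<omega>)) / (s * sqrt (real n)))) std_normal_distribution"
proof -
  \<comment> \<open>Reindexing through singleton blocks, since the sample starts at 1 and the
    central limit theorem at 0.\<close>
  have "indep_vars (\<lambda>j. PiM {Suc j} (\<lambda>_. borel)) (\<lambda>j \<omega>. restrict (\<lambda>i. X i \<omega>) {Suc j}) UNIV"
    by (rule indep_vars_restrict[OF indep]) (auto simp: disjoint_family_on_def)
  then have "indep_vars (\<lambda>_. borel) (\<lambda>j \<omega>. f (restrict (\<lambda>i. X i \<omega>) {Suc j} (Suc j))) UNIV"
    by (rule indep_vars_compose2[where Y = "\<lambda>j z. f (z (Suc j))"]) measurable
  then have ind: "indep_vars (\<lambda>_. borel) (\<lambda>j \<omega>. f (X (Suc j) \<omega>)) UNIV" by simp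
  have "weak_conv_m (\<lambda>n. distr M borel (\<lambda>\<omega>. (\<Sum>i<n. f (X (Suc i) \<omega>)) / sqrt (real n * s\<^sup>2))) std_normal_distribution"
  proof (rule central_limit_theorem_zero_mean[OF ind])
    show m: "expectation (\<lambda>\<omega>. f (X (Suc n) \<omega>)) = 0" for n
      using expectation_X[of "Suc n" f] zero by simp
    show "integrable M (\<lambda>\<omega>. (f (X (Suc n) \<omega>))\<^sup>2)" for n
      using integrable_X_iff[of "Suc n" "\<lambda>x. (f x)\<^sup>2"] sq by simp
    show "variance (\<lambda>\<omega>. f (X (Suc n) \<omega>)) = s\<^sup>2" for n
      unfolding m using expectation_X[of "Suc n" "\<lambda>x. (f x)\<^sup>2"] s by simp
    show "distr M borel (\<lambda>\<omega>. f (X (Suc n) \<omega>)) = distr D borel f" for n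
    proof -
      have "distr D borel f = distr (distr M borel (X (Suc n))) borel f" by (simp add: distr_X)
      also have "\<dots> = distr M borel (f \<circ> X (Suc n))" using X_measurable[of "Suc n"] by (intro distr_distr) auto
      finally show ?thesis by (simp add: comp_def)
    qed
  qed (rule s)
  moreover have "(\<Sum>i<n. f (X (Suc i) \<omega>)) / sqrt (real n * s\<^sup>2) = (\<Sum>i=1..n. f (X i \<omega>)) / (s * sqrt (real n))" for n \<omega>
    using s(1) by (simp add: real_sqrt_mult mult.commute sum.atLeast1_atMost_eq)
  ultimately show ?thesis by simp
qed

text \<open>The projection has slope \<open>1/6 - F (1 - F)\<close>, hence it is strictly increasing in the lower tail.\<close>

lemma proj_variance_pos:
  assumes atomless: "\<And>x. measure D {x} = 0"
  shows "0 < (\<integral>x. (proj x)\<^sup>2 \<partial>D)"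
proof (rule ccontr)
  assume "\<not> ?thesis"
  moreover have "0 \<le> (\<integral>x. (proj x)\<^sup>2 \<partial>D)" by simp
  ultimately have "(\<integral>x. (proj x)\<^sup>2 \<partial>D) = 0" by linarith
  then have ae: "AE x in D. proj x = 0"
    using integral_nonneg_eq_0_iff_AE[OF integrable_proj_square] by simp
  have "\<exists>x. cdf D x < 1 / 12"
    using order_tendstoD(2)[OF D.cdf_lim_at_bot, of "1 / 12"] by (auto simp: eventually_at_bot_linorder)
  then obtain a where a: "cdf D a < 1 / 12" by blast
  have "\<exists>x. 1 / 12 < cdf D x"
    using order_tendstoD(1)[OF D.cdf_lim_at_top_prob, of "1 / 12"] by (auto simp: eventually_at_top_linorder)
  then obtain b where b: "1 / 12 < cdf D b" by blast
  have ab: "a \<le> b" using a b D.cdf_nondecreasing[of b a] by (cases "a \<le> b") auto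
  \<comment> \<open>Continuity of the cdf comes from the absence of atoms. Any level in (0, 1/6)
    would do: below it the slope bound \<open>1 / 6 - q\<close> is positive.\<close>
  have "\<exists>x\<ge>a. x \<le> b \<and> cdf D x = 1 / 12"
    by (rule IVT) (use a b ab atomless D.isCont_cdf in auto)
  then obtain x0 where x0: "cdf D x0 = 1 / 12" by blast
  have mono: "proj x < proj x'" if xx: "x < x'" "x' \<le> x0" for x x'
  proof -
    let ?i = "\<lambda>y. indicator {..x'} y :: real"
    define q where "q = cdf D x'"
    have q: "q \<le> 1 / 12" using D.cdf_nondecreasing[OF xx(2)] x0 by (simp add: q_def)
    have qi: "(\<integral>z. ?i z \<partial>D) = q" by (simp add: q_def cdf_def)
    have ii: "integrable D ?i" by (simp add: D.emeasure_eq_measure)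
    \<comment> \<open>Moving \<open>x\<close> to \<open>x'\<close> raises the mean by a third of the
      step. The median rises by at most the full step, and not at all if \<open>y\<close> and
      \<open>z\<close> both exceed \<open>x'\<close>.\<close>
    have K: "(x' - x) * (1 / 6 - ?i y / 2 - ?i z / 2) \<le> sym_kernel x' y z - sym_kernel x y z" for y z
      unfolding sym_kernel_eq_mean_median using xx(1)
      by (simp add: indicator_def max_def min_def field_simps)
    have "(x' - x) * (1 / 6 - ?i y / 2 - q / 2) \<le> (\<integral>z. sym_kernel x' y z \<partial>D) - (\<integral>z. sym_kernel x y z \<partial>D)" for y
    proof -
      have "(\<integral>z. (x' - x) * (1 / 6 - ?i y / 2 - ?i z / 2) \<partial>D) \<le> (\<integral>z. sym_kernel x' y z - sym_kernel x y z \<partial>D)"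
        using K ii by (intro integral_mono) (auto intro!: integrable_sym_kernel)
      then show ?thesis using ii qi integrable_sym_kernel D.prob_space by simp
    qed
    then have "(\<integral>y. (x' - x) * (1 / 6 - ?i y / 2 - q / 2) \<partial>D)
        \<le> (\<integral>y. (\<integral>z. sym_kernel x' y z \<partial>D) - (\<integral>z. sym_kernel x y z \<partial>D) \<partial>D)"
      using ii by (intro integral_mono) (auto intro!: integrable_inner)
    then have "(x' - x) * (1 / 6 - q) \<le> proj x' - proj x"
      using ii qi integrable_inner D.prob_space by (simp add: proj_def)
    moreover have "0 < (x' - x) * (1 / 6 - q)" using xx(1) q by simp
    ultimately show ?thesis by linarith
  qed
  \<comment> \<open>Strict monotonicity leaves at most one zero below \<open>x0\<close>. It is a
    null set, so almost sure vanishing of \<open>proj\<close> would give the lower tail probability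
    0 instead of 1/12.\<close>
  have "\<exists>z. {x. x \<le> x0 \<and> proj x = 0} \<subseteq> {z}"
  proof (cases "{x. x \<le> x0 \<and> proj x = 0} = {}")
    case False
    then obtain z where z: "z \<le> x0" "proj z = 0" by blast
    have "x = z" if "x \<le> x0" "proj x = 0" for x
      using mono[of x z] mono[of z x] z that by (cases x z rule: linorder_cases) auto
    then show ?thesis by blast
  qed auto
  then obtain z where z: "{x. x \<le> x0 \<and> proj x = 0} \<subseteq> {z}" by blast
  have "AE x in D. x \<noteq> z"
    using atomless[of z] by (intro AE_not_in[where N = "{z}", simplified]) (simp add: null_sets_def D.emeasure_eq_measure)
  with ae have "AE x in D. x \<notin> {..x0}" by eventually_elim (use z in auto)
  then have "measure D {..x0} = 0"
    by (subst D.prob_eq_0) auto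
  with x0 show False by (simp add: cdf_def)
qed

end

subsection \<open>Second moments of the remainder\<close>

lemma square_le_falling:
  assumes "6 \<le> n"
  shows "(real n)\<^sup>2 / 4 \<le> (real n - 1) * (real n - 2)"
  using mult_mono[of "real n / 2" "real n - 1" "real n / 2" "real n - 2"] assms
  by (simp add: power2_eq_square)

lemma normalizer_bound:
  assumes "6 \<le> n"
  shows "6 / ((real n - 1) * (real n - 2)) \<le> 24 / (real n)\<^sup>2"
proof -
  have "6 / ((real n - 1) * (real n - 2)) \<le> 6 / ((real n)\<^sup>2 / 4)"
    using square_le_falling[OF assms] assms by (intro divide_left_mono) auto
  then show ?thesis by simp
qed

lemma card_triples_le: "real (card (triples {1..n})) \<le> (real n) ^ 3"
proof -
  have "card (triples {1..n}) \<le> card ({1..n} \<times> {1..n} \<times> {1..n})"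
    using triples_subset[of "{1..n}"] by (intro card_mono) auto
  also have "\<dots> = n ^ 3" by (simp add: card_cartesian_product power3_eq_cube)
  finally show ?thesis by (metis of_nat_le_iff of_nat_power)
qed

context iid_sample
begin

lemma U_stat_measurable:
  assumes "I \<subseteq> {1..}"
  shows "(\<lambda>\<omega>. U_stat I (\<lambda>i. X i \<omega>)) \<in> borel_measurable M"
  unfolding U_stat_def
proof (intro borel_measurable_times borel_measurable_const borel_measurable_sum)
  fix t assume "t \<in> {(k, j, i). k \<in> I \<and> j \<in> I \<and> i \<in> I \<and> k < j \<and> j < i}"
  then obtain k j i where "t = (k, j, i)" "k \<ge> 1" "j \<ge> 1" "i \<ge> 1" using assms by auto
  then show "(\<lambda>\<omega>. case t of (k, j, i) \<Rightarrow> sym_kernel (X i \<omega>) (X j \<omega>) (X k \<omega>)) \<in> borel_measurable M"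
    using X_measurable by (auto intro!: sym_kernel_measurable)
qed

lemma pseudo_value_measurable: "(\<lambda>\<omega>. pseudo_value n (\<lambda>i. X i \<omega>) l) \<in> borel_measurable M"
  unfolding pseudo_value_def
  by (intro borel_measurable_diff borel_measurable_times borel_measurable_const U_stat_measurable) auto

lemma adj_pseudo_value_measurable:
  "(\<lambda>\<omega>. adj_pseudo_value n (\<lambda>i. X i \<omega>) l) \<in> borel_measurable M"
  unfolding adj_pseudo_value_def using pseudo_value_measurable
  by (cases "l = n + 1") (auto intro!: borel_measurable_times borel_measurable_sum)

end

context centred_iid_sample
begin

definition pseudo_resid :: "nat \<Rightarrow> nat \<Rightarrow> 'a \<Rightarrow> real" where
  "pseudo_resid n l \<omega> = pseudo_value n (\<lambda>i. X i \<omega>) l - 3 * proj (X l \<omega>)"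

lemma kernel_eq_triple_resid:
  "(k, j, i) \<in> triples {1..n} \<Longrightarrow> sym_kernel (X i \<omega>) (X j \<omega>) (X k \<omega>)
     = triple_resid (k, j, i) \<omega> + (proj (X i \<omega>) + proj (X j \<omega>) + proj (X k \<omega>))"
  unfolding triple_resid_def resid_def by (simp, metis sym_kernel_commute)

text \<open>Balance of orders: c^2 is of order n^-4 against at most n^2 triples with 3n partners
  each, which gives 1/n. The triples avoiding \<open>l\<close> are of order n^3, but their factor
  \<open>(c - c')^2\<close> is of order n^-6, which gives n^-2.\<close>

lemma
  assumes n: "6 \<le> n" and l: "l \<in> {1..n}"
  shows pseudo_resid_square_integrable: "integrable M (\<lambda>\<omega>. (pseudo_resid n l \<omega>)\<^sup>2)"
    and pseudo_resid_square_expectation: "expectation (\<lambda>\<omega>. (pseudo_resid n l \<omega>)\<^sup>2) \<le> 60000 * resid_var / real n"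
proof -
  define c c' where "c = 6 / ((real n - 1) * (real n - 2))" and "c' = 6 / ((real n - 2) * (real n - 3))"
  define S T where "S = {t \<in> triples {1..n}. l \<in> elems t}" and "T = {t \<in> triples {1..n}. l \<notin> elems t}"
  have ST: "S \<subseteq> triples {1..n}" "T \<subseteq> triples {1..n}" by (auto simp: S_def T_def)
  have decomp: "pseudo_resid n l \<omega> = c * (\<Sum>t\<in>S. triple_resid t \<omega>) + (c - c') * (\<Sum>t\<in>T. triple_resid t \<omega>)" for \<omega>
    unfolding pseudo_resid_def c_def c'_def S_def T_def
    by (rule pseudo_value_decomposition[of n l "\<lambda>i. X i \<omega>" "\<lambda>t. triple_resid t \<omega>" "\<lambda>i. proj (X i \<omega>)"])
       (use n l in \<open>simp_all add: kernel_eq_triple_resid\<close>)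
  have meas: "pseudo_resid n l \<in> borel_measurable M"
    unfolding pseudo_resid_def[abs_def] using l
    by (intro borel_measurable_diff borel_measurable_times borel_measurable_const
        pseudo_value_measurable iid_f_measurable) auto
  have n2: "real n \<ge> 6" using n by simp
  have "(real n)\<^sup>2 / 4 \<le> (real n - 1) * (real n - 2)" by (rule square_le_falling[OF n])
  have c: "0 \<le> c" "c \<le> 24 / (real n)\<^sup>2"
    using n2 normalizer_bound[OF n] by (simp_all add: c_def)
  have "c' - c = 12 / ((real n - 1) * (real n - 2) * (real n - 3))"
    using n2 by (simp add: c_def c'_def divide_simps)
  \<comment> \<open>The threshold 6 is where \<open>n - 3\<close> reaches
    \<open>n / 2\<close>.\<close>
  moreover have "(real n) ^ 3 / 8 \<le> (real n - 1) * (real n - 2) * (real n - 3)"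
    using mult_mono[OF \<open>(real n)\<^sup>2 / 4 \<le> (real n - 1) * (real n - 2)\<close>, of "real n / 2" "real n - 3"] n2
    by (simp add: power2_eq_square power3_eq_cube)
  then have "12 / ((real n - 1) * (real n - 2) * (real n - 3)) \<le> 12 / ((real n) ^ 3 / 8)"
    using n2 by (intro divide_left_mono) auto
  moreover have "0 \<le> 12 / ((real n - 1) * (real n - 2) * (real n - 3))" using n2 by simp
  ultimately have "0 \<le> c' - c" "c' - c \<le> 12 / ((real n) ^ 3 / 8)" by (simp_all only:)
  then have cc: "\<bar>c - c'\<bar> \<le> 96 / (real n) ^ 3" by simp
  have c2: "c\<^sup>2 \<le> 576 / (real n) ^ 4"
    using power_mono[OF c(2,1), of 2] by (simp add: power_divide flip: power_mult)
  have cc2: "(c - c')\<^sup>2 \<le> 9216 / (real n) ^ 6"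
    using power_mono[OF cc abs_ge_zero, of 2] by (simp add: power_divide flip: power_mult)
  have cardS: "real (card S) \<le> (real n)\<^sup>2"
  proof -
    have "real (card S) = (real n - 1) * (real n - 2) / 2"
      using card_triples_containing[of "{1..n}" l] l n by (simp add: S_def real_choose_2 of_nat_diff)
    also have "\<dots> \<le> (real n)\<^sup>2"
    proof -
      have le: "(real n - 1) * (real n - 2) \<le> (real n)\<^sup>2"
        unfolding power2_eq_square using n2 by (intro mult_mono) auto
      have "p / 2 \<le> q" if "p \<le> q" "0 \<le> q" for p q :: real using that by simp
      from this[OF le zero_le_power2] show ?thesis .
    qed
    finally show ?thesis .
  qed
  have "card T \<le> card (triples {1..n})" using ST(2) by (intro card_mono) auto
  then have cardT: "real (card T) \<le> (real n) ^ 3" using card_triples_le[of n] by linarith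
  let ?v = "resid_var"
  note v = resid_var_nonneg
  have eS: "expectation (\<lambda>\<omega>. (\<Sum>t\<in>S. triple_resid t \<omega>)\<^sup>2) \<le> (real n)\<^sup>2 * (3 * real n * ?v)"
    using sum_triple_resid_square_expectation[OF ST(1)] cardS v by (elim order_trans) (intro mult_right_mono, auto)
  have eT: "expectation (\<lambda>\<omega>. (\<Sum>t\<in>T. triple_resid t \<omega>)\<^sup>2) \<le> (real n) ^ 3 * (3 * real n * ?v)"
    using sum_triple_resid_square_expectation[OF ST(2)] cardT v by (elim order_trans) (intro mult_right_mono, auto)
  let ?b = "\<lambda>\<omega>. 2 * c\<^sup>2 * (\<Sum>t\<in>S. triple_resid t \<omega>)\<^sup>2 + 2 * (c - c')\<^sup>2 * (\<Sum>t\<in>T. triple_resid t \<omega>)\<^sup>2"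
  have b: "integrable M ?b"
    using sum_triple_resid_square_integrable[OF ST(1)] sum_triple_resid_square_integrable[OF ST(2)] by simp
  have resid_le: "(pseudo_resid n l \<omega>)\<^sup>2 \<le> ?b \<omega>" for \<omega>
  proof -
    have "(p + q)\<^sup>2 \<le> 2 * p\<^sup>2 + 2 * q\<^sup>2" for p q :: real
      using zero_le_power2[of "p - q"] by (simp add: power2_eq_square algebra_simps)
    from this[of "c * (\<Sum>t\<in>S. triple_resid t \<omega>)" "(c - c') * (\<Sum>t\<in>T. triple_resid t \<omega>)"]
    show ?thesis unfolding decomp by (simp add: power_mult_distrib)
  qed
  show int: "integrable M (\<lambda>\<omega>. (pseudo_resid n l \<omega>)\<^sup>2)"
    by (rule integrable_abs_bound[OF b]) (use meas resid_le in auto)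
  have "expectation (\<lambda>\<omega>. (pseudo_resid n l \<omega>)\<^sup>2) \<le> expectation ?b"
    by (intro integral_mono int b resid_le)
  also have "\<dots> = 2 * (c\<^sup>2 * expectation (\<lambda>\<omega>. (\<Sum>t\<in>S. triple_resid t \<omega>)\<^sup>2))
      + 2 * ((c - c')\<^sup>2 * expectation (\<lambda>\<omega>. (\<Sum>t\<in>T. triple_resid t \<omega>)\<^sup>2))"
    using sum_triple_resid_square_integrable[OF ST(1)] sum_triple_resid_square_integrable[OF ST(2)] by simp
  also have "\<dots> \<le> 2 * (576 / (real n) ^ 4 * ((real n)\<^sup>2 * (3 * real n * ?v)))
      + 2 * (9216 / (real n) ^ 6 * ((real n) ^ 3 * (3 * real n * ?v)))"
    using eS eT c2 cc2 v by (intro add_mono mult_left_mono mult_mono) auto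
  \<comment> \<open>Here 3456 = 2 * 576 * 3 and 55296 = 2 * 9216 * 3; together they stay below
    60000.\<close>
  also have "\<dots> = 3456 * ?v / real n + 55296 * ?v / (real n)\<^sup>2"
    using n2 by (simp add: field_simps eval_nat_numeral)
  also have "55296 * ?v / (real n)\<^sup>2 \<le> 55296 * ?v / real n"
    using n2 v by (intro divide_left_mono) (auto simp: power2_eq_square)
  also have "3456 * ?v / real n + 55296 * ?v / real n \<le> 60000 * ?v / real n"
    using v n2 by (simp add: add_divide_distrib[symmetric] divide_right_mono)
  finally show "expectation (\<lambda>\<omega>. (pseudo_resid n l \<omega>)\<^sup>2) \<le> 60000 * resid_var / real n" by simp
qed

lemma
  assumes n: "6 \<le> n"
  shows sum_pseudo_resid_square_integrable: "integrable M (\<lambda>\<omega>. (\<Sum>l=1..n. pseudo_resid n l \<omega>)\<^sup>2)"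
    and sum_pseudo_resid_square_expectation: "expectation (\<lambda>\<omega>. (\<Sum>l=1..n. pseudo_resid n l \<omega>)\<^sup>2) \<le> 60000 * resid_var"
proof -
  define c where "c = 6 / ((real n - 1) * (real n - 2))"
  let ?T = "triples {1..n}"
  have decomp: "(\<Sum>l=1..n. pseudo_resid n l \<omega>) = c * (\<Sum>t\<in>?T. triple_resid t \<omega>)" for \<omega>
    unfolding pseudo_resid_def c_def
    by (rule sum_pseudo_value_decomposition[of n "\<lambda>i. X i \<omega>" "\<lambda>t. triple_resid t \<omega>" "\<lambda>i. proj (X i \<omega>)"])
       (use n in \<open>simp_all add: kernel_eq_triple_resid\<close>)
  have n2: "real n \<ge> 6" using n by simp
  have c: "0 \<le> c" "c \<le> 24 / (real n)\<^sup>2"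
    using n2 normalizer_bound[OF n] by (simp_all add: c_def)
  have c2: "c\<^sup>2 \<le> 576 / (real n) ^ 4"
    using power_mono[OF c(2,1), of 2] by (simp add: power_divide flip: power_mult)
  note cardT = card_triples_le[of n]
  note v = resid_var_nonneg
  have eT: "expectation (\<lambda>\<omega>. (\<Sum>t\<in>?T. triple_resid t \<omega>)\<^sup>2) \<le> (real n) ^ 3 * (3 * real n * resid_var)"
    using sum_triple_resid_square_expectation[OF order_refl, of n] cardT v by (elim order_trans) (intro mult_right_mono, auto)
  show "integrable M (\<lambda>\<omega>. (\<Sum>l=1..n. pseudo_resid n l \<omega>)\<^sup>2)"
    unfolding decomp power_mult_distrib using sum_triple_resid_square_integrable[OF order_refl, of n] by simp
  have "expectation (\<lambda>\<omega>. (\<Sum>l=1..n. pseudo_resid n l \<omega>)\<^sup>2) = c\<^sup>2 * expectation (\<lambda>\<omega>. (\<Sum>t\<in>?T. triple_resid t \<omega>)\<^sup>2)"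
    unfolding decomp power_mult_distrib by simp
  also have "\<dots> \<le> 576 / (real n) ^ 4 * ((real n) ^ 3 * (3 * real n * resid_var))"
    using eT c2 v by (intro mult_mono) auto
  also have "\<dots> = 1728 * resid_var"
    using n2 by (simp add: field_simps eval_nat_numeral)
  \<comment> \<open>Enlarged to the constant of the individual bound, so that one null sequence
    serves both estimates.\<close>
  also have "\<dots> \<le> 60000 * resid_var" using v by simp
  finally show "expectation (\<lambda>\<omega>. (\<Sum>l=1..n. pseudo_resid n l \<omega>)\<^sup>2) \<le> 60000 * resid_var" .
qed

end

subsection \<open>The limit law\<close>

text \<open>Reflecting both integration variables shows that \<open>proj\<close> is odd under the
  reflection, so its integral equals its own negative.\<close>

lemma (in iid_sample) centred_of_reflection:
  assumes "distr D borel (\<lambda>x. a - x) = D"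
  shows "(\<integral>x. proj x \<partial>D) = 0"
proof -
  have refl: "(\<integral>x. f x \<partial>D) = (\<integral>x. f (a - x) \<partial>D)" if f: "f \<in> borel_measurable borel" for f :: "real \<Rightarrow> real"
    by (subst assms[symmetric], subst integral_distr) (use f in auto)
  have inner: "(\<lambda>y. \<integral>z. sym_kernel x y z \<partial>D) \<in> borel_measurable borel" for x
    using inner_measurable'[of x] by simp
  have "proj (a - x) = - proj x" for x
  proof -
    have "proj (a - x) = (\<integral>y. \<integral>z. sym_kernel (a - x) (a - y) z \<partial>D \<partial>D)"
      unfolding proj_def by (rule refl[OF inner])
    also have "\<dots> = (\<integral>y. \<integral>z. sym_kernel (a - x) (a - y) (a - z) \<partial>D \<partial>D)"
      by (subst refl) auto
    finally show ?thesis by (simp add: sym_kernel_reflect proj_def)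
  qed
  then have "(\<integral>x. proj x \<partial>D) = - (\<integral>x. proj x \<partial>D)"
    using refl[OF proj_measurable] by simp
  then show ?thesis by simp
qed

context centred_iid_sample
begin

definition sd :: real where
  "sd = sqrt (9 * (\<integral>x. (proj x)\<^sup>2 \<partial>D))"

definition std_sum :: "nat \<Rightarrow> 'a \<Rightarrow> real" where
  "std_sum n \<omega> = (\<Sum>i=1..n. 3 * proj (X i \<omega>)) / (sd * sqrt (real n))"

text \<open>One number that dominates everything that must tend to 0 in
  \<open>jel_statistic_asymptotics\<close>. The term \<open>1 / n\<close> makes a small deviation
  force a large sample.\<close>

definition deviation :: "nat \<Rightarrow> 'a \<Rightarrow> real" where
  "deviation n \<omega> = \<bar>(\<Sum>i=1..n. (3 * proj (X i \<omega>))\<^sup>2) / real n - sd\<^sup>2\<bar>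
     + \<bar>(\<Sum>i=1..n. (pseudo_resid n i \<omega>)\<^sup>2) / real n\<bar> + \<bar>(\<Sum>i=1..n. pseudo_resid n i \<omega>) / sqrt (real n)\<bar>
     + \<bar>Max ((\<lambda>i. \<bar>3 * proj (X i \<omega>)\<bar>) ` {1..n}) / sqrt (real n)\<bar> + 1 / real n"

definition jel_stat :: "nat \<Rightarrow> 'a \<Rightarrow> real" where
  "jel_stat n \<omega> = - 2 * ln (adj_jel_ratio n (\<lambda>i. X i \<omega>))"

lemma sd_square: "sd\<^sup>2 = (\<integral>x. (3 * proj x)\<^sup>2 \<partial>D)"
  by (simp add: sd_def power_mult_distrib)

lemma proj3: "(\<lambda>x. 3 * proj x) \<in> borel_measurable borel" "integrable D (\<lambda>x. (3 * proj x)\<^sup>2)"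
  "(\<integral>x. 3 * proj x \<partial>D) = 0"
  using integrable_proj_square centred by (simp_all add: power_mult_distrib)

lemma jel_stat_measurable: "1 \<le> n \<Longrightarrow> jel_stat n \<in> borel_measurable M"
  unfolding jel_stat_def[abs_def] by (rule jel_statistic_measurable, assumption, rule adj_pseudo_value_measurable)

lemma deviation_vanishes: "vanishes deviation"
  unfolding deviation_def[abs_def]
proof (intro vanishes_add vanishes_abs)
  show "vanishes (\<lambda>n \<omega>. (\<Sum>i=1..n. (3 * proj (X i \<omega>))\<^sup>2) / real n - sd\<^sup>2)"
    unfolding sd_square using proj3
    by (intro weak_law_of_large_numbers_nonneg[where f = "\<lambda>x. (3 * proj x)\<^sup>2"]) auto
  show "vanishes (\<lambda>n \<omega>. Max ((\<lambda>i. \<bar>3 * proj (X i \<omega>)\<bar>) ` {1..n}) / sqrt (real n))"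
    using proj3 by (intro max_negligible[where f = "\<lambda>x. 3 * proj x"]) auto
  show "vanishes (\<lambda>n \<omega>. 1 / real n)"
    by (rule vanishes_const) (rule lim_1_over_n)
  have lim: "(\<lambda>n. 60000 * resid_var / real n) \<longlonglongrightarrow> 0"
    by (rule lim_const_over_n)
  show "vanishes (\<lambda>n \<omega>. (\<Sum>i=1..n. (pseudo_resid n i \<omega>)\<^sup>2) / real n)"
  proof (rule vanishes_L1[OF _ _ lim])
    show "\<forall>\<^sub>F n in sequentially. integrable M (\<lambda>\<omega>. (\<Sum>i=1..n. (pseudo_resid n i \<omega>)\<^sup>2) / real n)"
      using eventually_ge_at_top[of 6]
      by eventually_elim (intro Bochner_Integration.integrable_divide Bochner_Integration.integrable_sum pseudo_resid_square_integrable)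
    show "\<forall>\<^sub>F n in sequentially. expectation (\<lambda>\<omega>. \<bar>(\<Sum>i=1..n. (pseudo_resid n i \<omega>)\<^sup>2) / real n\<bar>) \<le> 60000 * resid_var / real n"
      using eventually_ge_at_top[of 6]
    proof eventually_elim
      case (elim n)
      have "expectation (\<lambda>\<omega>. \<bar>(\<Sum>i=1..n. (pseudo_resid n i \<omega>)\<^sup>2) / real n\<bar>)
          = (\<Sum>i=1..n. expectation (\<lambda>\<omega>. (pseudo_resid n i \<omega>)\<^sup>2)) / real n"
        using pseudo_resid_square_integrable[OF elim] by (simp add: sum_nonneg Bochner_Integration.integral_sum)
      also have "\<dots> \<le> (\<Sum>i=1..n. 60000 * resid_var / real n) / real n"
        by (intro divide_right_mono sum_mono pseudo_resid_square_expectation elim) auto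
      also have "\<dots> = 60000 * resid_var / real n" by simp
      finally show ?case .
    qed
  qed
  show "vanishes (\<lambda>n \<omega>. (\<Sum>i=1..n. pseudo_resid n i \<omega>) / sqrt (real n))"
  proof (rule vanishes_of_square, rule vanishes_L1[OF _ _ lim])
    have sq: "((\<Sum>i=1..n. pseudo_resid n i \<omega>) / sqrt (real n))\<^sup>2 = (\<Sum>i=1..n. pseudo_resid n i \<omega>)\<^sup>2 / real n" for n \<omega>
      by (simp add: power_divide)
    show "\<forall>\<^sub>F n in sequentially. integrable M (\<lambda>\<omega>. ((\<Sum>i=1..n. pseudo_resid n i \<omega>) / sqrt (real n))\<^sup>2)"
      unfolding sq using eventually_ge_at_top[of 6]
      by eventually_elim (intro Bochner_Integration.integrable_divide sum_pseudo_resid_square_integrable)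
    show "\<forall>\<^sub>F n in sequentially. expectation (\<lambda>\<omega>. \<bar>((\<Sum>i=1..n. pseudo_resid n i \<omega>) / sqrt (real n))\<^sup>2\<bar>) \<le> 60000 * resid_var / real n"
      unfolding sq using eventually_ge_at_top[of 6]
      by eventually_elim (use sum_pseudo_resid_square_expectation in \<open>simp add: divide_right_mono\<close>)
  qed
qed

text \<open>If no \<open>d\<close> worked, the choices 1/(k+1) would produce sample sizes and sample
  points along which the deviation tends to 0 while the error stays at least \<open>e\<close>. The
  deterministic expansion along this sequence excludes that. The sample point varies with
  \<open>k\<close>, hence no probability appears.\<close>

lemma jel_stat_eq_square_on_good_event:
  assumes sd: "0 < sd" and e: "0 < e"
  shows "\<exists>d>0. \<forall>n\<ge>1. \<forall>\<omega>\<in>space M. \<bar>deviation n \<omega>\<bar> < d \<longrightarrow> \<bar>std_sum n \<omega>\<bar> \<le> K \<longrightarrow> \<bar>jel_stat n \<omega> - (std_sum n \<omega>)\<^sup>2\<bar> < e"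
proof (rule ccontr)
  assume "\<not> ?thesis"
  then have "\<forall>k::nat. \<exists>n \<omega>. 1 \<le> n \<and> \<bar>deviation n \<omega>\<bar> < inverse (real (Suc k)) \<and> \<bar>std_sum n \<omega>\<bar> \<le> K \<and> e \<le> \<bar>jel_stat n \<omega> - (std_sum n \<omega>)\<^sup>2\<bar>"
    by (metis inverse_positive_iff_positive not_less of_nat_0_less_iff zero_less_Suc)
  then obtain N w where Nw: "\<And>k::nat. 1 \<le> N k" "\<And>k. \<bar>deviation (N k) (w k)\<bar> < inverse (real (Suc k))"
    "\<And>k. \<bar>std_sum (N k) (w k)\<bar> \<le> K" "\<And>k. e \<le> \<bar>jel_stat (N k) (w k) - (std_sum (N k) (w k))\<^sup>2\<bar>"
    by metis
  have deviation0: "(\<lambda>k. deviation (N k) (w k)) \<longlonglongrightarrow> 0"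
    by (rule Lim_null_comparison[OF _ LIMSEQ_inverse_real_of_nat])
       (intro always_eventually allI, use Nw(2) in \<open>simp add: less_imp_le\<close>)
  have part: "h \<longlonglongrightarrow> 0" if "\<And>k. \<bar>h k\<bar> \<le> deviation (N k) (w k)" for h :: "nat \<Rightarrow> real"
    by (rule Lim_null_comparison[OF _ deviation0]) (use that in auto)
  \<comment> \<open>The sample sizes chosen above are arbitrary; that they tend to infinity is read
    off from the last term of \<open>deviation\<close>.\<close>
  have "(\<lambda>k. 1 / real (N k)) \<longlonglongrightarrow> 0"
    by (rule part) (simp add: deviation_def add_nonneg_nonneg)
  moreover have "\<forall>\<^sub>F k in sequentially. 1 / real (N k) > 0" using Nw(1) by (simp add: Suc_le_eq)
  ultimately have "filterlim (\<lambda>k. inverse (1 / real (N k))) at_top sequentially"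
    by (rule filterlim_inverse_at_top)
  then have N: "filterlim N at_top sequentially"
    by (simp add: filterlim_sequentially_iff_filterlim_real)
  have "(\<lambda>k. (\<Sum>i=1..N k. (3 * proj (X i (w k)))\<^sup>2) / real (N k) - sd\<^sup>2) \<longlonglongrightarrow> 0"
    by (rule part) (simp add: deviation_def add_nonneg_nonneg)
  then have a: "(\<lambda>k. (\<Sum>i=1..N k. (3 * proj (X i (w k)))\<^sup>2) / real (N k)) \<longlonglongrightarrow> sd\<^sup>2"
    by (rule LIM_zero_cancel)
  have rho: "(\<lambda>k. (\<Sum>i=1..N k. (pseudo_resid (N k) i (w k))\<^sup>2) / real (N k)) \<longlonglongrightarrow> 0"
    by (rule part) (simp add: deviation_def add_nonneg_nonneg)
  have r: "(\<lambda>k. (\<Sum>i=1..N k. pseudo_resid (N k) i (w k)) / sqrt (real (N k))) \<longlonglongrightarrow> 0"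
    by (rule part) (simp add: deviation_def add_nonneg_nonneg)
  have mu: "(\<lambda>k. Max ((\<lambda>i. \<bar>3 * proj (X i (w k))\<bar>) ` {1..N k}) / sqrt (real (N k))) \<longlonglongrightarrow> 0"
    by (rule part) (simp add: deviation_def add_nonneg_nonneg)
  have "(\<lambda>k. jel_stat (N k) (w k) - (std_sum (N k) (w k))\<^sup>2) \<longlonglongrightarrow> 0"
    unfolding jel_stat_def std_sum_def
    by (rule jel_statistic_asymptotics[OF N sd Nw(3)[unfolded std_sum_def] a rho[unfolded pseudo_resid_def] r[unfolded pseudo_resid_def] mu])
       (auto intro!: Max_ge)
  from tendstoD[OF this e] obtain k where "\<bar>jel_stat (N k) (w k) - (std_sum (N k) (w k))\<^sup>2\<bar> < e"
    by (auto simp: eventually_sequentially)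
  with Nw(4)[of k] show False by linarith
qed

lemma jel_stat_close_to_square:
  assumes "0 < sd"
  shows "vanishes (\<lambda>n \<omega>. jel_stat n \<omega> - (std_sum n \<omega>)\<^sup>2)"
proof (rule vanishes_slutsky[OF deviation_vanishes, where Y = std_sum and C = 1])
  have Y2: "(std_sum n \<omega>)\<^sup>2 = (\<Sum>i=1..n. 3 * proj (X i \<omega>))\<^sup>2 / (sd\<^sup>2 * real n)" for n \<omega>
    by (simp add: std_sum_def power_divide power_mult_distrib)
  fix n :: nat assume n: "n \<ge> 1"
  show "std_sum n \<in> borel_measurable M"
    unfolding std_sum_def[abs_def] using proj3
    by (intro borel_measurable_divide borel_measurable_sum borel_measurable_const
        iid_f_measurable[where f = "\<lambda>x. 3 * proj x"]) auto
  show "integrable M (\<lambda>\<omega>. (std_sum n \<omega>)\<^sup>2)"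
    unfolding Y2 using centred_sum_square_integrable[OF proj3] by simp
  show "expectation (\<lambda>\<omega>. (std_sum n \<omega>)\<^sup>2) \<le> 1"
  proof -
    have "expectation (\<lambda>\<omega>. (\<Sum>i=1..n. 3 * proj (X i \<omega>))\<^sup>2) = real n * sd\<^sup>2"
      unfolding sd_square by (rule centred_sum_square_expectation[OF proj3])
    then show ?thesis unfolding Y2 using n assms by simp
  qed
qed (rule jel_stat_eq_square_on_good_event[OF assms])

end

text \<open>The coordinate map carries the one-fold product to its only factor. The right-hand side
  is a Gaussian measure of a set, so weak convergence on continuity sets applies to it.\<close>

lemma chi_square_1_cdf:
  "cdf (chi_square_measure 1) a = measure std_normal_distribution {y. y\<^sup>2 \<le> a}"
proof -
  let ?N = "std_normal_distribution"
  interpret N: real_distribution ?N by (rule real_dist_normal_dist)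
  interpret P: product_prob_space "\<lambda>_::nat. ?N" "{..<1}" ..
  let ?P = "\<Pi>\<^sub>M i\<in>{..<1::nat}. ?N"
  have S: "sets ?P = sets (\<Pi>\<^sub>M i\<in>{..<1::nat}. borel)" by (intro sets_PiM_cong) auto
  have m: "(\<lambda>z. z 0) \<in> measurable ?P ?N" by (rule measurable_component_singleton) simp
  have "cdf (chi_square_measure 1) a = measure ?P ((\<lambda>z. (z 0)\<^sup>2) -` {..a} \<inter> space ?P)"
  proof -
    have "(\<lambda>z. (z 0)\<^sup>2) \<in> borel_measurable ?P" using m by measurable
    then show ?thesis unfolding chi_square_measure_def cdf_def by (subst measure_distr) auto
  qed
  also have "\<dots> = measure (distr ?P ?N (\<lambda>z. z 0)) {y. y\<^sup>2 \<le> a}"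
    by (subst measure_distr[OF m]) (simp_all add: vimage_def Int_def)
  also have "distr ?P ?N (\<lambda>z. z 0) = ?N" by (rule P.PiM_component) simp
  finally show ?thesis .
qed

text \<open>The frontier lies in {sqrt a, - sqrt a}, or is empty for negative \<open>a\<close>.
  Hence the squares converge in distribution at every level.\<close>

lemma std_normal_null_frontier: "emeasure std_normal_distribution (frontier {y. y\<^sup>2 \<le> a}) = 0"
proof -
  have cl: "closed {y::real. y\<^sup>2 \<le> a}" by (intro closed_Collect_le continuous_intros)
  have op: "open {y::real. y\<^sup>2 < a}" by (intro open_Collect_less continuous_intros)
  have "frontier {y::real. y\<^sup>2 \<le> a} \<subseteq> {y. y\<^sup>2 \<le> a} - {y. y\<^sup>2 < a}"
  proof -
    have "{y::real. y\<^sup>2 < a} \<subseteq> interior {y. y\<^sup>2 \<le> a}" by (rule interior_maximal[OF _ op]) auto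
    then show ?thesis using cl by (auto simp: frontier_def closure_closed)
  qed
  also have "\<dots> \<subseteq> {sqrt a, - sqrt a}"
  proof
    fix y assume "y \<in> {y. y\<^sup>2 \<le> a} - {y. y\<^sup>2 < a}"
    then have "y\<^sup>2 = a" by simp
    then have "sqrt a = \<bar>y\<bar>" by (metis real_sqrt_abs)
    then show "y \<in> {sqrt a, - sqrt a}" by (auto simp: abs_if split: if_splits)
  qed
  finally have "finite (frontier {y::real. y\<^sup>2 \<le> a})" by (rule finite_subset) simp
  then have "frontier {y::real. y\<^sup>2 \<le> a} \<in> null_sets lborel"
    by (simp add: finite_imp_null_set_lborel)
  moreover from this have "AE y in lborel. y \<in> frontier {y. y\<^sup>2 \<le> a} \<longrightarrow> ennreal (std_normal_density y) = 0"
    by (intro eventually_mono[OF AE_not_in]) auto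
  ultimately have "frontier {y::real. y\<^sup>2 \<le> a} \<in> null_sets std_normal_distribution"
    by (intro null_sets_density_iff[THEN iffD2] conjI) auto
  then show ?thesis by (simp add: null_sets_def)
qed

lemma (in centred_iid_sample) jel_stat_weak_limit:
  assumes "0 < sd"
  shows "weak_conv_m (\<lambda>n. distr M borel (jel_stat n)) (chi_square_measure 1)"
  unfolding weak_conv_m_def weak_conv_def
proof (intro allI impI)
  fix a assume cont: "isCont (cdf (chi_square_measure 1)) a"
  let ?H = "cdf (chi_square_measure 1)"
  have Ym: "std_sum n \<in> borel_measurable M" for n
    unfolding std_sum_def[abs_def] using proj3
    by (intro borel_measurable_divide borel_measurable_sum borel_measurable_const
        iid_f_measurable[where f = "\<lambda>x. 3 * proj x"]) auto
  have clt: "weak_conv_m (\<lambda>n. distr M borel (std_sum n)) std_normal_distribution"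
    unfolding std_sum_def[abs_def] using clt_centred[OF proj3 assms sd_square] .
  have conv: "(\<lambda>n. prob {\<omega> \<in> space M. (std_sum n \<omega>)\<^sup>2 \<le> t}) \<longlonglongrightarrow> ?H t" for t
  proof -
    have "(\<lambda>n. measure (distr M borel (std_sum n)) {y. y\<^sup>2 \<le> t}) \<longlonglongrightarrow> measure std_normal_distribution {y. y\<^sup>2 \<le> t}"
      by (rule weak_conv_imp_continuity_set_conv[OF real_distribution_distr real_dist_normal_dist clt])
         (use Ym in \<open>auto simp: std_normal_null_frontier\<close>)
    moreover have "measure (distr M borel (std_sum n)) {y. y\<^sup>2 \<le> t} = prob {\<omega> \<in> space M. (std_sum n \<omega>)\<^sup>2 \<le> t}" for n
      using Ym by (subst measure_distr) (auto intro!: arg_cong[where f = prob])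
    ultimately show ?thesis unfolding chi_square_1_cdf by simp
  qed
  have "(\<lambda>n. prob {\<omega> \<in> space M. jel_stat n \<omega> \<le> a}) \<longlonglongrightarrow> ?H a"
    by (rule cdf_square_limit[where m = 1, OF Ym jel_stat_measurable jel_stat_close_to_square[OF assms] conv cont])
  \<comment> \<open>The identification holds only eventually because measurability of the statistic
    is available from \<open>n = 1\<close> on.\<close>
  then show "(\<lambda>n. cdf (distr M borel (jel_stat n)) a) \<longlonglongrightarrow> ?H a"
  proof (rule Lim_transform_eventually)
    show "\<forall>\<^sub>F n in sequentially. prob {\<omega> \<in> space M. jel_stat n \<omega> \<le> a} = cdf (distr M borel (jel_stat n)) a"
      using eventually_ge_at_top[of 1]
      by eventually_elim
        (use jel_stat_measurable in \<open>auto simp: cdf_def measure_distr intro!: arg_cong[where f = prob]\<close>)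
  qed
qed

theorem theorem4:
  fixes M :: "'a measure"
    and X :: "'a \<Rightarrow> real"
    and Xs :: "nat \<Rightarrow> 'a \<Rightarrow> real"
    and f :: "real \<Rightarrow> real"
    and \<mu> \<sigma> :: real
  assumes "prob_space M"
    and iid_indep: "prob_space.indep_vars M (\<lambda>_. borel) Xs {1..}"
    and iid_copies: "\<And>i. i \<ge> 1 \<Longrightarrow> distr M borel (Xs i) = distr M borel X"
    and density_nonneg: "\<And>x. 0 \<le> f x"
    and abs_cont: "distributed M lborel X (\<lambda>x. ennreal (f x))"
    and A1_mean: "has_bochner_integral M X \<mu>"
    and A1_variance: "has_bochner_integral M (\<lambda>\<omega>. (X \<omega> - \<mu>)\<^sup>2) (\<sigma>\<^sup>2)"
    and A2: "\<exists>e>0. continuous_on (ball \<mu> e) f"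
    and H0: "symmetric_cdf (cdf (distr M borel X))"
  shows "weak_conv_m
           (\<lambda>n. distr M borel (\<lambda>\<omega>. - 2 * ln (adj_jel_ratio n (\<lambda>i. Xs i \<omega>))))
           (chi_square_measure 1)"
proof -
  interpret prob_space M by fact
  define D where "D = distr M borel X"
  have X [measurable]: "X \<in> borel_measurable M"
    using abs_cont by (auto simp: distributed_def)
  interpret D: real_distribution D unfolding D_def by (rule real_distribution_distr) (rule X)
  \<comment> \<open>This expression is X^2 written through the centred square.\<close>
  have "integrable M (\<lambda>\<omega>. (X \<omega> - \<mu>)\<^sup>2 + 2 * \<mu> * X \<omega> - \<mu>\<^sup>2)"
    using A1_mean A1_variance by (simp add: has_bochner_integral_iff)
  then have "integrable M (\<lambda>\<omega>. (X \<omega>)\<^sup>2)"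
    by (simp add: power2_diff algebra_simps)
  then have sq: "integrable D (\<lambda>x. x\<^sup>2)" unfolding D_def by (subst integrable_distr_eq) auto
  interpret iid_sample M Xs D
    by unfold_locales (use iid_indep iid_copies sq in \<open>auto simp: D_def\<close>)
  have atomless: "measure D {x} = 0" for x
  proof -
    have "distr M borel X = distr M lborel X" by (intro distr_cong) auto
    also have "\<dots> = density lborel (\<lambda>x. ennreal (f x))" using abs_cont by (rule distributed_distr_eq_density)
    finally have D: "D = density lborel (\<lambda>x. ennreal (f x))" by (simp add: D_def)
    have "(\<lambda>x. ennreal (f x)) \<in> borel_measurable lborel" using abs_cont by (rule distributed_borel_measurable)
    moreover have "AE y in lborel. y \<in> {x} \<longrightarrow> ennreal (f y) = 0"
      using AE_lborel_singleton[of x] by (rule eventually_mono) simp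
    ultimately have "{x} \<in> null_sets D"
      unfolding D by (intro null_sets_density_iff[THEN iffD2] conjI) auto
    then show ?thesis by (simp add: measure_def null_sets_def)
  qed
  obtain m where m: "\<And>x. cdf D (m + x) = 1 - cdf D (m - x)"
    using H0 by (auto simp: symmetric_cdf_def D_def)
  \<comment> \<open>Symmetry of the cdf about \<open>m\<close> becomes invariance of the law under
    reflection at \<open>m\<close>.\<close>
  have "distr D borel (\<lambda>x. 2 * m - x) = D"
  proof (rule cdf_unique)
    show "real_distribution (distr D borel (\<lambda>x. 2 * m - x))" by (rule D.real_distribution_distr) simp
    show "cdf (distr D borel (\<lambda>x. 2 * m - x)) = cdf D"
    proof
      fix y
      have "cdf (distr D borel (\<lambda>x. 2 * m - x)) y = measure D {2 * m - y..}"
        unfolding cdf_def by (subst measure_distr) (auto intro!: arg_cong[where f = "measure D"])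
      also have "{2 * m - y..} = space D - {..<2 * m - y}" by auto
      also have "measure D \<dots> = 1 - measure D {..<2 * m - y}" by (subst D.prob_compl) auto
      \<comment> \<open>The reflected law yields an open half-line; without atoms it has the same
        measure as the closed one.\<close>
      also have "measure D {..<2 * m - y} = cdf D (2 * m - y)"
      proof -
        have "measure D ({..<2 * m - y} \<union> {2 * m - y}) = measure D {..<2 * m - y} + measure D {2 * m - y}"
          by (subst D.finite_measure_Union) auto
        moreover have "{..<2 * m - y} \<union> {2 * m - y} = {..2 * m - y}" by auto
        ultimately show ?thesis by (simp add: cdf_def atomless)
      qed
      also have "1 - cdf D (2 * m - y) = cdf D y" using m[of "y - m"] by simp
      finally show "cdf (distr D borel (\<lambda>x. 2 * m - x)) y = cdf D y" .
    qed
  qed (rule D.real_distribution_axioms)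
  then interpret centred_iid_sample M Xs D
    by unfold_locales (rule centred_of_reflection)
  have "0 < sd" using proj_variance_pos[OF atomless] by (simp add: sd_def)
  from jel_stat_weak_limit[OF this] show ?thesis by (simp add: jel_stat_def[abs_def])
qed

end
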